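(* For $N\geq1$ let $A_N=-\operatorname{diag}(1^2,2^2,\ldots,N^2)$. (i) Fix $N$. For every sufficiently small $T>0$, all unit vectors $b_N(T)=(b_{N,1}(T),\ldots,b_{N,N}(T))\in\mathbb{R}^N$ attaining $\gamma_1(A_N,T)$ have the same squared coefficients, and, as $T\to0^+$, for all $j\in\{1,\ldots,N\}$, $$\vert b_{N,j}(T)\vert^2=w_{N,j}\Big(1+\frac{2j^2-3N+1}{4}T\Big)+\mathrm{O}(T^2),\qquad w_{N,j}=\frac{j^2\binom{2N}{N+j}}{N2^{2N-2}}.$$ The weight vector is unique, but the maximizer is not: its $N$ signs are arbitrary, giving $2^N$ maximizing vectors, or $2^{N-1}$ unoriented lines. (ii) The numbers $w_{N,j}$ are positive and $\sum_{j=1}^Nw_{N,j}=1$. As $N\to+\infty$, the probability law of $j/\sqrt N$ with weights $w_{N,j}$ converges weakly on $(0,+\infty)$ to the law with density $\frac{4}{\sqrt\pi}x^2e^{-x^2}\,dx$ (the Maxwell law with scale parameter $1/\sqrt2$, i.e. the law of $\vert Z\vert/\sqrt2$ for a standard Gaussian vector $Z\in\mathbb{R}^3$). (iii) If, for every $N$, $b_N^0=\sum_{j=1}^Nb_{N,j}^0\varphi_j$ is any profile with $\vert b_{N,j}^0\vert^2=w_{N,j}$, then $b_N^0$ converges weakly to zero in $L^2(0,\pi)$ as $N\to+\infty$, while for every fixed $j\geq1$, $$\frac{\vert b_{N,j}^0\vert}{\vert b_{N,1}^0\vert}\underset{N\to+\infty}{\longrightarrow}j.$$ (iv) A formal profile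 $b=\sum_{j\geq1}b_j\varphi_j$ with coefficient moduli $\vert b_j\vert$ proportional to $j$ (with nonzero constant) belongs to $H_D^{-s}$ if and only if $s>3/2$. (v) One has $$\delta_N(A_N)=\frac{(2N)!}{N2^{2N-1}},\qquad\alpha_N(A_N)=-\frac{3N-1}{2}.$$ Consequently, for every fixed $N$, as $T\to0^+$, $$\rho_1(A_N,T)=\frac{N(2N-1)((N-1)!)^2}{16^{N-1}}T^{2N-2}\Big(1+\frac{(N-1)(N-2)}{3}T+\mathrm{O}(T^2)\Big).$$
   Context: $\varphi_j(x)=\sqrt{2/\pi}\,\sin(jx)$, $j\geq1$, is the Dirichlet eigenbasis on $(0,\pi)$; a vector $(b_1,\ldots,b_N)$ is identified with the profile $\sum_jb_j\varphi_j$. For a formal series $b=\sum_{j\geq1}b_j\varphi_j$ and $s\in\mathbb{R}$, $b\in H_D^{-s}$ means $\sum_{j\geq1}j^{-2s}\vert b_j\vert^2<+\infty$. For $A\in\mathbb{R}^{n\times n}$, $T>0$: $G_T(A,b)=\int_0^Te^{tA}bb^\top e^{tA^\top}dt$, $\gamma_1(A,T)=\max_{\Vert b\Vert=1}\lambda_{\min}(G_T(A,b))$ over $b\in\mathbb{R}^n$, $\gamma_{\mathrm{rel}}(A,T)=\max_{X\succeq0,\ \operatorname{tr}X=1}\lambda_{\min}\big(\int_0^Te^{tA}Xe^{tA^\top}dt\big)$ over real symmetric $X$, and $\rho_1=\gamma_1/\gamma_{\mathrm{rel}}$. A vector $b$ is cyclic for $A$ if $\operatorname{span}(b,Ab,\ldots,A^{n-1}b)=\mathbb{R}^n$.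 For a unit cyclic vector $b$, $d_n(A,b)=\operatorname{dist}(A^{n-1}b,\operatorname{span}(b,\ldots,A^{n-2}b))$ (the span being $\{0\}$ when $n=1$); $d_n(A,b)=0$ for a unit vector that is not cyclic. $\delta_n(A)=\max_{\Vert b\Vert=1}d_n(A,b)$. For cyclic $b$, $q_n(A,b)$ is the last column of $Q$ in the QR factorization $(b,Ab,\ldots,A^{n-1}b)=QR$ with positive diagonal in $R$, and $\alpha_n(A)=\max\{q_n(A,b)^\top Aq_n(A,b)\mid\Vert b\Vert=1,\ d_n(A,b)=\delta_n(A)\}$ (for $A$ admitting a cyclic vector). Here these are used with $n=N$. *)

theory Defs
  imports
    "HOL-Probability.Probability"
    "HOL-Library.Landau_Symbols"
    "Jordan_Normal_Form.VS_Connect"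
    "Jordan_Normal_Form.Spectral_Radius"
begin

no_notation inner (infixl \<open>\<bullet>\<close> 70)
no_notation vec_nth (infixl \<open>$\<close> 90)
hide_type (open) Finite_Cartesian_Product.vec
hide_const (open) Finite_Cartesian_Product.vec Finite_Cartesian_Product.mat

text \<open>
  Vectors of \<open>\<real>\<^sup>n\<close> and \<open>n \<times> n\<close> matrices are elements of \<open>carrier_vec n\<close> and \<open>carrier_mat n n\<close>,
  since the dimension tends to infinity in the statement. They are indexed from \<open>0\<close>; the
  function \<open>coef\<close> restores the indexing from \<open>1\<close>.
\<close>

definition coef :: "real vec \<Rightarrow> nat \<Rightarrow> real" where
  "coef b j = b $ (j - 1)"

definition enorm :: "real vec \<Rightarrow> real" where
  "enorm v = sqrt (v \<bullet> v)"

definition unit_sphere :: "nat \<Rightarrow> real vec set" where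
  "unit_sphere n = {b \<in> carrier_vec n. enorm b = 1}"

definition line_through :: "real vec \<Rightarrow> real vec set" where
  "line_through b = {c \<cdot>\<^sub>v b | c. True}"

text \<open>
  A maximum, not a supremum: the value is unspecified unless it is attained.
\<close>

definition max_over :: "'a set \<Rightarrow> ('a \<Rightarrow> real) \<Rightarrow> real" where
  "max_over S f = (GREATEST y. y \<in> f ` S)"


subsection \<open>Gramians\<close>

definition mat_exp :: "real mat \<Rightarrow> real mat" where
  "mat_exp A = mat (dim_row A) (dim_row A) (\<lambda>(i, j). \<Sum>k. (A ^\<^sub>m k) $$ (i, j) / fact k)"

definition gramian :: "real mat \<Rightarrow> real \<Rightarrow> real mat \<Rightarrow> real mat" where
  "gramian A T X = mat (dim_row A) (dim_row A)
     (\<lambda>(i, j). integral {0..T}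
        (\<lambda>t. (mat_exp (t \<cdot>\<^sub>m A) * X * mat_exp (t \<cdot>\<^sub>m transpose_mat A)) $$ (i, j)))"

definition outer_square :: "real vec \<Rightarrow> real mat" where
  "outer_square b = mat (dim_vec b) (dim_vec b) (\<lambda>(i, j). b $ i * b $ j)"

definition rank1_gramian :: "real mat \<Rightarrow> real \<Rightarrow> real vec \<Rightarrow> real mat" where
  "rank1_gramian A T b = gramian A T (outer_square b)"

definition lambda_min :: "real mat \<Rightarrow> real" where
  "lambda_min M = Min (spectrum M)"

definition gamma1 :: "real mat \<Rightarrow> real \<Rightarrow> real" where
  "gamma1 A T = max_over (unit_sphere (dim_row A)) (\<lambda>b. lambda_min (rank1_gramian A T b))"

definition gamma1_maximizers :: "real mat \<Rightarrow> real \<Rightarrow> real vec set" where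
  "gamma1_maximizers A T =
     {b \<in> unit_sphere (dim_row A). lambda_min (rank1_gramian A T b) = gamma1 A T}"

definition mat_trace :: "real mat \<Rightarrow> real" where
  "mat_trace X = (\<Sum>i<dim_row X. X $$ (i, i))"

definition psd :: "nat \<Rightarrow> real mat set" where
  "psd n = {X \<in> carrier_mat n n. transpose_mat X = X \<and>
     (\<forall>v\<in>carrier_vec n. 0 \<le> v \<bullet> (X *\<^sub>v v))}"

definition gamma_rel :: "real mat \<Rightarrow> real \<Rightarrow> real" where
  "gamma_rel A T =
     max_over {X \<in> psd (dim_row A). mat_trace X = 1} (\<lambda>X. lambda_min (gramian A T X))"

definition rho1 :: "real mat \<Rightarrow> real \<Rightarrow> real" where
  "rho1 A T = gamma1 A T / gamma_rel A T"


subsection \<open>Krylov quantities\<close>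

definition vspan :: "nat \<Rightarrow> real vec set \<Rightarrow> real vec set" where
  "vspan n S = LinearCombinations.module.span class_ring (module_vec TYPE(real) n) S"

definition krylov_vec :: "real mat \<Rightarrow> real vec \<Rightarrow> nat \<Rightarrow> real vec" where
  "krylov_vec A b k = (A ^\<^sub>m k) *\<^sub>v b"

definition cyclic :: "real mat \<Rightarrow> real vec \<Rightarrow> bool" where
  "cyclic A b \<longleftrightarrow> b \<in> carrier_vec (dim_row A) \<and>
     vspan (dim_row A) (krylov_vec A b ` {..<dim_row A}) = carrier_vec (dim_row A)"

definition vec_dist :: "real vec \<Rightarrow> real vec set \<Rightarrow> real" where
  "vec_dist v S = (INF s\<in>S. enorm (v - s))"

definition d_last :: "real mat \<Rightarrow> real vec \<Rightarrow> real" where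
  "d_last A b = (if cyclic A b
     then vec_dist (krylov_vec A b (dim_row A - 1))
            (vspan (dim_row A) (krylov_vec A b ` {..<dim_row A - 1}))
     else 0)"

definition delta_max :: "real mat \<Rightarrow> real" where
  "delta_max A = max_over (unit_sphere (dim_row A)) (d_last A)"

definition krylov_mat :: "real mat \<Rightarrow> real vec \<Rightarrow> real mat" where
  "krylov_mat A b = mat_of_cols (dim_row A) (map (krylov_vec A b) [0..<dim_row A])"

definition is_pos_QR :: "real mat \<Rightarrow> real mat \<Rightarrow> real mat \<Rightarrow> bool" where
  "is_pos_QR K Q R \<longleftrightarrow>
     Q \<in> carrier_mat (dim_row K) (dim_row K) \<and> transpose_mat Q * Q = 1\<^sub>m (dim_row K) \<and>
     R \<in> carrier_mat (dim_row K) (dim_row K) \<and> upper_triangular R \<and>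
     (\<forall>i<dim_row K. 0 < R $$ (i, i)) \<and> K = Q * R"

definition q_last :: "real mat \<Rightarrow> real vec \<Rightarrow> real vec" where
  "q_last A b = (THE q. \<exists>Q R. is_pos_QR (krylov_mat A b) Q R \<and> q = col Q (dim_row A - 1))"

definition alpha_max :: "real mat \<Rightarrow> real" where
  "alpha_max A = max_over {b \<in> unit_sphere (dim_row A). d_last A b = delta_max A}
     (\<lambda>b. q_last A b \<bullet> (A *\<^sub>v q_last A b))"


subsection \<open>The truncated Dirichlet Laplacian and its weights\<close>

definition A_dir :: "nat \<Rightarrow> real mat" where
  "A_dir N = mat_diag N (\<lambda>i. - (real (i + 1))\<^sup>2)"

definition weight :: "nat \<Rightarrow> nat \<Rightarrow> real" where
  "weight N j = (real j)\<^sup>2 * real ((2 * N) choose (N + j)) / (real N * 2 ^ (2 * N - 2))"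

definition phi :: "nat \<Rightarrow> real \<Rightarrow> real" where
  "phi j x = sqrt (2 / pi) * sin (real j * x)"

definition profile :: "real vec \<Rightarrow> real \<Rightarrow> real" where
  "profile b x = (\<Sum>j = 1..dim_vec b. coef b j * phi j x)"

text \<open>
  Formal series \<open>b = \<Sum>j\<ge>1. b\<^sub>j \<phi>\<^sub>j\<close> are given by their coefficient sequence; the value at
  \<open>0\<close> plays no role.
\<close>

definition H_D_minus :: "real \<Rightarrow> (nat \<Rightarrow> real) set" where
  "H_D_minus s = {b. summable (\<lambda>k. real (Suc k) powr (- 2 * s) * \<bar>b (Suc k)\<bar>\<^sup>2)}"


subsection \<open>Weak convergence\<close>

definition L2_on :: "real set \<Rightarrow> (real \<Rightarrow> real) set" where
  "L2_on S = {f \<in> borel_measurable (lebesgue_on S). integrable (lebesgue_on S) (\<lambda>x. (f x)\<^sup>2)}"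

definition weak_conv_L2 :: "real set \<Rightarrow> (nat \<Rightarrow> real \<Rightarrow> real) \<Rightarrow> (real \<Rightarrow> real) \<Rightarrow> bool" where
  "weak_conv_L2 S F f \<longleftrightarrow> (\<forall>n. F n \<in> L2_on S) \<and> f \<in> L2_on S \<and>
     (\<forall>g\<in>L2_on S. (\<lambda>n. LINT x|lebesgue_on S. F n x * g x)
        \<longlonglongrightarrow> (LINT x|lebesgue_on S. f x * g x))"

definition weak_conv_on :: "real set \<Rightarrow> (nat \<Rightarrow> real measure) \<Rightarrow> real measure \<Rightarrow> bool" where
  "weak_conv_on S \<mu> \<nu> \<longleftrightarrow>
     (\<forall>f :: real \<Rightarrow> real. continuous_on S f \<longrightarrow> bounded (f ` S) \<longrightarrow>
        (\<lambda>n. LINT x:S|\<mu> n. f x) \<longlonglongrightarrow> (LINT x:S|\<nu>. f x))"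

definition weight_law :: "nat \<Rightarrow> real measure" where
  "weight_law N = distr (point_measure {1..N} (\<lambda>j. ennreal (weight N j))) borel
     (\<lambda>j. real j / sqrt (real N))"

definition maxwell_law :: "real measure" where
  "maxwell_law = density lborel
     (\<lambda>x. ennreal (indicator {0<..} x * (4 / sqrt pi * x\<^sup>2 * exp (- x\<^sup>2))))"

text \<open>The standard Gaussian law on \<open>\<real>\<^sup>3\<close>, as the product of three standard normal laws.\<close>

definition gauss3 :: "(nat \<Rightarrow> real) measure" where
  "gauss3 = PiM {..<3} (\<lambda>_. density lborel (\<lambda>x. ennreal (std_normal_density x)))"

end

theory Submission
  imports Defs "HOL-Real_Asymp.Real_Asymp"
begin

text \<open>
  Write \<open>l i\<close> for the eigenvalues of \<open>- A_dir N\<close>. The Gramian of \<open>b\<close> is \<open>D E D\<close> with \<open>D = diag b\<close> and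
  \<open>E\<close> the Gram matrix of the exponentials \<open>exp (- l i t)\<close> on \<open>{0..T}\<close>. If the inverse \<open>M\<close> of \<open>E\<close> has the sign
  pattern \<open>s i * s j\<close> with \<open>s i\<close> of modulus 1, the optimisation over \<open>b\<close> is explicit: with \<open>r i\<close> the sum of the
  absolute values of the \<open>i\<close>-th row of \<open>M\<close> and \<open>R\<close> the sum of the \<open>r i\<close>, the test vector \<open>(M s) / b\<close> bounds the
  least eigenvalue by \<open>1 / R\<close>, with equality only if \<open>b i ^ 2 = r i / R\<close>, and for this \<open>b\<close> the bound is
  attained since \<open>E\<close> dominates \<open>diag (1 / r)\<close>. For the relaxed problem diagonal \<open>X\<close> suffice.

  For small \<open>T\<close>, centring the time interval reduces \<open>E\<close> to the Gram matrix of \<open>exp (l i t)\<close> on \<open>{-h..h}\<close>,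
  \<open>h = T / 2\<close>. In the basis of divided differences, suitably scaled, this matrix is analytic in \<open>h\<close>, and its value
  at \<open>h = 0\<close> is the Gram matrix of the monomials \<open>t ^ k / k!\<close> on \<open>{-1..1}\<close>, whose inverse is read off the
  Legendre polynomials. So \<open>h ^ (2 N - 1)\<close> times the inverse of the centred matrix is analytic in \<open>h\<close>; its value
  at \<open>h = 0\<close> is a multiple of \<open>v i * v j\<close> with \<open>v i\<close> the weights of the divided difference at the nodes \<open>l i\<close>,
  and being even it has no linear term. Since \<open>\<bar>v i\<bar>\<close> is proportional to \<open>weight N (i + 1)\<close> and the signs of \<open>v i\<close>
  alternate, the expansions follow from the second and fourth moments of the symmetric binomial distribution.

  The vector \<open>v / b\<close> is orthogonal to all Krylov vectors but the last, which determines \<open>d_last\<close> and \<open>q_last\<close>.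
  The limit law follows from a local limit theorem for the central binomial coefficients (Wallis' product)
  by dominated convergence of step densities.
\<close>

section \<open>Legendre polynomials and the Gram matrix of monomials\<close>

text \<open>Maximising the least eigenvalue over \<open>b\<close> is not a concave problem. The sign
  pattern of \<open>M\<close> removes this obstacle: scaled by \<open>b\<close>, the test vector
  always becomes the same vector \<open>M s\<close>, so completing a sum of squares replaces the
  minimax. The same completion, with \<open>total_weight N * weight N\<close> in place of
  \<open>r\<close>, settles the maximisation of \<open>d_last\<close>, which is why the leading
  profile is the Krylov-optimal one. As \<open>T\<close> tends to 0 the exponentials merge and
  \<open>E\<close> degenerates. The combination behaving like \<open>t ^ k / k!\<close> has squared
  norm of order \<open>h ^ (2 * k + 1)\<close>, so the inverse is governed by the last one,
  \<open>k = N - 1\<close>. Hence its leading part is of rank one, and as it has no zero entry its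
  signs persist for small \<open>T\<close>. In the inverse, centring costs only the factor
  \<open>exp ((l i + l j) * T / 2)\<close>. Since the rest has no linear term, this factor alone
  produces the first-order terms of the squared coefficients and of \<open>gamma1\<close>.\<close>

definition cint :: "real poly \<Rightarrow> real" where
  "cint p = integral {-1..1} (poly p)"

lemma cint_0 [simp]: "cint 0 = 0"
  by (simp add: cint_def poly_0[abs_def])

lemma cint_add: "cint (p + q) = cint p + cint q"
  unfolding cint_def poly_add
  by (intro integral_add integrable_continuous_real continuous_intros)

lemma cint_smult: "cint (Polynomial.smult c p) = c * cint p"
  unfolding cint_def poly_smult by simp

lemma cint_sum: "cint (\<Sum>i\<in>I. f i) = (\<Sum>i\<in>I. cint (f i))"
proof (induction I rule: infinite_finite_induct)
  case (insert x F)
  then show ?case by (simp add: cint_add)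
qed simp_all

lemma cint_pderiv: "cint (pderiv p) = poly p 1 - poly p (-1)"
proof -
  have "(poly (pderiv p) has_integral poly p 1 - poly p (-1)) {-1..1}"
  proof (rule fundamental_theorem_of_calculus)
    fix x :: real
    show "(poly p has_vector_derivative poly (pderiv p) x) (at x within {-1..1})"
      unfolding has_real_derivative_iff_has_vector_derivative[symmetric]
      by (rule has_field_derivative_at_within) (rule poly_DERIV)
  qed simp
  then show ?thesis unfolding cint_def by (rule integral_unique)
qed

lemma cint_parts:
  "cint (q * pderiv p) = poly q 1 * poly p 1 - poly q (-1) * poly p (-1) - cint (pderiv q * p)"
proof -
  have "cint (pderiv (q * p)) = cint (q * pderiv p) + cint (pderiv q * p)"
    by (simp add: pderiv_mult cint_add[symmetric] algebra_simps)
  then show ?thesis by (simp add: cint_pderiv)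
qed

lemma cint_monom: "cint (monom 1 k) = (1 + (-1) ^ k) / real (Suc k)"
proof -
  have "cint (pderiv (monom (1 / real (Suc k)) (Suc k))) = (1 + (-1) ^ k) / real (Suc k)"
    by (simp add: cint_pderiv poly_monom field_simps)
  then show ?thesis by (simp add: pderiv_monom del: of_nat_Suc)
qed

text \<open>A continuous nonnegative integrand with zero integral vanishes on the whole interval,
  and a polynomial with infinitely many roots is 0. This is the positive definiteness behind
  \<open>moment_mat_nonsingular\<close>.\<close>

lemma cint_square_eq_0:
  assumes "cint (p * p) = 0" shows "p = 0"
proof -
  have "integral {-1..1} (\<lambda>x. poly p x * poly p x) = 0"
    using assms by (simp add: cint_def poly_mult[abs_def])
  moreover have "continuous_on {-1..1} (\<lambda>x. poly p x * poly p x)" by (intro continuous_intros)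
  ultimately have "\<forall>x\<in>{-1..1}. poly p x * poly p x = 0"
    by (subst (asm) integral_eq_0_iff) auto
  then have "{-1..1} \<subseteq> {x. poly p x = 0}" by auto
  moreover have "infinite {-1..1::real}" by (rule infinite_Icc) simp
  ultimately show ?thesis using poly_roots_finite[of p] finite_subset by blast
qed

lemma power_dvd_pderiv:
  fixes p :: "real poly"
  assumes "[:-a, 1:] ^ m dvd p"
  shows "[:-a, 1:] ^ (m - 1) dvd pderiv p"
proof (cases m)
  case (Suc k)
  obtain q where q: "p = [:-a, 1:] ^ Suc k * q" using assms Suc by (auto elim: dvdE)
  have "pderiv p = [:-a, 1:] ^ k * (Polynomial.smult (real (Suc k)) q + [:-a, 1:] * pderiv q)"
    unfolding q pderiv_mult pderiv_power_Suc by (simp add: pderiv_pCons algebra_simps del: of_nat_Suc)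
  then show ?thesis using Suc by simp
qed simp

lemma power_dvd_higher_pderiv:
  fixes p :: "real poly"
  assumes "[:-a, 1:] ^ m dvd p"
  shows "[:-a, 1:] ^ (m - j) dvd (pderiv ^^ j) p"
proof (induction j)
  case (Suc j)
  from power_dvd_pderiv[OF Suc] show ?case by simp
qed (use assms in simp)

text \<open>Up to normalisation, \<open>(pderiv ^^ n) (rodrigues n)\<close> is the Legendre polynomial of degree \<open>n\<close>.\<close>

definition rodrigues :: "nat \<Rightarrow> real poly" where
  "rodrigues n = [:-1, 0, 1:] ^ n"

lemma rodrigues_factor: "rodrigues n = [:-1, 1:] ^ n * [:- (-1), 1:] ^ n"
  unfolding rodrigues_def power_mult_distrib[symmetric] by simp

text \<open>Both end points are roots of \<open>rodrigues n\<close> of multiplicity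
  \<open>n\<close>, and a derivative lowers the multiplicity by at most one. These are the boundary
  terms of the integrations by parts below.\<close>

lemma higher_pderiv_rodrigues_eq_0:
  assumes "j < n" "a = 1 \<or> a = -1"
  shows "poly ((pderiv ^^ j) (rodrigues n)) a = 0"
proof -
  have "[:-a, 1:] ^ n dvd rodrigues n"
    using assms(2) unfolding rodrigues_factor by auto
  from power_dvd_higher_pderiv[OF this, of j]
  have "[:-a, 1:] dvd (pderiv ^^ j) (rodrigues n)"
    using assms(1) by (meson dvd_power_le dvd_trans dvd_power zero_less_diff)
  then show ?thesis by (simp add: poly_eq_0_iff_dvd)
qed

text \<open>Repeated integration by parts; the induction generalises over \<open>q\<close> because
  \<open>q\<close> is differentiated on the way. For \<open>j = n\<close> every \<open>q\<close> of
  degree below \<open>n\<close> is annihilated, which is the orthogonality of the Legendre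
  polynomial.\<close>

lemma cint_mult_higher_pderiv_rodrigues:
  "j \<le> n \<Longrightarrow> cint (q * (pderiv ^^ j) (rodrigues n)) = (-1) ^ j * cint ((pderiv ^^ j) q * rodrigues n)"
proof (induction j arbitrary: q)
  case (Suc j)
  have "cint (q * (pderiv ^^ Suc j) (rodrigues n)) = - cint (pderiv q * (pderiv ^^ j) (rodrigues n))"
    using Suc.prems by (simp add: cint_parts higher_pderiv_rodrigues_eq_0)
  also have "\<dots> = (-1) ^ Suc j * cint ((pderiv ^^ j) (pderiv q) * rodrigues n)"
    using Suc by simp
  finally show ?case by (simp add: funpow_swap1)
qed simp

text \<open>Recursion in \<open>n\<close>: the derivative of x (x^2 - 1)^(n + 1) is (2 n + 3) (x^2 -
  1)^(n + 1) + (2 n + 2) (x^2 - 1)^n, and its integral is 0 because x^2 - 1 vanishes at both end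
  points.\<close>

lemma cint_rodrigues:
  "(-1) ^ n * cint (rodrigues n) = 2 ^ (2 * n + 1) * (fact n)\<^sup>2 / fact (2 * n + 1)"
proof (induction n)
  case 0
  show ?case using cint_monom[of 0] by (simp add: rodrigues_def one_pCons monom_0)
next
  case (Suc n)
  have "pderiv ([:0, 1:] * rodrigues (Suc n)) =
      Polynomial.smult (real (2 * n + 3)) (rodrigues (Suc n)) + Polynomial.smult (real (2 * n + 2)) (rodrigues n)"
  proof (rule poly_ext)
    fix x :: real
    have "poly (pderiv ([:0, 1:] * rodrigues (Suc n))) x =
        (x\<^sup>2 - 1) ^ Suc n + x * (real (Suc n) * (x\<^sup>2 - 1) ^ n * (2 * x))"
      unfolding rodrigues_def pderiv_mult pderiv_power_Suc
      by (simp add: pderiv_pCons poly_power power2_eq_square algebra_simps del: power_Suc)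
    then show "poly (pderiv ([:0, 1:] * rodrigues (Suc n))) x =
      poly (Polynomial.smult (real (2 * n + 3)) (rodrigues (Suc n)) + Polynomial.smult (real (2 * n + 2)) (rodrigues n)) x"
      by (simp add: rodrigues_def poly_power power2_eq_square algebra_simps)
  qed
  then have "cint (Polynomial.smult (real (2 * n + 3)) (rodrigues (Suc n)) + Polynomial.smult (real (2 * n + 2)) (rodrigues n)) = 0"
    using cint_pderiv[of "[:0, 1:] * rodrigues (Suc n)"]
      higher_pderiv_rodrigues_eq_0[of 0 "Suc n" 1] higher_pderiv_rodrigues_eq_0[of 0 "Suc n" "-1"]
    by (simp add: mult.commute del: mult_pCons_left)
  then have "real (2 * n + 3) * cint (rodrigues (Suc n)) = - (real (2 * n + 2) * cint (rodrigues n))"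
    by (simp add: cint_add cint_smult)
  then have "(-1) ^ Suc n * (real (2 * n + 3) * cint (rodrigues (Suc n)))
      = (-1) ^ Suc n * - (real (2 * n + 2) * cint (rodrigues n))"
    by (simp only:)
  then have "real (2 * n + 3) * ((-1) ^ Suc n * cint (rodrigues (Suc n)))
      = real (2 * n + 2) * ((-1) ^ n * cint (rodrigues n))"
    by (simp only: power_Suc) (simp only: mult_minus_left mult_minus_right minus_minus mult_1_left mult.left_commute)
  also have "\<dots> = real (2 * n + 2) * (2 ^ (2 * n + 1) * (fact n)\<^sup>2 / fact (2 * n + 1))"
    by (simp only: Suc)
  also have "\<dots> = real (2 * n + 3) * (2 ^ (2 * Suc n + 1) * (fact (Suc n))\<^sup>2 / fact (2 * Suc n + 1))"
  proof -
    have f: "fact (2 * Suc n + 1) = (real (2 * n + 3) * real (2 * n + 2)) * fact (2 * n + 1)"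
      by (simp add: algebra_simps)
    have g: "(fact (Suc n) :: real) = real (n + 1) * fact n" by simp
    have p: "(2::real) ^ (2 * Suc n + 1) = 4 * 2 ^ (2 * n + 1)" by simp
    have nz: "real (2 * n + 3) \<noteq> 0" "real (2 * n + 2) \<noteq> 0" by auto
    show ?thesis unfolding f g p using nz
      by (simp add: divide_simps power2_eq_square del: of_nat_add of_nat_mult) (simp add: algebra_simps)
  qed
  finally show ?case using of_nat_0_less_iff[of "2 * n + 3", where 'a=real]
    by (metis mult_left_cancel less_irrefl add_gr_0 zero_less_numeral)
qed

definition moment_mat :: "nat \<Rightarrow> real mat" where
  "moment_mat N = mat N N (\<lambda>(k, l). (1 + (-1) ^ (k + l)) / (real (Suc (k + l)) * fact k * fact l))"

lemma poly_sum_monom: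
  fixes p :: "real poly"
  assumes "degree p < N" shows "p = (\<Sum>l<N. Polynomial.smult (coeff p l) (monom 1 l))"
proof -
  have "p = (\<Sum>l\<le>N - 1. monom (coeff p l) l)"
    using assms by (intro poly_as_sum_of_monoms'[symmetric]) simp
  also have "{..N - 1} = {..<N}" using assms by auto
  finally show ?thesis by (simp add: smult_monom)
qed

lemma cint_monom_mult:
  assumes "degree p < N"
  shows "cint (monom 1 k * p) = (\<Sum>l<N. coeff p l * ((1 + (-1) ^ (k + l)) / real (Suc (k + l))))"
proof -
  have "monom 1 k * p = (\<Sum>l<N. Polynomial.smult (coeff p l) (monom 1 (k + l)))"
    by (subst poly_sum_monom[OF assms]) (simp add: sum_distrib_left mult_monom)
  then show ?thesis by (simp add: cint_sum cint_smult cint_monom)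
qed

text \<open>A kernel vector gives, up to factorials, the coefficients of a polynomial of degree
  below \<open>N\<close> that is orthogonal to all monomials of degree below \<open>N\<close>, hence
  to itself.\<close>

lemma moment_mat_nonsingular: "det (moment_mat N) \<noteq> 0"
proof
  assume "det (moment_mat N) = 0"
  then obtain z where z: "z \<in> carrier_vec N" "z \<noteq> 0\<^sub>v N" "moment_mat N *\<^sub>v z = 0\<^sub>v N"
    using det_0_iff_vec_prod_zero[of "moment_mat N" N] by (auto simp: moment_mat_def)
  define q where "q = (\<Sum>l<N. monom (z $ l / fact l) l)"
  have cq: "coeff q l = (if l < N then z $ l / fact l else 0)" for l
    unfolding q_def by (simp add: coeff_sum)
  have N: "N > 0" using z by (cases N) auto
  have dq: "degree q < N" using cq N by (intro degree_lessI) auto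
  have "cint (monom 1 k * q) = 0" if "k < N" for k
  proof -
    have "0 = (moment_mat N *\<^sub>v z) $ k" using z(3) that by (simp only: index_zero_vec)
    also have "\<dots> = (\<Sum>l<N. (1 + (-1) ^ (k + l)) / (real (Suc (k + l)) * fact k * fact l) * z $ l)"
      using z(1) that by (simp add: moment_mat_def scalar_prod_def lessThan_atLeast0)
    also have "\<dots> = cint (monom 1 k * q) / fact k"
      unfolding cint_monom_mult[OF dq] sum_divide_distrib
      by (intro sum.cong) (auto simp: cq mult_ac)
    finally show ?thesis by simp
  qed
  then have "cint (q * q) = 0"
    by (subst poly_sum_monom[OF dq]) (simp add: sum_distrib_right cint_sum cint_smult)
  then have "q = 0" by (rule cint_square_eq_0)
  then have "z $ l = 0" if "l < N" for l using cq[of l] that by simp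
  then have "z = 0\<^sub>v N" using z(1) by auto
  then show False using z(2) by simp
qed

text \<open>Reciprocal of the squared L2 distance on {-1..1} from t^n / n! to the polynomials of
  degree below n; equivalently, the last diagonal entry of the inverse of
  \<open>moment_mat (Suc n)\<close>.\<close>

definition gram_const :: "nat \<Rightarrow> real" where
  "gram_const n = fact (2 * n) * fact (2 * n + 1) / (2 ^ (2 * n + 1) * (fact n)\<^sup>2)"

text \<open>Orthogonality of the Legendre polynomial to lower powers says that its coefficients,
  rescaled by factorials, are mapped to a multiple of the last unit vector. So \<open>y\<close> is
  the last column of the inverse, and its last entry is all that survives in
  \<open>dual_gram_0\<close>.\<close>

lemma moment_mat_last_unit_vec:
  "\<exists>y\<in>carrier_vec (Suc n). moment_mat (Suc n) *\<^sub>v y = unit_vec (Suc n) n \<and> y $ n = gram_const n"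
proof -
  define R where "R = (pderiv ^^ n) (rodrigues n)"
  define I where "I = (-1) ^ n * cint (rodrigues n)"
  define y where "y = vec (Suc n) (\<lambda>l. fact l * coeff R l / I)"
  have I: "I = 2 ^ (2 * n + 1) * (fact n)\<^sup>2 / fact (2 * n + 1)" unfolding I_def by (rule cint_rodrigues)
  then have I0: "I > 0" by simp
  have deg: "degree (rodrigues n) = 2 * n" unfolding rodrigues_def by (simp add: degree_power_eq)
  have "coeff (rodrigues n) (2 * n) = 1"
    using lead_coeff_power[of "[:-1, 0, 1:] :: real poly" n] deg by (simp add: rodrigues_def)
  then have Rn: "coeff R n = fact (2 * n) / fact n"
    unfolding R_def by (simp add: coeff_higher_pderiv pochhammer_fact mult_2 add.commute)
      (metis pochhammer_product' pochhammer_fact fact_nonzero nonzero_mult_div_cancel_left add.commute of_nat_1 plus_1_eq_Suc of_nat_add)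
  have dR: "degree R < Suc n" unfolding R_def using deg
    by (simp add: degree_higher_pderiv)
  have L: "cint (monom 1 k * R) = (if k = n then fact n * I else 0)" if "k \<le> n" for k
  proof -
    have "(pderiv ^^ n) (monom 1 k) = (if k = n then [:fact n:] else (0::real poly))"
      using that by (intro poly_eqI) (auto simp: coeff_higher_pderiv pochhammer_fact coeff_pCons split: nat.splits)
    then show ?thesis unfolding R_def I_def
      by (simp add: cint_mult_higher_pderiv_rodrigues cint_smult)
  qed
  have "(moment_mat (Suc n) *\<^sub>v y) $ k = unit_vec (Suc n) n $ k" if k: "k < Suc n" for k
  proof -
    have "(moment_mat (Suc n) *\<^sub>v y) $ k
       = (\<Sum>l<Suc n. (1 + (-1) ^ (k + l)) / (real (Suc (k + l)) * fact k * fact l) * y $ l)"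
      using k by (simp add: moment_mat_def scalar_prod_def lessThan_atLeast0 y_def)
    also have "\<dots> = cint (monom 1 k * R) / (fact k * I)"
      unfolding cint_monom_mult[OF dR] sum_divide_distrib
      using I0 by (intro sum.cong) (auto simp: y_def mult_ac)
    finally show ?thesis using I0 k L[of k] by auto
  qed
  moreover have "y $ n = gram_const n"
    unfolding y_def gram_const_def I by (simp add: Rn)
  ultimately show ?thesis
    by (intro bexI[of _ y]) (auto simp: y_def moment_mat_def)
qed

section \<open>Gram matrices of exponentials on short intervals\<close>

definition lagrange :: "nat \<Rightarrow> (nat \<Rightarrow> real) \<Rightarrow> nat \<Rightarrow> real poly" where
  "lagrange N l i = (\<Prod>j\<in>{..<N} - {i}. Polynomial.smult (1 / (l i - l j)) [:- l j, 1:])"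

text \<open>Row \<open>k\<close> holds the weights of the functional that takes values at the nodes
  to the coefficient of x^k in the interpolating polynomial. For \<open>k = N - 1\<close> this is
  the divided difference.\<close>

definition vdm_inv :: "nat \<Rightarrow> (nat \<Rightarrow> real) \<Rightarrow> nat \<Rightarrow> nat \<Rightarrow> real" where
  "vdm_inv N l k i = coeff (lagrange N l i) k"

definition divdiff_weight :: "nat \<Rightarrow> (nat \<Rightarrow> real) \<Rightarrow> nat \<Rightarrow> real" where
  "divdiff_weight N l i = 1 / (\<Prod>j\<in>{..<N} - {i}. l i - l j)"

lemma lagrange_alt:
  "lagrange N l i = Polynomial.smult (divdiff_weight N l i) (\<Prod>j\<in>{..<N} - {i}. [:- l j, 1:])"
proof -
  have "(\<Prod>j\<in>I. Polynomial.smult (c j) (p j)) = Polynomial.smult (\<Prod>j\<in>I. c j) (\<Prod>j\<in>I. p j)"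
    if "finite I" for I :: "nat set" and c :: "nat \<Rightarrow> real" and p
    using that by (induction I rule: finite_induct) (simp_all add: mult.commute)
  then show ?thesis unfolding lagrange_def divdiff_weight_def
    by (simp only: finite_Diff finite_lessThan prod_dividef prod.neutral_const)
qed

lemma degree_lagrange:
  assumes "i < N" shows "degree (lagrange N l i) < N"
proof -
  have "degree (\<Prod>j\<in>{..<N} - {i}. [:- l j, 1:]) \<le> (\<Sum>j\<in>{..<N} - {i}. 1)"
    by (rule order.trans[OF degree_prod_sum_le]) auto
  also have "\<dots> = N - 1" using assms by simp
  finally have "degree (\<Prod>j\<in>{..<N} - {i}. [:- l j, 1:]) \<le> N - 1" .
  with degree_smult_le[of "divdiff_weight N l i" "\<Prod>j\<in>{..<N} - {i}. [:- l j, 1:]"]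
  have "degree (lagrange N l i) \<le> N - 1" unfolding lagrange_alt by (rule order.trans)
  then show ?thesis using assms by linarith
qed

lemma poly_lagrange:
  assumes "inj_on l {..<N}" "i < N" "j < N"
  shows "poly (lagrange N l i) (l j) = (if i = j then 1 else 0)"
proof (cases "i = j")
  case True
  then show ?thesis using assms
    by (auto simp: lagrange_def poly_prod diff_divide_distrib[symmetric] inj_on_eq_iff intro!: prod.neutral)
next
  case False
  then show ?thesis using assms
    by (auto simp: lagrange_def poly_prod diff_divide_distrib[symmetric] intro!: bexI[of _ j])
qed

lemma vdm_inv_right:
  assumes "inj_on l {..<N}" "i < N" "j < N"
  shows "(\<Sum>k<N. l j ^ k * vdm_inv N l k i) = (if i = j then 1 else 0)"
proof -
  have "poly (lagrange N l i) (l j) = (\<Sum>k\<le>degree (lagrange N l i). coeff (lagrange N l i) k * l j ^ k)"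
    by (rule poly_altdef)
  also have "\<dots> = (\<Sum>k<N. coeff (lagrange N l i) k * l j ^ k)"
    using degree_lagrange[OF assms(2), of l] by (intro sum.mono_neutral_left) (auto simp: coeff_eq_0)
  finally show ?thesis using poly_lagrange[OF assms] by (simp add: vdm_inv_def mult.commute)
qed

text \<open>Interpolation reproduces x^m for \<open>m < N\<close>. It is obtained from
  \<open>vdm_inv_right\<close>, since a one-sided inverse of a square matrix is two-sided.\<close>

lemma vdm_inv_left:
  assumes "inj_on l {..<N}" "k < N" "m < N"
  shows "(\<Sum>i<N. vdm_inv N l k i * l i ^ m) = (if k = m then 1 else 0)"
proof -
  define U where "U = mat N N (\<lambda>(k, i). vdm_inv N l k i)"
  define V where "V = mat N N (\<lambda>(i, k). l i ^ k)"
  have "V * U = 1\<^sub>m N"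
    using vdm_inv_right[OF assms(1)]
    by (intro eq_matI) (auto simp: U_def V_def scalar_prod_def lessThan_atLeast0)
  then have "U * V = 1\<^sub>m N" by (rule mat_mult_left_right_inverse[rotated 2]) (auto simp: U_def V_def)
  then have "(U * V) $$ (k, m) = 1\<^sub>m N $$ (k, m)" by simp
  then show ?thesis using assms by (simp add: U_def V_def scalar_prod_def lessThan_atLeast0)
qed

lemma vdm_inv_last:
  assumes "i < N"
  shows "vdm_inv N l (N - 1) i = divdiff_weight N l i"
proof -
  define p where "p = (\<Prod>j\<in>{..<N} - {i}. [:- l j, 1:])"
  have "degree p = (\<Sum>j\<in>{..<N} - {i}. degree [:- l j, 1:])"
    unfolding p_def by (intro degree_prod_eq_sum_degree) auto
  then have "degree p = N - 1" using assms by simp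
  moreover have "lead_coeff p = 1" unfolding p_def by (simp add: lead_coeff_prod)
  ultimately show ?thesis unfolding vdm_inv_def lagrange_alt p_def[symmetric] by simp
qed

text \<open>The divided difference over all nodes annihilates polynomials of degree below
  \<open>N - 1\<close>. At the nodes of \<open>A_dir\<close> this becomes the orthogonality to all
  Krylov vectors but the last.\<close>

lemma divdiff_weight_moments:
  assumes "inj_on l {..<N}" "m < N"
  shows "(\<Sum>i<N. divdiff_weight N l i * l i ^ m) = (if m = N - 1 then 1 else 0)"
proof -
  have "(\<Sum>i<N. divdiff_weight N l i * l i ^ m) = (\<Sum>i<N. vdm_inv N l (N - 1) i * l i ^ m)"
    by (intro sum.cong) (simp_all only: lessThan_iff vdm_inv_last)
  then show ?thesis using vdm_inv_left[OF assms(1), of "N - 1" m] assms(2) by auto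
qed

section \<open>Germs at 0 with a power series expansion, and matrix inverses over them\<close>

lemma has_fps_expansion_nth_0:
  "f has_fps_expansion F \<Longrightarrow> fps_nth F 0 = f 0"
  by (auto simp: has_fps_expansion_def eval_fps_at_0 dest: eventually_nhds_x_imp_x)

text \<open>The series is hidden behind an existential: the class is closed under the operations of
  Cramer's rule, and afterwards only the value at 0 and the parity of a germ matter.\<close>

definition expandable :: "(real \<Rightarrow> real) \<Rightarrow> bool" where
  "expandable f \<longleftrightarrow> (\<exists>F. f has_fps_expansion F)"

lemma expandable_const [simp]: "expandable (\<lambda>_. c)"
  unfolding expandable_def by (blast intro: fps_expansion_intros)

lemma expandable_mult: "expandable f \<Longrightarrow> expandable g \<Longrightarrow> expandable (\<lambda>x. f x * g x)"
  unfolding expandable_def by (blast intro: fps_expansion_intros)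

lemma expandable_power: "expandable (\<lambda>x. x ^ n)"
  unfolding expandable_def by (blast intro: fps_expansion_intros)

lemma expandable_inverse: "expandable f \<Longrightarrow> f 0 \<noteq> 0 \<Longrightarrow> expandable (\<lambda>x. inverse (f x))"
  unfolding expandable_def
  using has_fps_expansion_inverse has_fps_expansion_nth_0 by force

lemma expandable_sum: "(\<And>i. i \<in> I \<Longrightarrow> expandable (f i)) \<Longrightarrow> expandable (\<lambda>x. \<Sum>i\<in>I. f i x)"
proof -
  assume "\<And>i. i \<in> I \<Longrightarrow> expandable (f i)"
  then have "\<forall>i\<in>I. \<exists>F. f i has_fps_expansion F" by (simp add: expandable_def)
  then obtain F where "\<forall>i\<in>I. f i has_fps_expansion F i" by (rule bchoice[THEN exE])
  then show ?thesis unfolding expandable_def using has_fps_expansion_sum[of I f F] by blast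
qed

lemma expandable_prod: "(\<And>i. i \<in> I \<Longrightarrow> expandable (f i)) \<Longrightarrow> expandable (\<lambda>x. \<Prod>i\<in>I. f i x)"
proof -
  assume "\<And>i. i \<in> I \<Longrightarrow> expandable (f i)"
  then have "\<forall>i\<in>I. \<exists>F. f i has_fps_expansion F" by (simp add: expandable_def)
  then obtain F where "\<forall>i\<in>I. f i has_fps_expansion F i" by (rule bchoice[THEN exE])
  then show ?thesis unfolding expandable_def using has_fps_expansion_prod[of I f F] by blast
qed

lemma expandable_continuous: "expandable f \<Longrightarrow> isCont f 0"
  unfolding expandable_def using has_fps_expansion_imp_continuous by blast

lemma has_fps_expansion_shift_power:
  fixes F :: "real fps"
  assumes "f has_fps_expansion F" and z: "\<And>p. p < n \<Longrightarrow> fps_nth F p = 0"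
  shows "(\<lambda>x. if x = 0 then fps_nth F n else f x / x ^ n) has_fps_expansion fps_shift n F"
proof (cases "F = 0")
  case True
  then have "eventually (\<lambda>x. f x = 0) (nhds 0)"
    using assms(1) unfolding has_fps_expansion_def by (auto elim: eventually_mono)
  then have "eventually (\<lambda>x. eval_fps (fps_shift n F) x = (if x = 0 then fps_nth F n else f x / x ^ n)) (nhds 0)"
    by eventually_elim (simp add: True)
  then show ?thesis using True by (simp add: has_fps_expansion_def)
next
  case False
  then show ?thesis using assms by (intro has_fps_expansion_shift subdegree_geI) auto
qed

text \<open>With \<open>q\<close> the quadratic remainder divided by x^2, evenness gives x (q (-x) -
  q x) = 2 c for the linear coefficient c, and the left side tends to 0 because \<open>q\<close> is
  continuous at 0. Evenness is assumed only near 0, as it is later known only where the Gram matrix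
  is invertible.\<close>

lemma expandable_even_bigo:
  assumes "expandable f" and ev: "eventually (\<lambda>x. f (- x) = f x) (at_right 0)"
  shows "(\<lambda>x. f x - f 0) \<in> O[at 0](\<lambda>x. x\<^sup>2)"
proof -
  obtain F where F: "f has_fps_expansion F" using assms(1) by (auto simp: expandable_def)
  have f0: "f 0 = fps_nth F 0" using has_fps_expansion_nth_0[OF F] by simp
  define G where "G = F - fps_const (f 0) - fps_const (fps_nth F 1) * fps_X"
  define g where "g = (\<lambda>x. f x - f 0 - fps_nth F 1 * x)"
  have G: "g has_fps_expansion G"
    unfolding g_def G_def by (intro fps_expansion_intros F)
  have Gn: "fps_nth G p = 0" if "p < 2" for p
    using that f0 by (cases "p = 0") (auto simp: G_def less_2_cases_iff)
  define q where "q = (\<lambda>x. if x = 0 then fps_nth G 2 else g x / x ^ 2)"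
  have "q has_fps_expansion fps_shift 2 G"
    unfolding q_def by (rule has_fps_expansion_shift_power[OF G Gn])
  then have "isCont q 0" by (rule has_fps_expansion_imp_continuous)
  then have lim: "(q \<longlongrightarrow> q 0) (at 0)" by (simp add: isCont_def)
  have gq: "g x = x\<^sup>2 * q x" for x
    by (simp add: q_def g_def)
  have bigo: "g \<in> O[at 0](\<lambda>x. x\<^sup>2)"
  proof -
    have q1: "q \<in> O[at 0](\<lambda>_. 1)" by (rule bigoI_tendsto[where c = "q 0"]) (use lim in auto)
    have "(\<lambda>x. x\<^sup>2 * q x) \<in> O[at 0](\<lambda>x. x\<^sup>2 * 1)"
      by (rule landau_o.big.mult[OF landau_o.big_refl q1])
    also have "(\<lambda>x. x\<^sup>2 * q x) = g" using gq by auto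
    finally show ?thesis by simp
  qed
  have "fps_nth F 1 = 0"
  proof -
    have limr: "(q \<longlongrightarrow> q 0) (at_right 0)" using lim by (simp add: filterlim_at_split)
    have "((\<lambda>x. q (- x)) \<longlongrightarrow> q 0) (at_right 0)"
      using lim filterlim_at_split[of q "nhds (q 0)" 0] filterlim_at_left_to_right[of q "nhds (q 0)" 0] by simp
    with limr have "((\<lambda>x. x * (q (- x) - q x) / 2) \<longlongrightarrow> 0 * (q 0 - q 0) / 2) (at_right 0)"
      by (intro tendsto_intros) simp_all
    moreover have "eventually (\<lambda>x. x * (q (- x) - q x) / 2 = fps_nth F 1) (at_right 0)"
      using ev eventually_at_right_less[of 0]
    proof eventually_elim
      case (elim x)
      have "x\<^sup>2 * (q (- x) - q x) = g (- x) - g x" using gq[of "-x"] gq[of x] by (simp add: algebra_simps)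
      also have "\<dots> = x * (2 * fps_nth F 1)" using elim by (simp add: g_def)
      finally have "x * (q (- x) - q x) = 2 * fps_nth F 1" using elim by (simp add: power2_eq_square)
      then show ?case by simp
    qed
    ultimately have "((\<lambda>x. fps_nth F 1) \<longlongrightarrow> 0) (at_right (0::real))"
      by (simp add: tendsto_cong)
    then show ?thesis by (simp add: tendsto_const_iff)
  qed
  then show ?thesis using bigo by (simp add: g_def)
qed

lemma expandable_det:
  assumes "\<And>h. A h \<in> carrier_mat n n"
    and "\<And>i j. i < n \<Longrightarrow> j < n \<Longrightarrow> expandable (\<lambda>h. A h $$ (i, j))"
  shows "expandable (\<lambda>h. det (A h))"
proof -
  have "(\<lambda>h. det (A h)) = (\<lambda>h. \<Sum>p\<in>{p. p permutes {0..<n}}. signof p * (\<Prod>i = 0..<n. A h $$ (i, p i)))"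
    using det_def'[OF assms(1)] by simp
  moreover have "expandable (\<lambda>h. \<Sum>p\<in>{p. p permutes {0..<n}}. signof p * (\<Prod>i = 0..<n. A h $$ (i, p i)))"
  proof (intro expandable_sum expandable_mult expandable_const expandable_prod assms(2))
    fix p i assume "p \<in> {p. p permutes {0..<n}}" "i \<in> {0..<n}"
    then show "i < n" "p i < n" using permutes_in_image[of p "{0..<n}" i] by simp_all
  qed
  ultimately show ?thesis by (simp only:)
qed

text \<open>The adjugate formula makes every entry of the inverse a quotient of polynomials in the
  entries, so expandability passes to the inverse.\<close>

definition inv_mat :: "real mat \<Rightarrow> real mat" where
  "inv_mat A = (1 / det A) \<cdot>\<^sub>m adj_mat A"

lemma inv_mat:
  assumes "A \<in> carrier_mat n n" "det A \<noteq> 0"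
  shows "inv_mat A \<in> carrier_mat n n" "A * inv_mat A = 1\<^sub>m n" "inv_mat A * A = 1\<^sub>m n"
proof -
  note a = adj_mat[OF assms(1)]
  show "inv_mat A \<in> carrier_mat n n" using a(1) by (simp add: inv_mat_def)
  show "A * inv_mat A = 1\<^sub>m n"
    unfolding inv_mat_def mult_smult_distrib[OF assms(1) a(1)] a(2) using assms(2)
    by (intro eq_matI) auto
  show "inv_mat A * A = 1\<^sub>m n"
    unfolding inv_mat_def mult_smult_assoc_mat[OF a(1) assms(1)] a(3) using assms(2)
    by (intro eq_matI) auto
qed

lemma expandable_inv_mat:
  assumes c: "\<And>h. A h \<in> carrier_mat n n"
    and e: "\<And>i j. i < n \<Longrightarrow> j < n \<Longrightarrow> expandable (\<lambda>h. A h $$ (i, j))"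
    and d: "det (A 0) \<noteq> 0" and ij: "i < n" "j < n"
  shows "expandable (\<lambda>h. inv_mat (A h) $$ (i, j))"
proof -
  have "expandable (\<lambda>h. det (mat_delete (A h) j i))"
  proof (rule expandable_det)
    show "mat_delete (A h) j i \<in> carrier_mat (n - 1) (n - 1)" for h
      by (rule mat_delete_carrier[OF c])
    show "expandable (\<lambda>h. mat_delete (A h) j i $$ (a, b))" if "a < n - 1" "b < n - 1" for a b
    proof -
      have "mat_delete (A h) j i $$ (a, b) = A h $$ (if a < j then a else Suc a, if b < i then b else Suc b)" for h
        using that c[of h] by (auto simp: mat_delete_def)
      then show ?thesis using that ij e by auto
    qed
  qed
  then have "expandable (\<lambda>h. inverse (det (A h)) * ((-1) ^ (j + i) * det (mat_delete (A h) j i)))"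
    using expandable_inverse[OF expandable_det[OF c e] d]
    by (rule expandable_mult[OF _ expandable_mult[OF expandable_const], rotated])
  moreover have "(\<lambda>h. inv_mat (A h) $$ (i, j)) =
      (\<lambda>h. inverse (det (A h)) * ((-1) ^ (j + i) * det (mat_delete (A h) j i)))"
  proof
    fix h
    show "inv_mat (A h) $$ (i, j) = inverse (det (A h)) * ((-1) ^ (j + i) * det (mat_delete (A h) j i))"
      using ij c[of h] by (simp add: inv_mat_def adj_mat_def cofactor_def divide_inverse)
  qed
  ultimately show ?thesis by (simp only:)
qed

text \<open>\<open>h * exp_kernel s h\<close> is the integral of \<open>exp (s * t)\<close> over \<open>{-h..h}\<close>.\<close>

definition exp_kernel :: "real \<Rightarrow> real \<Rightarrow> real" where
  "exp_kernel s h = (if h = 0 then 2 else (exp (s * h) - exp (- s * h)) / (s * h))"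

lemma exp_kernel_minus: "exp_kernel s (- h) = exp_kernel s h"
proof -
  have "(exp (- (s * h)) - exp (s * h)) / - (s * h) = (exp (s * h) - exp (- (s * h))) / (s * h)"
    by (metis minus_diff_eq minus_divide_divide)
  then show ?thesis by (simp add: exp_kernel_def)
qed

definition exp_kernel_fps :: "real \<Rightarrow> real fps" where
  "exp_kernel_fps s = Abs_fps (\<lambda>p. (1 + (-1) ^ p) * s ^ p / fact (Suc p))"

lemma exp_kernel_has_fps_expansion:
  assumes "s \<noteq> 0"
  shows "exp_kernel s has_fps_expansion exp_kernel_fps s"
proof -
  let ?F = "fps_const (1 / s) * (fps_exp s - fps_exp (- s))"
  have "(\<lambda>h. 1 / s * (exp (s * h) - exp (- s * h))) has_fps_expansion ?F"
    by (intro fps_expansion_intros)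
  from has_fps_expansion_shift_power[OF this, of 1]
  have "(\<lambda>h. if h = 0 then fps_nth ?F 1 else 1 / s * (exp (s * h) - exp (- s * h)) / h ^ 1)
    has_fps_expansion fps_shift 1 ?F"
    by simp
  moreover have "(\<lambda>h. if h = 0 then fps_nth ?F 1 else 1 / s * (exp (s * h) - exp (- s * h)) / h ^ 1) = exp_kernel s"
    using assms by (auto simp: exp_kernel_def fun_eq_iff field_simps)
  moreover have "fps_shift 1 ?F = exp_kernel_fps s"
  proof (rule fps_ext)
    fix p
    have "(- s) ^ Suc p = - ((-1) ^ p * s ^ Suc p)"
      by (subst power_minus) simp
    then show "fps_nth (fps_shift 1 ?F) p = fps_nth (exp_kernel_fps s) p"
      using assms by (simp add: exp_kernel_fps_def field_simps add_divide_distrib)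
  qed
  ultimately show ?thesis by simp
qed

text \<open>For positive nodes and \<open>h > 0\<close>, \<open>h\<close> times this entry is the
  integral over \<open>{-h..h}\<close> of the product of e_k and e_m, where e_k is the combination
  of the exponentials exp (l i t) with the weights \<open>vdm_inv N l k i\<close>. Its Taylor
  expansion is e_k (t) = t^k / k! + O(t^N).\<close>

definition compressed_gram :: "nat \<Rightarrow> (nat \<Rightarrow> real) \<Rightarrow> nat \<Rightarrow> nat \<Rightarrow> real \<Rightarrow> real" where
  "compressed_gram N l k m h =
     (\<Sum>i<N. \<Sum>j<N. vdm_inv N l k i * vdm_inv N l m j * exp_kernel (l i + l j) h)"

text \<open>The binomial theorem splits the double sum into products of a moment of row
  \<open>k\<close> and a moment of row \<open>m\<close>. If \<open>q < k\<close> the first moment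
  vanishes; if \<open>q > k\<close> then \<open>p - q < m\<close> and the second one does, even when
  \<open>q\<close> exceeds the range in which the moments of row \<open>k\<close> are known.\<close>

lemma vdm_inv_power_sum:
  assumes inj: "inj_on l {..<N}" and km: "k < N" "m < N" and p: "p \<le> k + m"
  shows "(\<Sum>i<N. \<Sum>j<N. vdm_inv N l k i * vdm_inv N l m j * (l i + l j) ^ p)
    = (if p = k + m then real (p choose k) else 0)"
proof -
  define \<mu> where "\<mu> = (\<lambda>k q. \<Sum>i<N. vdm_inv N l k i * l i ^ q)"
  have "(\<Sum>i<N. \<Sum>j<N. vdm_inv N l k i * vdm_inv N l m j * (l i + l j) ^ p)
      = (\<Sum>i<N. \<Sum>j<N. \<Sum>q\<le>p. real (p choose q) *
          ((vdm_inv N l k i * l i ^ q) * (vdm_inv N l m j * l j ^ (p - q))))"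
    by (simp add: binomial_ring sum_distrib_left mult_ac)
  also have "\<dots> = (\<Sum>q\<le>p. \<Sum>i<N. \<Sum>j<N. real (p choose q) *
          ((vdm_inv N l k i * l i ^ q) * (vdm_inv N l m j * l j ^ (p - q))))"
    by (subst sum.swap[of _ _ "{..<N}"], subst sum.swap) (rule refl)
  also have "\<dots> = (\<Sum>q\<le>p. real (p choose q) * (\<mu> k q * \<mu> m (p - q)))"
    unfolding \<mu>_def sum_product by (simp add: sum_distrib_left)
  also have "\<dots> = (\<Sum>q\<le>p. if q = k then (if p = k + m then real (p choose k) else 0) else 0)"
  proof (rule sum.cong[OF refl])
    fix q assume q: "q \<in> {..p}"
    consider "q < k" | "q = k" | "q > k" by linarith
    then show "real (p choose q) * (\<mu> k q * \<mu> m (p - q))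
      = (if q = k then (if p = k + m then real (p choose k) else 0) else 0)"
    proof cases
      case 1
      then have "\<mu> k q = 0" using vdm_inv_left[OF inj, of k q] km by (simp add: \<mu>_def)
      then show ?thesis using 1 by simp
    next
      case 2
      have "\<mu> k k = 1" using vdm_inv_left[OF inj, of k k] km by (simp add: \<mu>_def)
      moreover have "\<mu> m (p - k) = (if p = k + m then 1 else 0)"
        using vdm_inv_left[OF inj, of m "p - k"] km p q 2 by (auto simp: \<mu>_def)
      ultimately show ?thesis using 2 by simp
    next
      case 3
      then have "p - q < m" using p q by auto
      then have "\<mu> m (p - q) = 0" using vdm_inv_left[OF inj, of m "p - q"] km by (simp add: \<mu>_def)
      then show ?thesis using 3 by simp
    qed
  qed
  also have "\<dots> = (if p = k + m then real (p choose k) else 0)" by auto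
  finally show ?thesis .
qed

text \<open>The kernel matrix degenerates as \<open>h\<close> tends to \<open>0\<close>; in the basis of divided differences, with row \<open>k\<close>
  scaled by \<open>h ^ (- k)\<close>, it extends analytically to \<open>h = 0\<close>.\<close>

definition scaled_gram :: "nat \<Rightarrow> (nat \<Rightarrow> real) \<Rightarrow> real \<Rightarrow> real mat" where
  "scaled_gram N l h = (if h = 0 then moment_mat N
     else mat N N (\<lambda>(k, m). compressed_gram N l k m h / h ^ (k + m)))"

lemma expandable_scaled_gram:
  assumes inj: "inj_on l {..<N}" and pos: "\<And>i. i < N \<Longrightarrow> l i > 0" and km: "k < N" "m < N"
  shows "expandable (\<lambda>h. scaled_gram N l h $$ (k, m))"
proof -
  define Q where "Q = (\<Sum>i<N. \<Sum>j<N. fps_const (vdm_inv N l k i * vdm_inv N l m j) * exp_kernel_fps (l i + l j))"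
  \<comment> \<open>Positivity of the nodes excludes a zero sum, for which \<open>exp_kernel\<close>
    would be 0 away from \<open>h = 0\<close> by division by zero.\<close>
  have "l i + l j \<noteq> 0" if "i < N" "j < N" for i j
    using pos[OF that(1)] pos[OF that(2)] by linarith
  then have "compressed_gram N l k m has_fps_expansion Q"
    unfolding compressed_gram_def[abs_def] Q_def
    by (intro has_fps_expansion_sum has_fps_expansion_cmult_left exp_kernel_has_fps_expansion) auto
  moreover have nth: "fps_nth Q p = (1 + (-1) ^ p) / fact (Suc p) *
      (if p = k + m then real (p choose k) else 0)" if "p \<le> k + m" for p
  proof -
    have "fps_nth Q p = (1 + (-1) ^ p) / fact (Suc p) *
      (\<Sum>i<N. \<Sum>j<N. vdm_inv N l k i * vdm_inv N l m j * (l i + l j) ^ p)"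
      unfolding Q_def sum_distrib_left
      by (simp add: fps_sum_nth exp_kernel_fps_def mult_ac del: fact_Suc)
    then show ?thesis by (simp only: vdm_inv_power_sum[OF inj km that])
  qed
  ultimately have "(\<lambda>h. if h = 0 then fps_nth Q (k + m) else compressed_gram N l k m h / h ^ (k + m))
      has_fps_expansion fps_shift (k + m) Q"
    by (intro has_fps_expansion_shift_power) auto
  moreover have "fps_nth Q (k + m) = moment_mat N $$ (k, m)"
    using km by (simp add: nth moment_mat_def binomial_fact del: of_nat_Suc of_nat_add)
  moreover have "(\<lambda>h. if h = 0 then moment_mat N $$ (k, m) else compressed_gram N l k m h / h ^ (k + m))
      = (\<lambda>h. scaled_gram N l h $$ (k, m))"
    using km by (auto simp: scaled_gram_def)
  ultimately have "(\<lambda>h. scaled_gram N l h $$ (k, m)) has_fps_expansion fps_shift (k + m) Q"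
    by (simp only:)
  then show ?thesis by (auto simp: expandable_def)
qed

text \<open>For small \<open>h \<noteq> 0\<close> this is \<open>h ^ (2 * (N - 1))\<close> times the
  inverse of the matrix \<open>exp_kernel (l i + l j) h\<close>. Only nonnegative powers of
  \<open>h\<close> occur, so the expression keeps its meaning at \<open>h = 0\<close>.\<close>

definition dual_gram :: "nat \<Rightarrow> (nat \<Rightarrow> real) \<Rightarrow> real \<Rightarrow> nat \<Rightarrow> nat \<Rightarrow> real" where
  "dual_gram N l h i j = (\<Sum>k<N. \<Sum>m<N. h ^ ((N - 1 - k) + (N - 1 - m)) * vdm_inv N l k i
     * vdm_inv N l m j * inv_mat (scaled_gram N l h) $$ (k, m))"

lemma scaled_gram_carrier: "scaled_gram N l h \<in> carrier_mat N N"
  by (simp add: scaled_gram_def moment_mat_def)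

lemma expandable_dual_gram:
  assumes inj: "inj_on l {..<N}" and pos: "\<And>i. i < N \<Longrightarrow> l i > 0"
  shows "expandable (\<lambda>h. dual_gram N l h i j)"
  unfolding dual_gram_def
proof (intro expandable_sum expandable_mult expandable_power expandable_const)
  fix k m assume km: "k \<in> {..<N}" "m \<in> {..<N}"
  show "expandable (\<lambda>h. inv_mat (scaled_gram N l h) $$ (k, m))"
    using km moment_mat_nonsingular[of N]
    by (intro expandable_inv_mat[of _ N] scaled_gram_carrier expandable_scaled_gram inj pos)
      (auto simp: scaled_gram_def)
qed

text \<open>At \<open>h = 0\<close> the powers remove every term except
  \<open>k = m = N - 1\<close>, where the exponent is 0; the last row of \<open>vdm_inv\<close>
  consists of the divided-difference weights. This is where the rank-one limit comes from.\<close>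

lemma dual_gram_0:
  assumes N: "N \<ge> 1" and i: "i < N" and j: "j < N"
  shows "dual_gram N l 0 i j = gram_const (N - 1) * divdiff_weight N l i * divdiff_weight N l j"
proof -
  define M where "M = moment_mat N"
  have M: "M \<in> carrier_mat N N" "det M \<noteq> 0"
    using moment_mat_nonsingular by (auto simp: M_def moment_mat_def)
  have N': "Suc (N - 1) = N" using N by simp
  obtain y where y: "y \<in> carrier_vec N" "M *\<^sub>v y = unit_vec N (N - 1)" "y $ (N - 1) = gram_const (N - 1)"
    using moment_mat_last_unit_vec[of "N - 1"] unfolding N' M_def by blast
  have "inv_mat M *\<^sub>v unit_vec N (N - 1) = (inv_mat M * M) *\<^sub>v y"
    using y M inv_mat(1)[OF M] by (simp add: assoc_mult_mat_vec)
  then have "inv_mat M *\<^sub>v unit_vec N (N - 1) = y"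
    using y M by (simp add: inv_mat(3)[OF M])
  moreover have "(inv_mat M *\<^sub>v unit_vec N (N - 1)) $ (N - 1) = inv_mat M $$ (N - 1, N - 1)"
    using inv_mat(1)[OF M] N by simp
  ultimately have g: "inv_mat M $$ (N - 1, N - 1) = gram_const (N - 1)" using y by simp
  have "dual_gram N l 0 i j = (\<Sum>k<N. \<Sum>m<N. if k = N - 1 \<and> m = N - 1 then
     vdm_inv N l k i * vdm_inv N l m j * inv_mat M $$ (k, m) else 0)"
    unfolding dual_gram_def by (intro sum.cong refl) (auto simp: scaled_gram_def M_def)
  also have "\<dots> = (\<Sum>k<N. if k = N - 1 then \<Sum>m<N. if m = N - 1 then
     vdm_inv N l k i * vdm_inv N l m j * inv_mat M $$ (k, m) else 0 else 0)"
    by (intro sum.cong refl) (auto intro!: sum.neutral)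
  also have "\<dots> = vdm_inv N l (N - 1) i * vdm_inv N l (N - 1) j * inv_mat M $$ (N - 1, N - 1)"
    using N by simp
  finally show ?thesis using i j unfolding vdm_inv_last[OF i] vdm_inv_last[OF j] g by simp
qed

text \<open>With n = N - 1, K the kernel matrix, H the scaled matrix and X, Y the scaled Vandermonde
  matrix and its dual, one has X Y = h^n, Y K Y^T = h^(2n) H and D = Y^T H^(-1) Y. Hence h^n K D = X
  (Y K Y^T) H^(-1) Y = h^(2n) X Y = h^(3n), and h^n cancels.\<close>

lemma gram_times_dual_gram:
  assumes inj: "inj_on l {..<N}" and h: "h \<noteq> 0" and d: "det (scaled_gram N l h) \<noteq> 0"
    and i: "i < N" and j: "j < N"
  shows "(\<Sum>k<N. exp_kernel (l i + l k) h * dual_gram N l h k j) = (if i = j then h ^ (2 * (N - 1)) else 0)"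
proof -
  define n where "n = N - 1"
  define K where "K = mat N N (\<lambda>(i, j). exp_kernel (l i + l j) h)"
  define H where "H = scaled_gram N l h"
  define G where "G = inv_mat H"
  define X where "X = mat N N (\<lambda>(i, k). l i ^ k * h ^ k)"
  define Y where "Y = mat N N (\<lambda>(k, i). h ^ (n - k) * vdm_inv N l k i)"
  define D where "D = mat N N (\<lambda>(i, j). dual_gram N l h i j)"
  have [simp]: "H \<in> carrier_mat N N" by (simp add: H_def scaled_gram_carrier)
  have G: "G \<in> carrier_mat N N" "H * G = 1\<^sub>m N" using inv_mat[of H N] d by (simp_all add: G_def H_def scaled_gram_carrier)
  note [simp] = G(1)
  have [simp]: "K \<in> carrier_mat N N" "X \<in> carrier_mat N N" "Y \<in> carrier_mat N N" "D \<in> carrier_mat N N"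
    "transpose_mat Y \<in> carrier_mat N N"
    by (simp_all add: K_def X_def Y_def D_def)
  have pw: "h ^ k * h ^ (n - k) = h ^ n" if "k < N" for k
    using that by (simp add: n_def power_add[symmetric])
  have XY: "X * Y = h ^ n \<cdot>\<^sub>m 1\<^sub>m N"
  proof (rule eq_matI)
    fix i j assume ij: "i < dim_row (h ^ n \<cdot>\<^sub>m 1\<^sub>m N)" "j < dim_col (h ^ n \<cdot>\<^sub>m 1\<^sub>m N)"
    then have "(X * Y) $$ (i, j) = (\<Sum>k<N. h ^ n * (l i ^ k * vdm_inv N l k j))"
      by (auto simp: X_def Y_def scalar_prod_def lessThan_atLeast0 pw[symmetric] intro!: sum.cong)
    also have "\<dots> = h ^ n * (if j = i then 1 else 0)"
      using ij vdm_inv_right[OF inj, of j i] by (simp add: sum_distrib_left[symmetric])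
    finally show "(X * Y) $$ (i, j) = (h ^ n \<cdot>\<^sub>m 1\<^sub>m N) $$ (i, j)" using ij by auto
  qed (auto simp: X_def Y_def)
  have YKY: "Y * K * transpose_mat Y = h ^ (2 * n) \<cdot>\<^sub>m H"
  proof (rule eq_matI)
    fix k m assume "k < dim_row (h ^ (2 * n) \<cdot>\<^sub>m H)" "m < dim_col (h ^ (2 * n) \<cdot>\<^sub>m H)"
    then have km: "k < N" "m < N" using \<open>H \<in> carrier_mat N N\<close> by auto
    have "(Y * K * transpose_mat Y) $$ (k, m) =
        (\<Sum>j<N. (\<Sum>i<N. h ^ (n - k) * vdm_inv N l k i * exp_kernel (l i + l j) h) * (h ^ (n - m) * vdm_inv N l m j))"
      using km by (simp add: Y_def K_def scalar_prod_def lessThan_atLeast0)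
    also have "\<dots> = h ^ (n - k) * h ^ (n - m) * compressed_gram N l k m h"
      unfolding compressed_gram_def sum_distrib_left sum_distrib_right by (subst sum.swap) (simp add: mult_ac)
    also have "\<dots> = h ^ (2 * n) * (compressed_gram N l k m h / h ^ (k + m))"
    proof -
      have "h ^ (n - k) * h ^ (n - m) * h ^ (k + m) = (h ^ k * h ^ (n - k)) * (h ^ m * h ^ (n - m))"
        by (simp only: power_add mult_ac)
      also have "\<dots> = h ^ (2 * n)" unfolding pw[OF km(1)] pw[OF km(2)] by (simp add: mult_2 power_add)
      finally show ?thesis using h by (simp add: field_simps)
    qed
    finally show "(Y * K * transpose_mat Y) $$ (k, m) = (h ^ (2 * n) \<cdot>\<^sub>m H) $$ (k, m)"
      using km h by (simp add: H_def scaled_gram_def)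
  qed (use h in \<open>auto simp: Y_def H_def scaled_gram_def\<close>)
  have Deq: "D = transpose_mat Y * G * Y"
  proof (rule eq_matI)
    fix i j assume "i < dim_row (transpose_mat Y * G * Y)" "j < dim_col (transpose_mat Y * G * Y)"
    then have ij: "i < N" "j < N" by (auto simp: Y_def)
    have "(transpose_mat Y * G * Y) $$ (i, j) = (\<Sum>m<N. (\<Sum>k<N. h ^ (n - k) * vdm_inv N l k i * G $$ (k, m)) * (h ^ (n - m) * vdm_inv N l m j))"
      using ij carrier_matD[OF G(1)] by (simp add: Y_def scalar_prod_def lessThan_atLeast0)
    also have "\<dots> = dual_gram N l h i j"
      unfolding dual_gram_def sum_distrib_right by (subst sum.swap) (simp only: n_def G_def H_def power_add mult_ac)
    finally show "D $$ (i, j) = (transpose_mat Y * G * Y) $$ (i, j)" using ij by (simp add: D_def)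
  qed (auto simp: D_def Y_def)
  have KD [simp]: "K * D \<in> carrier_mat N N" and GY [simp]: "G * Y \<in> carrier_mat N N"
    by (rule mult_carrier_mat[of _ N N _ N]; simp)+
  have "h ^ n \<cdot>\<^sub>m (K * D) = (X * Y) * (K * D)"
    unfolding XY by (subst mult_smult_assoc_mat[of _ N N _ N]) (simp_all add: left_mult_one_mat[OF KD])
  also have "\<dots> = X * ((Y * K * transpose_mat Y) * (G * Y))"
    unfolding Deq by (simp add: assoc_mult_mat[of _ N N _ N _ N] mult_carrier_mat[of _ N N _ N])
  also have "\<dots> = X * (h ^ (2 * n) \<cdot>\<^sub>m (H * (G * Y)))"
    unfolding YKY by (subst mult_smult_assoc_mat[of _ N N _ N]) (auto simp: mult_carrier_mat[of _ N N _ N])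
  also have "H * (G * Y) = Y"
    by (subst assoc_mult_mat[symmetric, of _ N N _ N _ N]) (auto simp: G(2) left_mult_one_mat[of _ N N])
  also have "X * (h ^ (2 * n) \<cdot>\<^sub>m Y) = h ^ (2 * n) \<cdot>\<^sub>m (h ^ n \<cdot>\<^sub>m 1\<^sub>m N)"
    by (subst mult_smult_distrib[of _ N N _ N]) (auto simp: XY)
  finally have eq: "h ^ n \<cdot>\<^sub>m (K * D) = h ^ (2 * n) \<cdot>\<^sub>m (h ^ n \<cdot>\<^sub>m 1\<^sub>m N)" .
  have "(h ^ n \<cdot>\<^sub>m (K * D)) $$ (i, j) = (h ^ (2 * n) \<cdot>\<^sub>m (h ^ n \<cdot>\<^sub>m 1\<^sub>m N)) $$ (i, j)" by (simp only: eq)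
  then have "h ^ n * (K * D) $$ (i, j) = h ^ n * (if i = j then h ^ (2 * n) else 0)"
    using i j by (auto simp: K_def D_def)
  then have "(K * D) $$ (i, j) = (if i = j then h ^ (2 * n) else 0)" using h by simp
  moreover have "(K * D) $$ (i, j) = (\<Sum>k<N. exp_kernel (l i + l k) h * dual_gram N l h k j)"
    using i j by (simp add: K_def D_def scalar_prod_def lessThan_atLeast0)
  ultimately show ?thesis by (simp add: n_def)
qed

text \<open>Serves to transfer the symmetry of the kernel under \<open>h\<close> to
  \<open>- h\<close> to \<open>dual_gram\<close>, whose defining formula does not display
  it.\<close>

lemma kernel_inverse_unique:
  fixes K B C :: "nat \<Rightarrow> nat \<Rightarrow> real"
  assumes "c \<noteq> 0"
    and B: "\<And>i j. i < N \<Longrightarrow> j < N \<Longrightarrow> (\<Sum>k<N. K i k * B k j) = (if i = j then c else 0)"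
    and C: "\<And>i j. i < N \<Longrightarrow> j < N \<Longrightarrow> (\<Sum>k<N. K i k * C k j) = (if i = j then c else 0)"
    and ij: "i < N" "j < N"
  shows "B i j = C i j"
proof -
  define K' B' C' where "K' = mat N N (\<lambda>(i, j). K i j)"
    and "B' = mat N N (\<lambda>(i, j). B i j / c)" and "C' = mat N N (\<lambda>(i, j). C i j / c)"
  have [simp]: "K' \<in> carrier_mat N N" "B' \<in> carrier_mat N N" "C' \<in> carrier_mat N N"
    by (simp_all add: K'_def B'_def C'_def)
  have KB: "K' * B' = 1\<^sub>m N"
    using B \<open>c \<noteq> 0\<close> by (intro eq_matI)
      (auto simp: K'_def B'_def scalar_prod_def lessThan_atLeast0 sum_divide_distrib[symmetric])
  have KC: "K' * C' = 1\<^sub>m N"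
    using C \<open>c \<noteq> 0\<close> by (intro eq_matI)
      (auto simp: K'_def C'_def scalar_prod_def lessThan_atLeast0 sum_divide_distrib[symmetric])
  have BK: "B' * K' = 1\<^sub>m N" by (rule mat_mult_left_right_inverse[OF _ _ KB]) simp_all
  have "B' = B' * (K' * C')" unfolding KC by (simp add: right_mult_one_mat[of _ N N])
  also have "\<dots> = (B' * K') * C'" by (simp add: assoc_mult_mat[of _ N N _ N _ N])
  also have "\<dots> = C'" unfolding BK by (simp add: left_mult_one_mat[of _ N N])
  finally have "B' $$ (i, j) = C' $$ (i, j)" by simp
  then show ?thesis using ij \<open>c \<noteq> 0\<close> by (simp add: B'_def C'_def)
qed

lemma eventually_gram_times_dual_gram:
  assumes inj: "inj_on l {..<N}" and pos: "\<And>i. i < N \<Longrightarrow> l i > 0"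
  shows "\<forall>\<^sub>F h in at 0. \<forall>i<N. \<forall>j<N.
    (\<Sum>k<N. exp_kernel (l i + l k) h * dual_gram N l h k j) = (if i = j then h ^ (2 * (N - 1)) else 0)"
proof -
  have "expandable (\<lambda>h. det (scaled_gram N l h))"
    by (rule expandable_det[OF scaled_gram_carrier expandable_scaled_gram[OF inj pos]])
  then have "isCont (\<lambda>h. det (scaled_gram N l h)) 0" by (rule expandable_continuous)
  moreover have "det (scaled_gram N l 0) \<noteq> 0"
    using moment_mat_nonsingular by (simp add: scaled_gram_def)
  ultimately have "\<forall>\<^sub>F h in at 0. det (scaled_gram N l h) \<noteq> 0"
    unfolding isCont_def by (rule tendsto_imp_eventually_ne)
  moreover have "\<forall>\<^sub>F h in at (0::real). h \<noteq> 0" by (simp add: eventually_at_filter)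
  ultimately show ?thesis
    by eventually_elim (use gram_times_dual_gram[OF inj] in blast)
qed

text \<open>At \<open>h\<close> and \<open>- h\<close> the matrix \<open>dual_gram\<close> inverts
  the same kernel matrix up to the same even factor \<open>h ^ (2 * (N - 1))\<close>; uniqueness
  makes it even near 0, so the first correction to the rank-one limit is quadratic.\<close>

lemma dual_gram_asymptotics:
  assumes N: "N \<ge> 1" and inj: "inj_on l {..<N}" and pos: "\<And>i. i < N \<Longrightarrow> l i > 0"
    and ij: "i < N" "j < N"
  shows "(\<lambda>h. dual_gram N l h i j - gram_const (N - 1) * divdiff_weight N l i * divdiff_weight N l j)
     \<in> O[at_right 0](\<lambda>h. h\<^sup>2)"
proof -
  note ev = eventually_gram_times_dual_gram[OF inj pos]
  have "\<forall>\<^sub>F h in at_right 0. dual_gram N l (- h) i j = dual_gram N l h i j"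
  proof -
    have even_pow: "(- x) ^ (2 * (N - 1)) = x ^ (2 * (N - 1))" for x :: real
      by (simp add: power_mult)
    have r: "\<forall>\<^sub>F h in at_right 0. \<forall>i<N. \<forall>j<N.
      (\<Sum>k<N. exp_kernel (l i + l k) h * dual_gram N l h k j) = (if i = j then h ^ (2 * (N - 1)) else 0)"
      using ev by (simp add: eventually_at_split)
    have "\<forall>\<^sub>F h in at_left 0. \<forall>i<N. \<forall>j<N.
      (\<Sum>k<N. exp_kernel (l i + l k) h * dual_gram N l h k j) = (if i = j then h ^ (2 * (N - 1)) else 0)"
      using ev by (simp add: eventually_at_split)
    then have "\<forall>\<^sub>F h in at_right 0. \<forall>i<N. \<forall>j<N.
      (\<Sum>k<N. exp_kernel (l i + l k) h * dual_gram N l (- h) k j) = (if i = j then h ^ (2 * (N - 1)) else 0)"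
      by (simp only: eventually_at_left_to_right minus_zero exp_kernel_minus even_pow)
    with r eventually_at_right_less[of 0] show ?thesis
    proof eventually_elim
      case (elim h)
      show ?case
        by (rule kernel_inverse_unique[where c = "h ^ (2 * (N - 1))" and N = N
              and K = "\<lambda>i k. exp_kernel (l i + l k) h"]) (use elim ij in auto)
    qed
  qed
  from expandable_even_bigo[OF expandable_dual_gram[OF inj pos] this]
  have "(\<lambda>h. dual_gram N l h i j - dual_gram N l 0 i j) \<in> O[at 0](\<lambda>h. h\<^sup>2)" by simp
  moreover have "at_right (0::real) \<le> at 0" by (simp add: at_le)
  ultimately have "(\<lambda>h. dual_gram N l h i j - dual_gram N l 0 i j) \<in> O[at_right 0](\<lambda>h. h\<^sup>2)"
    by (rule landau_o.big.filter_mono[rotated])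
  then show ?thesis by (simp add: dual_gram_0[OF N ij])
qed

section \<open>Moments and asymptotics of the weights\<close>

text \<open>Writing N^2 - j^2 = (N + j) (N - j), each factor removes one step of a factorial and
  leaves the binomial coefficient for \<open>N - 1\<close> at the same distance \<open>j\<close>
  from the centre. Moments for \<open>N\<close> thus reduce to lower moments for
  \<open>N - 1\<close>. For \<open>j = N\<close> both sides are 0.\<close>

lemma choose_shift_absorb:
  assumes "1 \<le> N" "j \<le> N"
  shows "((real N)\<^sup>2 - (real j)\<^sup>2) * real ((2 * N) choose (N + j))
    = 2 * real N * (2 * real N - 1) * real ((2 * N - 2) choose (N - 1 + j))"
proof (cases "j = N")
  case True
  then show ?thesis using assms by (cases N) simp_all
next
  case False
  then have j: "j < N" using assms by simp
  obtain n where n: "N = Suc n" using assms by (cases N) auto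
  define m where "m = n - j"
  have m: "n = m + j" using j n by (simp add: m_def)
  have "real ((2 * N) choose (N + j)) = fact (2 * N) / (fact (N + j) * fact (N - j))"
    using j by (subst binomial_fact) auto
  moreover have "real ((2 * N - 2) choose (N - 1 + j)) = fact (2 * N - 2) / (fact (N - 1 + j) * fact (N - 1 - j))"
    using j n by (subst binomial_fact) auto
  moreover have "(fact (2 * N) :: real) = 2 * real N * (2 * real N - 1) * fact (2 * N - 2)"
    unfolding n by (simp add: algebra_simps)
  moreover have "(fact (N + j) :: real) = (real N + real j) * fact (N - 1 + j)"
    unfolding n by (simp add: algebra_simps)
  moreover have "(fact (N - j) :: real) = (real N - real j) * fact (N - 1 - j)"
    unfolding n m by (simp add: algebra_simps)
  moreover have "(real N)\<^sup>2 - (real j)\<^sup>2 = (real N + real j) * (real N - real j)"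
    by (simp add: power2_eq_square algebra_simps)
  moreover have "real N + real j \<noteq> 0" "real N - real j \<noteq> 0" using j by auto
  ultimately show ?thesis by simp
qed

lemma sum_choose_upper_half:
  "(\<Sum>j = 1..N. real ((2 * N) choose (N + j))) = (4 ^ N - real ((2 * N) choose N)) / 2"
proof -
  have "(\<Sum>k\<le>2 * N. real ((2 * N) choose k)) = real (2 ^ (2 * N))"
    unfolding of_nat_sum[symmetric] choose_row_sum ..
  also have "\<dots> = 4 ^ N" by (simp add: power_mult)
  also have "{..2 * N} = {..<N} \<union> {N} \<union> {Suc N..2 * N}" by auto
  also have "(\<Sum>k\<in>{..<N} \<union> {N} \<union> {Suc N..2 * N}. real ((2 * N) choose k))
      = (\<Sum>k<N. real ((2 * N) choose k)) + real ((2 * N) choose N) + (\<Sum>k = Suc N..2 * N. real ((2 * N) choose k))"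
    by (subst sum.union_disjoint; (subst sum.union_disjoint)?) auto
  also have "(\<Sum>k = Suc N..2 * N. real ((2 * N) choose k)) = (\<Sum>j = 1..N. real ((2 * N) choose (N + j)))"
    by (rule sum.reindex_bij_witness[of _ "\<lambda>j. N + j" "\<lambda>k. k - N"]) auto
  also have "(\<Sum>k<N. real ((2 * N) choose k)) = (\<Sum>j = 1..N. real ((2 * N) choose (N + j)))"
  proof (rule sum.reindex_bij_witness[of _ "\<lambda>j. N - j" "\<lambda>k. N - k"])
    fix k assume "k \<in> {..<N}"
    then have k: "k \<le> 2 * N" "2 * N - k = N + (N - k)" by auto
    show "real ((2 * N) choose (N + (N - k))) = real ((2 * N) choose k)"
      using binomial_symmetric[OF k(1)] unfolding k(2) by simp
  qed auto
  finally show ?thesis by simp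
qed

text \<open>Writing j^2 = N^2 - (N^2 - j^2) leaves two half-row sums; their central binomial terms
  cancel by \<open>choose_shift_absorb\<close> at \<open>j = 0\<close>.\<close>

lemma sum_squares_choose:
  assumes "1 \<le> N"
  shows "(\<Sum>j = 1..N. (real j)\<^sup>2 * real ((2 * N) choose (N + j))) = real N * 4 ^ (N - 1)"
proof -
  have "(\<Sum>j = 1..N. (real j)\<^sup>2 * real ((2 * N) choose (N + j)))
     = (\<Sum>j = 1..N. (real N)\<^sup>2 * real ((2 * N) choose (N + j))
        - 2 * real N * (2 * real N - 1) * real ((2 * N - 2) choose (N - 1 + j)))"
    by (intro sum.cong refl, subst choose_shift_absorb[symmetric]) (use assms in \<open>auto simp: algebra_simps\<close>)
  also have "\<dots> = (real N)\<^sup>2 * (\<Sum>j = 1..N. real ((2 * N) choose (N + j)))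
      - 2 * real N * (2 * real N - 1) * (\<Sum>j = 1..N. real ((2 * N - 2) choose (N - 1 + j)))"
    by (simp add: sum_subtractf sum_distrib_left)
  \<comment> \<open>The term \<open>j = N\<close> drops out: its lower index 2 N - 1 exceeds the
    upper one.\<close>
  also have "(\<Sum>j = 1..N. real ((2 * N - 2) choose (N - 1 + j)))
      = (\<Sum>j = 1..N - 1. real ((2 * (N - 1)) choose ((N - 1) + j)))"
    using assms by (intro sum.mono_neutral_cong_right) (auto simp: diff_mult_distrib2)
  also have "\<dots> = (4 ^ (N - 1) - real ((2 * (N - 1)) choose (N - 1))) / 2"
    by (rule sum_choose_upper_half)
  also have "(\<Sum>j = 1..N. real ((2 * N) choose (N + j))) = (4 * 4 ^ (N - 1) - real ((2 * N) choose N)) / 2"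
    unfolding sum_choose_upper_half using assms by (cases N) auto
  also have "(real N)\<^sup>2 * ((4 * 4 ^ (N - 1) - real ((2 * N) choose N)) / 2)
      - 2 * real N * (2 * real N - 1) * ((4 ^ (N - 1) - real ((2 * (N - 1)) choose (N - 1))) / 2)
      = real N * 4 ^ (N - 1)
        - ((real N)\<^sup>2 * real ((2 * N) choose N) - 2 * real N * (2 * real N - 1) * real ((2 * (N - 1)) choose (N - 1))) / 2"
    by (simp add: field_simps power2_eq_square)
  also have "(real N)\<^sup>2 * real ((2 * N) choose N) = 2 * real N * (2 * real N - 1) * real ((2 * (N - 1)) choose (N - 1))"
    using choose_shift_absorb[of N 0] assms by (simp add: diff_mult_distrib2)
  finally show ?thesis by simp
qed

text \<open>The reduction of \<open>sum_squares_choose\<close> one degree higher. It calls on the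
  second moment for \<open>N - 1\<close>, so \<open>N = 1\<close> is treated apart.\<close>

lemma sum_fourth_powers_choose:
  assumes "1 \<le> N"
  shows "(\<Sum>j = 1..N. (real j) ^ 4 * real ((2 * N) choose (N + j)))
    = real N * 4 ^ (N - 1) * ((3 * real N - 1) / 2)"
proof (cases "N = 1")
  case True
  then show ?thesis using binomial_n_n[of 2] by (simp add: numeral_2_eq_2)
next
  case False
  then have N: "1 \<le> N - 1" using assms by simp
  then have p4: "(4::real) ^ (N - 1) = 4 * 4 ^ (N - 1 - 1)" by (cases "N - 1") auto
  have "(\<Sum>j = 1..N. (real j) ^ 4 * real ((2 * N) choose (N + j)))
     = (\<Sum>j = 1..N. (real N)\<^sup>2 * ((real j)\<^sup>2 * real ((2 * N) choose (N + j)))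
        - 2 * real N * (2 * real N - 1) * ((real j)\<^sup>2 * real ((2 * N - 2) choose (N - 1 + j))))"
  proof (rule sum.cong[OF refl])
    fix j assume j: "j \<in> {1..N}"
    have "(real N)\<^sup>2 * ((real j)\<^sup>2 * real ((2 * N) choose (N + j))) - (real j) ^ 4 * real ((2 * N) choose (N + j))
      = (real j)\<^sup>2 * (((real N)\<^sup>2 - (real j)\<^sup>2) * real ((2 * N) choose (N + j)))"
      by (simp add: algebra_simps power2_eq_square power4_eq_xxxx)
    also have "\<dots> = 2 * real N * (2 * real N - 1) * ((real j)\<^sup>2 * real ((2 * N - 2) choose (N - 1 + j)))"
      by (subst choose_shift_absorb) (use assms j in auto)
    finally show "(real j) ^ 4 * real ((2 * N) choose (N + j)) = (real N)\<^sup>2 * ((real j)\<^sup>2 * real ((2 * N) choose (N + j)))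
        - 2 * real N * (2 * real N - 1) * ((real j)\<^sup>2 * real ((2 * N - 2) choose (N - 1 + j)))"
      by simp
  qed
  also have "\<dots> = (real N)\<^sup>2 * (\<Sum>j = 1..N. (real j)\<^sup>2 * real ((2 * N) choose (N + j)))
      - 2 * real N * (2 * real N - 1) * (\<Sum>j = 1..N. (real j)\<^sup>2 * real ((2 * N - 2) choose (N - 1 + j)))"
    by (simp add: sum_subtractf sum_distrib_left)
  also have "(\<Sum>j = 1..N. (real j)\<^sup>2 * real ((2 * N - 2) choose (N - 1 + j)))
      = (\<Sum>j = 1..N - 1. (real j)\<^sup>2 * real ((2 * (N - 1)) choose ((N - 1) + j)))"
    using assms by (intro sum.mono_neutral_cong_right) (auto simp: diff_mult_distrib2)
  also have "\<dots> = real (N - 1) * 4 ^ (N - 1 - 1)" by (rule sum_squares_choose[OF N])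
  also have "(\<Sum>j = 1..N. (real j)\<^sup>2 * real ((2 * N) choose (N + j))) = real N * (4 * 4 ^ (N - 1 - 1))"
    unfolding sum_squares_choose[OF assms] p4 ..
  finally show ?thesis unfolding p4 using N by (simp add: of_nat_diff field_simps power2_eq_square)
qed

lemma power_2_eq_4: "1 \<le> N \<Longrightarrow> (2::real) ^ (2 * N - 2) = 4 ^ (N - 1)"
  by (cases N) (simp_all add: power_mult)

lemma weight_pos:
  assumes "j \<in> {1..N}" shows "0 < weight N j"
  using assms unfolding weight_def by (auto simp: zero_less_binomial_iff)

lemma sum_weight:
  assumes "1 \<le> N" shows "(\<Sum>j = 1..N. weight N j) = 1"
proof -
  have "(\<Sum>j = 1..N. weight N j) = (\<Sum>j = 1..N. (real j)\<^sup>2 * real ((2 * N) choose (N + j))) / (real N * 4 ^ (N - 1))"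
    unfolding weight_def power_2_eq_4[OF assms] by (simp add: sum_divide_distrib)
  then show ?thesis using assms unfolding sum_squares_choose[OF assms] by simp
qed

lemma sum_weight_squares:
  assumes "1 \<le> N" shows "(\<Sum>j = 1..N. (real j)\<^sup>2 * weight N j) = (3 * real N - 1) / 2"
proof -
  have "(\<Sum>j = 1..N. (real j)\<^sup>2 * weight N j)
     = (\<Sum>j = 1..N. (real j) ^ 4 * real ((2 * N) choose (N + j))) / (real N * 4 ^ (N - 1))"
    unfolding weight_def power_2_eq_4[OF assms]
    by (simp add: sum_divide_distrib power2_eq_square power4_eq_xxxx mult_ac)
  then show ?thesis using assms unfolding sum_fourth_powers_choose[OF assms] by simp
qed

lemma weight_eq_0: "N < j \<Longrightarrow> weight N j = 0"
  by (simp add: weight_def)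

lemma weight_alt:
  assumes "1 \<le> N"
  shows "weight N j = 4 * (real j)\<^sup>2 / real N * (real ((2 * N) choose (N + j)) / 4 ^ N)"
proof -
  have "(4::real) ^ N = 4 * 4 ^ (N - 1)" using assms by (cases N) auto
  then show ?thesis unfolding weight_def power_2_eq_4[OF assms] by simp
qed

section \<open>Gaussian bounds for binomial coefficients near the centre\<close>

lemma prod_shift_eq_fact: "(\<Prod>i = 1..k. real (m + i)) = fact (m + k) / fact m"
proof (induction k)
  case (Suc k)
  have "(\<Prod>i = 1..Suc k. real (m + i)) = (\<Prod>i = 1..k. real (m + i)) * real (m + Suc k)" by simp
  also have "\<dots> = fact (m + Suc k) / fact m" unfolding Suc by (simp add: algebra_simps)
  finally show ?case .
qed simp

lemma choose_ratio_prod: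
  assumes "j \<le> N"
  shows "real ((2 * N) choose (N + j)) / real ((2 * N) choose N) = (\<Prod>i = 1..j. 1 - real j / real (N + i))"
proof -
  have "(\<Prod>i = 1..j. 1 - real j / real (N + i)) = (\<Prod>i = 1..j. real (N - j + i)) / (\<Prod>i = 1..j. real (N + i))"
    unfolding prod_dividef[symmetric] using assms by (intro prod.cong refl) (auto simp: field_simps of_nat_diff)
  also have "(\<Prod>i = 1..j. real (N + i)) = fact (N + j) / fact N"
    by (rule prod_shift_eq_fact)
  also have "(\<Prod>i = 1..j. real (N - j + i)) = fact N / fact (N - j)"
    unfolding prod_shift_eq_fact using assms by simp
  finally show ?thesis using assms
    by (simp add: binomial_fact)
qed

lemma choose_ratio_upper:
  assumes "j \<le> N"
  shows "real ((2 * N) choose (N + j)) / real ((2 * N) choose N) \<le> exp (- ((real j)\<^sup>2 / real (N + j)))"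
proof (cases "N = 0")
  case True
  then show ?thesis using assms by simp
next
  case False
  have "(\<Prod>i = 1..j. 1 - real j / real (N + i)) \<le> (\<Prod>i = 1..j. exp (- (real j / real (N + j))))"
  proof (rule prod_mono)
    fix i assume i: "i \<in> {1..j}"
    have "1 - real j / real (N + i) \<le> exp (- (real j / real (N + i)))"
      using exp_ge_add_one_self[of "- (real j / real (N + i))"] by simp
    also have "\<dots> \<le> exp (- (real j / real (N + j)))"
      using i False by (auto intro!: divide_left_mono)
    finally show "0 \<le> 1 - real j / real (N + i) \<and> 1 - real j / real (N + i) \<le> exp (- (real j / real (N + j)))"
      using assms i by (auto simp: divide_le_eq)
  qed
  also have "\<dots> = exp (- ((real j)\<^sup>2 / real (N + j)))"
    by (simp add: exp_of_nat_mult[symmetric] power2_eq_square)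
  finally show ?thesis unfolding choose_ratio_prod[OF assms] .
qed

text \<open>Each factor is at least 1 - j / N = 1 / (1 + j / (N - j)), hence at least exp (- j / (N
  - j)). Together with \<open>choose_ratio_upper\<close> the exponent is enclosed between j^2 / (N +
  j) and j^2 / (N - j), which have the same limit for j of order sqrt N.\<close>

lemma choose_ratio_lower:
  assumes "j < N"
  shows "exp (- ((real j)\<^sup>2 / real (N - j))) \<le> real ((2 * N) choose (N + j)) / real ((2 * N) choose N)"
proof -
  have "exp (- ((real j)\<^sup>2 / real (N - j))) = (\<Prod>i = 1..j. exp (- (real j / real (N - j))))"
    by (simp add: exp_of_nat_mult[symmetric] power2_eq_square)
  also have "\<dots> \<le> (\<Prod>i = 1..j. 1 - real j / real (N + i))"
  proof (rule prod_mono, intro conjI)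
    fix i assume i: "i \<in> {1..j}"
    let ?y = "real j / real (N - j)"
    have "0 < 1 + ?y" using assms by (intro add_pos_nonneg) auto
    then have "1 / exp ?y \<le> 1 / (1 + ?y)"
      using exp_ge_add_one_self[of ?y] by (intro divide_left_mono) simp_all
    also have "1 / (1 + ?y) = 1 - real j / real N" using assms by (simp add: field_simps of_nat_diff)
    also have "\<dots> \<le> 1 - real j / real (N + i)" using assms i by (auto intro!: divide_left_mono)
    finally show "exp (- ?y) \<le> 1 - real j / real (N + i)" by (simp add: exp_minus inverse_eq_divide)
  qed simp
  finally show ?thesis using choose_ratio_prod[of j N] assms by simp
qed

lemma choose_ratio_tendsto_1:
  "(\<lambda>N. real ((2 * N) choose (N + j)) / real ((2 * N) choose N)) \<longlonglongrightarrow> 1"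
proof (rule tendsto_sandwich)
  show "\<forall>\<^sub>F N in sequentially. exp (- ((real j)\<^sup>2 / real (N - j))) \<le> real ((2 * N) choose (N + j)) / real ((2 * N) choose N)"
    using eventually_gt_at_top[of j] by eventually_elim (rule choose_ratio_lower)
  show "\<forall>\<^sub>F N in sequentially. real ((2 * N) choose (N + j)) / real ((2 * N) choose N) \<le> exp (- ((real j)\<^sup>2 / real (N + j)))"
    using eventually_ge_at_top[of j] by eventually_elim (rule choose_ratio_upper)
  have "(\<lambda>N. exp (- ((real j)\<^sup>2 / real N))) \<longlonglongrightarrow> exp (- 0)"
    by (intro tendsto_intros lim_const_over_n)
  then have l: "(\<lambda>N. exp (- ((real j)\<^sup>2 / real N))) \<longlonglongrightarrow> 1" by simp
  from LIMSEQ_ignore_initial_segment[OF this, of j]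
  show "(\<lambda>N. exp (- ((real j)\<^sup>2 / real (N + j)))) \<longlonglongrightarrow> 1" .
  show "(\<lambda>N. exp (- ((real j)\<^sup>2 / real (N - j)))) \<longlonglongrightarrow> 1"
    by (rule LIMSEQ_offset[of _ j]) (use l in simp)
qed

text \<open>The square of the normalised central coefficient times 2 n + 1 is exactly the reciprocal
  of the n-th partial Wallis product.\<close>

lemma central_binomial_asymptotics:
  "(\<lambda>N. sqrt (real N) * (real ((2 * N) choose N) / 4 ^ N)) \<longlonglongrightarrow> 1 / sqrt pi"
proof -
  define c where "c = (\<lambda>N. real ((2 * N) choose N) / 4 ^ N)"
  define Wa where "Wa = (\<lambda>n. \<Prod>k = 1..n. (4 * (real k)\<^sup>2) / (4 * (real k)\<^sup>2 - 1))"
  have c_Suc: "c (Suc n) = c n * ((2 * real n + 1) / (2 * real n + 2))" for n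
  proof -
    define B B' where "B = real ((2 * n) choose n)" and "B' = real ((2 * Suc n) choose Suc n)"
    have "B' = fact (2 * Suc n) / (fact (Suc n) * fact (Suc n))"
      unfolding B'_def by (subst binomial_fact) auto
    also have "\<dots> = (2 * real n + 2) * (2 * real n + 1) / (real n + 1)\<^sup>2 * (fact (2 * n) / (fact n * fact n))"
    proof -
      have "(fact (2 * Suc n) :: real) = (2 * real n + 2) * (2 * real n + 1) * fact (2 * n)"
        by (simp add: algebra_simps)
      moreover have "(fact (Suc n) :: real) = (real n + 1) * fact n" by simp
      ultimately show ?thesis by (simp only: power2_eq_square times_divide_times_eq mult_ac)
    qed
    also have "fact (2 * n) / (fact n * fact n) = B"
      unfolding B_def by (subst binomial_fact) auto
    also have "(2 * real n + 2) * (2 * real n + 1) / (real n + 1)\<^sup>2 = 4 * ((2 * real n + 1) / (2 * real n + 2))"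
      by (simp add: divide_simps power2_eq_square) (simp add: algebra_simps)
    finally have "B' = 4 * ((2 * real n + 1) / (2 * real n + 2)) * B" .
    moreover have "4 * R * B / (4 * 4 ^ n) = B / 4 ^ n * R" for R by simp
    ultimately show ?thesis unfolding c_def B_def[symmetric] B'_def[symmetric] by (simp only: power_Suc)
  qed
  have eq: "(c n)\<^sup>2 * (2 * real n + 1) = 1 / Wa n" for n
  proof (induction n)
    case 0
    show ?case by (simp add: c_def Wa_def)
  next
    case (Suc n)
    have "Wa (Suc n) = Wa n * ((2 * real n + 2)\<^sup>2 / ((2 * real n + 1) * (2 * real n + 3)))"
      by (simp add: Wa_def power2_eq_square algebra_simps)
    moreover have "(c (Suc n))\<^sup>2 * (2 * real (Suc n) + 1)
      = ((c n)\<^sup>2 * (2 * real n + 1)) * (((2 * real n + 1) * (2 * real n + 3)) / (2 * real n + 2)\<^sup>2)"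
      unfolding c_Suc by (simp add: power_mult_distrib power_divide power2_eq_square algebra_simps)
    ultimately show ?case unfolding Suc by simp
  qed
  have "Wa \<longlonglongrightarrow> pi / 2" using wallis unfolding Wa_def .
  moreover have "(\<lambda>n. real n / (2 * real n + 1)) \<longlonglongrightarrow> 1 / 2" by real_asymp
  ultimately have "(\<lambda>n. (1 / Wa n) * (real n / (2 * real n + 1))) \<longlonglongrightarrow> (1 / (pi / 2)) * (1 / 2)"
    by (intro tendsto_mult[OF tendsto_divide[OF tendsto_const]]) simp_all
  moreover have "(1 / Wa n) * (real n / (2 * real n + 1)) = (sqrt (real n) * c n)\<^sup>2" for n
    unfolding eq[symmetric] by (simp add: power_mult_distrib)
  ultimately have "(\<lambda>n. (sqrt (real n) * c n)\<^sup>2) \<longlonglongrightarrow> 1 / pi" by simp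
  then have "(\<lambda>n. sqrt ((sqrt (real n) * c n)\<^sup>2)) \<longlonglongrightarrow> sqrt (1 / pi)" by (rule tendsto_real_sqrt)
  moreover have "sqrt ((sqrt (real n) * c n)\<^sup>2) = sqrt (real n) * c n" for n
    by (simp add: c_def)
  ultimately show ?thesis by (simp add: c_def real_sqrt_divide)
qed

section \<open>Least eigenvalues and kernels with a checkerboard inverse\<close>

text \<open>Vectors are functions on the naturals, read below \<open>n\<close> only, so that
  scalings and test vectors carry no dimension side conditions.\<close>

definition bform :: "nat \<Rightarrow> (nat \<Rightarrow> nat \<Rightarrow> real) \<Rightarrow> (nat \<Rightarrow> real) \<Rightarrow> (nat \<Rightarrow> real) \<Rightarrow> real" where
  "bform n A u w = (\<Sum>i<n. \<Sum>j<n. u i * A i j * w j)"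

lemma bform_add_smult:
  assumes sym: "\<And>i j. i < n \<Longrightarrow> j < n \<Longrightarrow> A i j = A j i"
  shows "bform n A (\<lambda>i. u i + t * w i) (\<lambda>i. u i + t * w i)
    = bform n A u u + 2 * t * bform n A u w + t\<^sup>2 * bform n A w w"
proof -
  have "bform n A w u = bform n A u w"
    unfolding bform_def by (subst sum.swap) (auto intro!: sum.cong simp: sym)
  moreover have "bform n A (\<lambda>i. u i + t * w i) (\<lambda>i. u i + t * w i)
    = bform n A u u + t * bform n A u w + t * bform n A w u + t\<^sup>2 * bform n A w w"
    unfolding bform_def by (simp add: algebra_simps sum.distrib sum_distrib_left power2_eq_square)
  ultimately show ?thesis by simp
qed

lemma quadratic_nonneg_discriminant:
  fixes a b c :: real
  assumes "\<And>t. 0 \<le> a + 2 * t * b + t\<^sup>2 * c"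
  shows "b\<^sup>2 \<le> a * c"
proof (cases "c = 0")
  case True
  have "b = 0"
  proof (rule ccontr)
    assume "b \<noteq> 0"
    then have "a + 2 * (- (a + 1) / (2 * b)) * b + (- (a + 1) / (2 * b))\<^sup>2 * c = - 1"
      using True by (simp add: field_simps)
    with assms[of "- (a + 1) / (2 * b)"] show False by linarith
  qed
  then show ?thesis using True by simp
next
  case False
  have "0 \<le> a" using assms[of 0] by simp
  have "c > 0"
  proof (rule ccontr)
    assume "\<not> c > 0"
    then have c: "c < 0" using False by simp
    \<comment> \<open>A point so far out that \<open>t * c\<close> falls below
      \<open>- (2 * \<bar>b\<bar> + a)\<close>; with \<open>t \<ge> 1\<close> the quadratic is
      negative there.\<close>
    define t where "t = (\<bar>b\<bar> * 2 + a + 1) / (- c) + 1"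
    have "0 \<le> (\<bar>b\<bar> * 2 + a + 1) / (- c)" using c \<open>0 \<le> a\<close> by (intro divide_nonneg_pos) auto
    then have t: "t \<ge> 1" by (simp add: t_def)
    have "t * (- c) = \<bar>b\<bar> * 2 + a + 1 - c" using c by (simp add: t_def field_simps)
    then have "t * c < - (\<bar>b\<bar> * 2 + a)" using c by simp
    then have "t * (t * c) < t * - (\<bar>b\<bar> * 2 + a)" using t by (intro mult_strict_left_mono) auto
    moreover have "2 * t * b \<le> t * (\<bar>b\<bar> * 2)" using t by simp
    moreover have "a \<le> t * a" using t \<open>0 \<le> a\<close> by (simp add: mult_le_cancel_right1)
    ultimately have "a + 2 * t * b + t\<^sup>2 * c < 0" by (simp add: power2_eq_square algebra_simps)
    with assms[of t] show False by simp
  qed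
  have "a + 2 * (- b / c) * b + (- b / c)\<^sup>2 * c = a - b\<^sup>2 / c"
    using False by (simp add: power2_eq_square field_simps)
  with assms[of "- b / c"] have "b\<^sup>2 / c \<le> a" by simp
  then show ?thesis using \<open>c > 0\<close> by (simp add: field_simps)
qed

lemma bform_cauchy_schwarz:
  assumes "\<And>i j. i < n \<Longrightarrow> j < n \<Longrightarrow> A i j = A j i" and "\<And>u. 0 \<le> bform n A u u"
  shows "(bform n A u w)\<^sup>2 \<le> bform n A u u * bform n A w w"
proof (rule quadratic_nonneg_discriminant)
  fix t show "0 \<le> bform n A u u + 2 * t * bform n A u w + t\<^sup>2 * bform n A w w"
    using assms(2)[of "\<lambda>i. u i + t * w i"] by (simp only: bform_add_smult[OF assms(1)])
qed

lemma bform_bound: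
  "\<bar>bform n A v v\<bar> \<le> (\<Sum>i<n. \<Sum>j<n. \<bar>A i j\<bar>) * (\<Sum>i<n. (v i)\<^sup>2)"
proof -
  let ?S = "\<Sum>i<n. (v i)\<^sup>2"
  have "\<bar>v i * A i j * v j\<bar> \<le> \<bar>A i j\<bar> * ?S" if "i < n" "j < n" for i j
  proof -
    have s: "(v k)\<^sup>2 \<le> ?S" if "k < n" for k
      using that by (intro member_le_sum) auto
    have "\<bar>v i\<bar> * \<bar>v j\<bar> \<le> ((v i)\<^sup>2 + (v j)\<^sup>2) / 2"
      using sum_squares_bound[of "\<bar>v i\<bar>" "\<bar>v j\<bar>"] by simp
    also have "\<dots> \<le> ?S" using s[OF that(1)] s[OF that(2)] by simp
    finally have "\<bar>A i j\<bar> * (\<bar>v i\<bar> * \<bar>v j\<bar>) \<le> \<bar>A i j\<bar> * ?S" by (rule mult_left_mono) simp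
    then show ?thesis by (simp add: abs_mult mult_ac)
  qed
  then have "(\<Sum>i<n. \<Sum>j<n. \<bar>v i * A i j * v j\<bar>) \<le> (\<Sum>i<n. \<Sum>j<n. \<bar>A i j\<bar> * ?S)"
    by (intro sum_mono) auto
  moreover have "\<bar>bform n A v v\<bar> \<le> (\<Sum>i<n. \<Sum>j<n. \<bar>v i * A i j * v j\<bar>)"
    unfolding bform_def by (rule order.trans[OF sum_abs]) (intro sum_mono sum_abs)
  ultimately show ?thesis by (simp add: sum_distrib_right)
qed

abbreviation ent :: "real mat \<Rightarrow> nat \<Rightarrow> nat \<Rightarrow> real" where
  "ent M i j \<equiv> M $$ (i, j)"

lemma scalar_prod_mult_mat_vec:
  assumes "M \<in> carrier_mat n n" "u \<in> carrier_vec n" "w \<in> carrier_vec n"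
  shows "u \<bullet> (M *\<^sub>v w) = bform n (ent M) (\<lambda>i. u $ i) (\<lambda>i. w $ i)"
  using assms by (simp add: bform_def scalar_prod_def sum_distrib_left lessThan_atLeast0 mult_ac)

lemma scalar_prod_self: "v \<in> carrier_vec n \<Longrightarrow> v \<bullet> v = (\<Sum>i<n. ((v $ i) :: real)\<^sup>2)"
  by (simp add: scalar_prod_def power2_eq_square lessThan_atLeast0)

lemma bform_cong:
  "(\<And>i. i < n \<Longrightarrow> u i = u' i) \<Longrightarrow> (\<And>i. i < n \<Longrightarrow> w i = w' i) \<Longrightarrow>
   (\<And>i j. i < n \<Longrightarrow> j < n \<Longrightarrow> A i j = A' i j) \<Longrightarrow> bform n A u w = bform n A' u' w'"
  by (simp add: bform_def)

lemma sum_squares_pos: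
  fixes v :: "nat \<Rightarrow> real"
  assumes "i < n" "v i \<noteq> 0" shows "0 < (\<Sum>i<n. (v i)\<^sup>2)"
  using assms by (intro sum_pos2[of _ i]) auto

text \<open>If the shift of \<open>M\<close> by the infimum of its Rayleigh quotients were invertible, the shifted
  form would be bounded below by a positive multiple of the norm, so the infimum could be raised.\<close>

lemma symmetric_min_eigenvalue:
  fixes M :: "real mat"
  assumes M: "M \<in> carrier_mat n n" and sym: "transpose_mat M = M" and n: "n \<ge> 1"
  shows "\<exists>\<mu>. eigenvalue M \<mu> \<and> (\<forall>v. \<mu> * (\<Sum>i<n. (v i)\<^sup>2) \<le> bform n (ent M) v v)"
proof -
  define V where "V = {v :: nat \<Rightarrow> real. (\<Sum>i<n. (v i)\<^sup>2) = 1}"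
  define \<mu> where "\<mu> = (INF v\<in>V. bform n (ent M) v v)"
  define C where "C = (\<Sum>i<n. \<Sum>j<n. \<bar>ent M i j\<bar>)"
  have "(\<lambda>i. if i = 0 then 1 else 0) \<in> V" using n by (simp add: V_def if_distrib[of "\<lambda>x. x\<^sup>2"] cong: if_cong)
  then have ne: "V \<noteq> {}" by auto
  have bdd: "bdd_below ((\<lambda>v. bform n (ent M) v v) ` V)"
  proof (rule bdd_belowI2)
    fix v assume "v \<in> V"
    then show "- C \<le> bform n (ent M) v v" using bform_bound[of n "ent M" v] by (simp add: V_def C_def)
  qed
  have ray: "\<mu> * (\<Sum>i<n. (v i)\<^sup>2) \<le> bform n (ent M) v v" for v
  proof (cases "(\<Sum>i<n. (v i)\<^sup>2) = 0")
    case True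
    then show ?thesis using bform_bound[of n "ent M" v] by simp
  next
    case False
    define s where "s = (\<Sum>i<n. (v i)\<^sup>2)"
    have s: "s > 0" using False sum_nonneg[of "{..<n}" "\<lambda>i. (v i)\<^sup>2"] by (simp add: s_def less_le)
    have "(\<lambda>i. v i / sqrt s) \<in> V"
      using s by (simp add: V_def power_divide sum_divide_distrib[symmetric]) (simp add: s_def)
    then have "\<mu> \<le> bform n (ent M) (\<lambda>i. v i / sqrt s) (\<lambda>i. v i / sqrt s)"
      unfolding \<mu>_def by (intro cINF_lower bdd)
    also have "\<dots> = bform n (ent M) v v / s"
      using s by (simp add: bform_def sum_divide_distrib real_sqrt_mult_self)
    finally show ?thesis using s by (simp add: field_simps s_def[symmetric])
  qed
  have symM: "ent M i j = ent M j i" if "i < n" "j < n" for i j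
    using that M arg_cong[OF sym, of "\<lambda>A. A $$ (i, j)"] by auto
  define P where "P = M - \<mu> \<cdot>\<^sub>m 1\<^sub>m n"
  have P: "P \<in> carrier_mat n n" unfolding P_def by (intro minus_carrier_mat smult_carrier_mat one_carrier_mat)
  have bP: "bform n (ent P) v v = bform n (ent M) v v - \<mu> * (\<Sum>i<n. (v i)\<^sup>2)" for v
  proof -
    have "bform n (ent P) v v = (\<Sum>i<n. \<Sum>j<n. v i * ent M i j * v j - (if i = j then \<mu> * (v i)\<^sup>2 else 0))"
      unfolding bform_def using M
      by (intro sum.cong refl) (auto simp: P_def algebra_simps power2_eq_square)
    also have "\<dots> = bform n (ent M) v v - \<mu> * (\<Sum>i<n. (v i)\<^sup>2)"
      by (simp add: bform_def sum_subtractf sum_distrib_left)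
    finally show ?thesis .
  qed
  have symP: "ent P i j = ent P j i" if "i < n" "j < n" for i j
    using that M symM[OF that] by (auto simp: P_def)
  have psdP: "0 \<le> bform n (ent P) v v" for v using ray[of v] bP[of v] by simp
  have "det P = 0"
  proof (rule ccontr)
    assume "det P \<noteq> 0"
    then obtain B where B: "B \<in> carrier_mat n n" "P * B = 1\<^sub>m n"
      using det_non_zero_imp_unit[OF P, of undefined] P
      unfolding Units_def ring_mat_def by auto
    \<comment> \<open>A bound for the form of the inverse \<open>B\<close> on unit vectors. With w =
      B v one has 1 = (v, P w), so Cauchy-Schwarz for the form of \<open>P\<close> yields 1 \<le>
      (v, P v) (w, P w) \<le> c (v, P v).\<close>
    define c where "c = 1 + (\<Sum>i<n. \<Sum>j<n. \<bar>ent B i j\<bar>)"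
    have c: "c > 0" unfolding c_def by (intro add_pos_nonneg sum_nonneg) auto
    have "\<mu> + 1 / c \<le> bform n (ent M) v v" if "v \<in> V" for v
    proof -
      have v1: "(\<Sum>i<n. (v i)\<^sup>2) = 1" using that by (simp add: V_def)
      let ?v = "vec n v"
      let ?w = "B *\<^sub>v ?v"
      have w: "?w \<in> carrier_vec n" using B by simp
      have Pw: "P *\<^sub>v ?w = ?v"
        using B P by (simp add: assoc_mult_mat_vec[symmetric, of P n n B n])
      have "bform n (ent P) v (\<lambda>i. ?w $ i) = ?v \<bullet> (P *\<^sub>v ?w)"
        using scalar_prod_mult_mat_vec[OF P, of ?v ?w] w by (simp add: bform_def)
      also have "\<dots> = 1" unfolding Pw using v1 by (simp add: scalar_prod_self[of _ n])
      finally have one: "bform n (ent P) v (\<lambda>i. ?w $ i) = 1" .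
      have "bform n (ent P) (\<lambda>i. ?w $ i) (\<lambda>i. ?w $ i) = ?w \<bullet> (P *\<^sub>v ?w)"
        using scalar_prod_mult_mat_vec[OF P w w] by simp
      also have "\<dots> = ?v \<bullet> (B *\<^sub>v ?v)" unfolding Pw using w by (simp add: comm_scalar_prod[of _ n])
      also have "\<dots> = bform n (ent B) v v"
        using scalar_prod_mult_mat_vec[OF B(1), of ?v ?v] by (simp add: bform_def)
      also have "\<dots> \<le> c" using bform_bound[of n "ent B" v] v1 by (simp add: c_def)
      finally have two: "bform n (ent P) (\<lambda>i. ?w $ i) (\<lambda>i. ?w $ i) \<le> c" .
      have "1 \<le> bform n (ent P) v v * bform n (ent P) (\<lambda>i. ?w $ i) (\<lambda>i. ?w $ i)"
        using bform_cauchy_schwarz[of n "ent P" v "\<lambda>i. ?w $ i", OF symP psdP] one by simp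
      also have "\<dots> \<le> bform n (ent P) v v * c" using two psdP by (intro mult_left_mono)
      finally show ?thesis using c v1 bP[of v] by (simp add: field_simps)
    qed
    then have "\<mu> + 1 / c \<le> \<mu>" unfolding \<mu>_def[symmetric] using ne
      by (subst (2) \<mu>_def) (rule cINF_greatest)
    then show False using c by simp
  qed
  then obtain v where v: "v \<in> carrier_vec n" "v \<noteq> 0\<^sub>v n" "P *\<^sub>v v = 0\<^sub>v n"
    using det_0_iff_vec_prod_zero[OF P] by blast
  have "M *\<^sub>v v = \<mu> \<cdot>\<^sub>v v"
  proof (rule eq_vecI)
    fix i assume i: "i < dim_vec (\<mu> \<cdot>\<^sub>v v)"
    then have i': "i < n" using v by simp
    have "0 = (P *\<^sub>v v) $ i" using v i' by simp
    also have "\<dots> = (\<Sum>j<n. ent M i j * v $ j - (if i = j then \<mu> * v $ j else 0))"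
    proof -
      have "(P *\<^sub>v v) $ i = (\<Sum>j<n. ent P i j * v $ j)"
        using P v(1) i' by (simp add: scalar_prod_def lessThan_atLeast0)
      also have "\<dots> = (\<Sum>j<n. ent M i j * v $ j - (if i = j then \<mu> * v $ j else 0))"
        using M i' by (intro sum.cong refl) (auto simp: P_def algebra_simps)
      finally show ?thesis .
    qed
    also have "\<dots> = (M *\<^sub>v v) $ i - \<mu> * v $ i"
      using M v(1) i' by (simp add: sum_subtractf scalar_prod_def lessThan_atLeast0)
    finally show "(M *\<^sub>v v) $ i = (\<mu> \<cdot>\<^sub>v v) $ i" using v M i' by simp
  qed (use M v in auto)
  then have "eigenvalue M \<mu>"
    unfolding eigenvalue_def eigenvector_def using v M by auto
  then show ?thesis using ray by blast
qed

text \<open>Rayleigh characterisation: the least eigenvalue is the largest constant whose multiple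
  of the squared norm stays below the form. All later estimates of least eigenvalues go through
  these two facts.\<close>

lemma lambda_min_props:
  fixes M :: "real mat"
  assumes M: "M \<in> carrier_mat n n" and sym: "transpose_mat M = M" and n: "n \<ge> 1"
  shows "lambda_min M * (\<Sum>i<n. (v i)\<^sup>2) \<le> bform n (ent M) v v"
    and "(\<And>v. c * (\<Sum>i<n. (v i)\<^sup>2) \<le> bform n (ent M) v v) \<Longrightarrow> c \<le> lambda_min M"
proof -
  have eig: "c \<le> k" if k: "eigenvalue M k" and c: "\<And>v. c * (\<Sum>i<n. (v i)\<^sup>2) \<le> bform n (ent M) v v" for k c
  proof -
    obtain v where v: "v \<in> carrier_vec n" "v \<noteq> 0\<^sub>v n" "M *\<^sub>v v = k \<cdot>\<^sub>v v"
      using k M unfolding eigenvalue_def eigenvector_def by auto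
    obtain i where i: "i < n" "v $ i \<noteq> 0" using v(1,2) by (metis carrier_vecD eq_vecI index_zero_vec)
    have "bform n (ent M) (\<lambda>i. v $ i) (\<lambda>i. v $ i) = v \<bullet> (k \<cdot>\<^sub>v v)"
      using scalar_prod_mult_mat_vec[OF M v(1) v(1)] v(3) by simp
    also have "\<dots> = k * (\<Sum>i<n. (v $ i)\<^sup>2)" using v(1) by (simp add: scalar_prod_self)
    finally have "c * (\<Sum>i<n. (v $ i)\<^sup>2) \<le> k * (\<Sum>i<n. (v $ i)\<^sup>2)" using c[of "\<lambda>i. v $ i"] by simp
    then show ?thesis using sum_squares_pos[of i n "\<lambda>i. v $ i"] i by simp
  qed
  obtain \<mu> where \<mu>: "eigenvalue M \<mu>" "\<And>v. \<mu> * (\<Sum>i<n. (v i)\<^sup>2) \<le> bform n (ent M) v v"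
    using symmetric_min_eigenvalue[OF assms] by blast
  have "lambda_min M = \<mu>"
    unfolding lambda_min_def
    using card_finite_spectrum(1)[OF M] \<mu> eig by (intro Min_eqI) (auto simp: spectrum_def)
  then show "lambda_min M * (\<Sum>i<n. (v i)\<^sup>2) \<le> bform n (ent M) v v"
    and "(\<And>v. c * (\<Sum>i<n. (v i)\<^sup>2) \<le> bform n (ent M) v v) \<Longrightarrow> c \<le> lambda_min M"
    using \<mu> eig by auto
qed

lemma max_over_eqI:
  assumes "x \<in> S" "f x = y" "\<And>x. x \<in> S \<Longrightarrow> f x \<le> y"
  shows "max_over S f = y"
  unfolding max_over_def using assms by (intro Greatest_equality) auto

section \<open>Optimal diagonal scaling when the inverse has a checkerboard sign pattern\<close>

definition congruence_mat :: "nat \<Rightarrow> (nat \<Rightarrow> nat \<Rightarrow> real) \<Rightarrow> (nat \<Rightarrow> real) \<Rightarrow> real mat" where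
  "congruence_mat n E b = mat n n (\<lambda>(i, j). b i * b j * E i j)"

lemma bform_congruence_mat: "bform n (ent (congruence_mat n E b)) u w = bform n E (\<lambda>i. b i * u i) (\<lambda>i. b i * w i)"
  unfolding bform_def by (intro sum.cong refl) (simp add: congruence_mat_def mult_ac)

lemma sum_mult_delta:
  fixes f :: "nat \<Rightarrow> real"
  shows "i < n \<Longrightarrow> (\<Sum>j<n. f j * (if j = i then 1 else 0)) = f i"
proof -
  assume "i < n"
  have "(\<Sum>j<n. f j * (if j = i then 1 else 0)) = (\<Sum>j<n. if j = i then f j else 0)"
    by (intro sum.cong) auto
  then show ?thesis using \<open>i < n\<close> by (simp add: sum.delta)
qed

text \<open>Isolates the algebra at a fixed \<open>T\<close> from the small-time analysis, which has
  to supply the inverse relation \<open>EM\<close> and the sign pattern \<open>pos\<close>.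
  \<open>M\<close> enters as a right inverse; its symmetry is derived in
  \<open>M_sym\<close>.\<close>

locale checkerboard_inverse =
  fixes n :: nat and E M :: "nat \<Rightarrow> nat \<Rightarrow> real" and s :: "nat \<Rightarrow> real"
  assumes n: "1 \<le> n"
    and Esym: "\<And>i j. E i j = E j i"
    and Epsd: "\<And>u. 0 \<le> bform n E u u"
    and EM: "\<And>i j. i < n \<Longrightarrow> j < n \<Longrightarrow> (\<Sum>k<n. E i k * M k j) = (if i = j then 1 else 0)"
    and s1: "\<And>i. \<bar>s i\<bar> = 1"
    and pos: "\<And>i j. i < n \<Longrightarrow> j < n \<Longrightarrow> 0 < s i * s j * M i j"
begin

definition r :: "nat \<Rightarrow> real" where "r i = (\<Sum>j<n. \<bar>M i j\<bar>)"
definition R :: real where "R = (\<Sum>i<n. r i)"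

lemma abs_M: "i < n \<Longrightarrow> j < n \<Longrightarrow> \<bar>M i j\<bar> = s i * s j * M i j"
  using pos[of i j] s1[of i] s1[of j] by (metis abs_mult abs_of_pos mult_1)

lemma s_sq: "s i * s i = 1"
  using s1[of i] by (auto simp: abs_if split: if_splits)

lemma r_pos: "i < n \<Longrightarrow> 0 < r i"
  unfolding r_def
proof (rule sum_pos)
  fix j assume "i < n" "j \<in> {..<n}"
  then show "0 < \<bar>M i j\<bar>" using pos[of i j] by (cases "M i j = 0") auto
qed (use n in auto)

lemma R_pos: "0 < R"
  unfolding R_def using r_pos n by (intro sum_pos) (auto simp: lessThan_empty_iff)

lemma bform_E_right:
  "bform n E z (\<lambda>i. \<Sum>j<n. M i j * u j) = (\<Sum>i<n. z i * u i)"
proof -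
  have "bform n E z (\<lambda>i. \<Sum>j<n. M i j * u j) = (\<Sum>i<n. z i * (\<Sum>k<n. \<Sum>j<n. E i k * M k j * u j))"
    by (simp add: bform_def sum_distrib_left mult_ac)
  also have "\<dots> = (\<Sum>i<n. z i * (\<Sum>j<n. (\<Sum>k<n. E i k * M k j) * u j))"
    unfolding sum_distrib_right by (subst sum.swap) (rule refl)
  also have "\<dots> = (\<Sum>i<n. z i * (\<Sum>j<n. (if i = j then 1 else 0) * u j))"
    by (intro sum.cong refl arg_cong2[of _ _ _ _ "(*)"]) (simp add: EM)
  also have "\<dots> = (\<Sum>i<n. z i * u i)" by (simp add: if_distrib[of "\<lambda>x. x * _"] cong: if_cong)
  finally show ?thesis .
qed

lemma bform_E_M: "bform n E (\<lambda>i. \<Sum>j<n. M i j * u j) (\<lambda>i. \<Sum>j<n. M i j * u j) = bform n M u u"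
proof -
  have "bform n E (\<lambda>i. \<Sum>j<n. M i j * u j) (\<lambda>i. \<Sum>j<n. M i j * u j) = (\<Sum>i<n. \<Sum>j<n. M i j * u j * u i)"
    unfolding bform_E_right by (simp add: sum_distrib_right)
  then show ?thesis by (simp add: bform_def mult_ac)
qed

lemma M_sym: assumes "i < n" "j < n" shows "M i j = M j i"
proof -
  let ?e = "\<lambda>i k. if k = i then 1 else (0::real)"
  have col: "(\<Sum>j<n. M k j * ?e i j) = M k i" if "i < n" for k i
    using that by (rule sum_mult_delta)
  have "bform n E (\<lambda>k. M k i) (\<lambda>k. M k j) = M j i" if "i < n" "j < n" for i j
  proof -
    have "bform n E (\<lambda>k. M k i) (\<lambda>k. M k j) = bform n E (\<lambda>k. M k i) (\<lambda>k. \<Sum>l<n. M k l * ?e j l)"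
      using that by (simp only: col)
    then show ?thesis unfolding bform_E_right using that by (simp only: sum_mult_delta)
  qed
  moreover have "bform n E u w = bform n E w u" for u w
    unfolding bform_def by (subst sum.swap) (simp add: Esym mult_ac)
  ultimately show ?thesis using assms by metis
qed

text \<open>Schur test: each product \<open>u i * u j\<close> is replaced by half the sum of the
  squares, and symmetry of \<open>M\<close> collects both halves into the row sums. As forms,
  \<open>M\<close> is at most diag r.\<close>

lemma bform_M_le: "bform n M u u \<le> (\<Sum>i<n. r i * (u i)\<^sup>2)"
proof -
  have "bform n M u u \<le> (\<Sum>i<n. \<Sum>j<n. \<bar>M i j\<bar> * (u i)\<^sup>2 / 2 + \<bar>M i j\<bar> * (u j)\<^sup>2 / 2)"
    unfolding bform_def
  proof (intro sum_mono)
    fix i j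
    have "u i * M i j * u j \<le> \<bar>M i j\<bar> * (\<bar>u i\<bar> * \<bar>u j\<bar>)"
      using abs_ge_self[of "u i * M i j * u j"] by (simp add: abs_mult mult_ac)
    also have "\<dots> \<le> \<bar>M i j\<bar> * (((u i)\<^sup>2 + (u j)\<^sup>2) / 2)"
      using sum_squares_bound[of "\<bar>u i\<bar>" "\<bar>u j\<bar>"] by (intro mult_left_mono) auto
    finally show "u i * M i j * u j \<le> \<bar>M i j\<bar> * (u i)\<^sup>2 / 2 + \<bar>M i j\<bar> * (u j)\<^sup>2 / 2"
      by (simp add: algebra_simps add_divide_distrib)
  qed
  also have "\<dots> = (\<Sum>i<n. \<Sum>j<n. \<bar>M i j\<bar> * (u i)\<^sup>2 / 2) + (\<Sum>j<n. \<Sum>i<n. \<bar>M i j\<bar> * (u j)\<^sup>2 / 2)"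
    unfolding sum.distrib by (subst (3) sum.swap) (rule refl)
  also have "(\<Sum>j<n. \<Sum>i<n. \<bar>M i j\<bar> * (u j)\<^sup>2 / 2) = (\<Sum>j<n. \<Sum>i<n. \<bar>M j i\<bar> * (u j)\<^sup>2 / 2)"
    by (intro sum.cong refl) (simp add: M_sym)
  finally show ?thesis by (simp add: r_def sum_distrib_right sum_divide_distrib[symmetric] sum.distrib[symmetric])
qed

text \<open>Inversion reverses the order of forms, so \<open>bform_M_le\<close> turns into a lower
  bound for \<open>E\<close>. Concretely, Cauchy-Schwarz for \<open>E\<close> is applied to
  \<open>z\<close> and \<open>M u\<close> with \<open>u = z / r\<close>, the choice for which the
  pairing and the bound on the form of \<open>M\<close> coincide.\<close>

lemma E_lower: "(\<Sum>i<n. (z i)\<^sup>2 / r i) \<le> bform n E z z"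
proof -
  define S where "S = (\<Sum>i<n. (z i)\<^sup>2 / r i)"
  define u where "u = (\<lambda>i. z i / r i)"
  have S0: "0 \<le> S" unfolding S_def using r_pos by (intro sum_nonneg divide_nonneg_nonneg) (auto simp: less_imp_le)
  have zu: "(\<Sum>i<n. z i * u i) = S" by (simp add: S_def u_def power2_eq_square)
  have ru: "(\<Sum>i<n. r i * (u i)\<^sup>2) = S"
    unfolding S_def u_def using r_pos by (intro sum.cong refl) (auto simp: power2_eq_square less_imp_neq)
  have "S\<^sup>2 \<le> bform n E z z * bform n M u u"
    using bform_cauchy_schwarz[of n E z "\<lambda>i. \<Sum>j<n. M i j * u j", OF Esym Epsd]
    unfolding bform_E_M unfolding bform_E_right zu .
  also have "\<dots> \<le> bform n E z z * S"
    using bform_M_le[of u] Epsd unfolding ru by (intro mult_left_mono)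
  finally have "S * S \<le> bform n E z z * S" by (simp add: power2_eq_square)
  then show ?thesis using S0 Epsd[of z] unfolding S_def[symmetric]
    by (cases "S = 0") (auto simp: mult_le_cancel_right)
qed

lemma congruence_mat_sym: "transpose_mat (congruence_mat n E b) = congruence_mat n E b"
  by (rule eq_matI) (auto simp: congruence_mat_def Esym mult_ac)

lemma congruence_mat_carrier: "congruence_mat n E b \<in> carrier_mat n n"
  by (simp add: congruence_mat_def)

lemmas lambda_min_congruence = lambda_min_props[OF congruence_mat_carrier congruence_mat_sym n]

lemma lambda_min_optimal:
  assumes "\<And>i. i < n \<Longrightarrow> (b i)\<^sup>2 = r i / R"
  shows "1 / R \<le> lambda_min (congruence_mat n E b)"
proof (rule lambda_min_congruence(2))
  fix v
  have "1 / R * (v i)\<^sup>2 = (b i * v i)\<^sup>2 / r i" if "i < n" for i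
    using assms[OF that] r_pos[OF that] by (simp add: power_mult_distrib)
  then have "1 / R * (\<Sum>i<n. (v i)\<^sup>2) = (\<Sum>i<n. (b i * v i)\<^sup>2 / r i)"
    unfolding sum_distrib_left by (intro sum.cong refl) auto
  also have "\<dots> \<le> bform n (ent (congruence_mat n E b)) v v"
    unfolding bform_congruence_mat by (rule E_lower)
  finally show "1 / R * (\<Sum>i<n. (v i)\<^sup>2) \<le> bform n (ent (congruence_mat n E b)) v v" .
qed

text \<open>At the test vector \<open>x / b\<close> the form equals \<open>R\<close> whatever
  \<open>b\<close> is, so \<open>b\<close> enters only through the squared norm \<open>Y\<close>.
  Under the constraint on \<open>b\<close> one has Y \<ge> R^2, and the case of equality determines
  \<open>b\<close> up to signs.\<close>

lemma lambda_min_le: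
  assumes b: "(\<Sum>i<n. (b i)\<^sup>2) = 1"
  shows "lambda_min (congruence_mat n E b) \<le> 1 / R"
    and "lambda_min (congruence_mat n E b) = 1 / R \<Longrightarrow> i < n \<Longrightarrow> (b i)\<^sup>2 = r i / R"
proof -
  let ?L = "lambda_min (congruence_mat n E b)"
  have "?L \<le> 1 / R \<and> (?L = 1 / R \<longrightarrow> (\<forall>i<n. (b i)\<^sup>2 = r i / R))"
  proof (cases "\<exists>i<n. b i = 0")
    case True
    then obtain k where k: "k < n" "b k = 0" by blast
    \<comment> \<open>A zero coordinate of \<open>b\<close> makes the form vanish at the
      \<open>k\<close>-th unit vector. The quotient \<open>x / b\<close> is available only in the
      other case.\<close>
    have "?L * (\<Sum>i<n. (if i = k then 1 else 0)\<^sup>2)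
        \<le> bform n E (\<lambda>i. b i * (if i = k then 1 else 0)) (\<lambda>i. b i * (if i = k then 1 else 0))"
      using lambda_min_congruence(1)[of b "\<lambda>i. if i = k then 1 else 0"] unfolding bform_congruence_mat .
    also have "(\<lambda>i. b i * (if i = k then 1 else 0)) = (\<lambda>i. 0)" using k by auto
    finally have "?L \<le> 0" using k by (simp add: bform_def if_distrib[of "\<lambda>x. x\<^sup>2"] cong: if_cong)
    moreover have "0 < 1 / R" using R_pos by simp
    ultimately show ?thesis by linarith
  next
    case False
    define x where "x = (\<lambda>i. \<Sum>j<n. M i j * s j)"
    have x: "x i = s i * r i" if "i < n" for i
      unfolding x_def r_def sum_distrib_left using that
      by (intro sum.cong refl) (simp add: abs_M mult.assoc[symmetric] s_sq)
    define Y where "Y = (\<Sum>i<n. (x i / b i)\<^sup>2)"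
    have Y: "Y = (\<Sum>i<n. (r i / b i)\<^sup>2)"
      unfolding Y_def using s_sq by (intro sum.cong refl) (auto simp: x power_mult_distrib power2_eq_square)
    have "?L * Y \<le> bform n E (\<lambda>i. b i * (x i / b i)) (\<lambda>i. b i * (x i / b i))"
      using lambda_min_congruence(1)[of b "\<lambda>i. x i / b i"] unfolding bform_congruence_mat Y_def .
    also have "\<dots> = bform n E x x" using False by (intro bform_cong) auto
    also have "\<dots> = (\<Sum>i<n. x i * s i)" by (subst (2) x_def) (rule bform_E_right)
    also have "\<dots> = R" unfolding R_def by (intro sum.cong refl) (simp add: x mult.commute mult.left_commute s_sq)
    finally have LY: "?L * Y \<le> R" .
    \<comment> \<open>Completed squares displaying the defect in Y \<ge> R^2; if it is 0, then
      \<open>r i / b i = R * b i\<close> for every \<open>i\<close>.\<close>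
    have "(\<Sum>i<n. (r i / b i - R * b i)\<^sup>2) = (\<Sum>i<n. (r i / b i)\<^sup>2 - 2 * R * r i + R\<^sup>2 * (b i)\<^sup>2)"
      using False by (intro sum.cong refl) (auto simp: power2_eq_square algebra_simps)
    also have "\<dots> = Y - 2 * R * R + R\<^sup>2"
      using b by (simp add: Y sum.distrib sum_subtractf sum_distrib_left[symmetric] R_def[symmetric])
    finally have sq: "(\<Sum>i<n. (r i / b i - R * b i)\<^sup>2) = Y - R\<^sup>2" by (simp add: power2_eq_square)
    moreover have "0 \<le> (\<Sum>i<n. (r i / b i - R * b i)\<^sup>2)" by (intro sum_nonneg) auto
    ultimately have YR: "R\<^sup>2 \<le> Y" by simp
    then have Y0: "0 < Y" using R_pos by (meson less_le_trans zero_less_power)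
    have "?L \<le> R / Y" using LY Y0 by (simp add: field_simps)
    also have RY: "R / Y \<le> R / R\<^sup>2" using YR R_pos Y0 by (intro divide_left_mono) auto
    finally have le: "?L \<le> 1 / R" using R_pos by (simp add: power2_eq_square)
    moreover have "(b i)\<^sup>2 = r i / R" if eq: "?L = 1 / R" and i: "i < n" for i
    proof -
      have "Y \<le> R * R" using LY R_pos unfolding eq by (simp add: field_simps)
      then have "(\<Sum>i<n. (r i / b i - R * b i)\<^sup>2) = 0" using sq YR by (simp add: power2_eq_square)
      then have "r i / b i - R * b i = 0" using i by (simp add: sum_nonneg_eq_0_iff)
      then show ?thesis using False i R_pos by (simp add: field_simps power2_eq_square)
    qed
    ultimately show ?thesis by blast
  qed
  then show "?L \<le> 1 / R" "?L = 1 / R \<Longrightarrow> i < n \<Longrightarrow> (b i)\<^sup>2 = r i / R" by auto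
qed

end

section \<open>Gramians of the truncated Dirichlet Laplacian\<close>

definition dir_eig :: "nat \<Rightarrow> real" where
  "dir_eig i = (real (Suc i))\<^sup>2"

lemma dir_eig_pos: "0 < dir_eig i"
  by (simp add: dir_eig_def)

lemma inj_dir_eig: "inj_on dir_eig S"
  by (rule inj_onI) (simp add: dir_eig_def power2_eq_iff_nonneg)

definition gram_kernel :: "real \<Rightarrow> nat \<Rightarrow> nat \<Rightarrow> real" where
  "gram_kernel T i j = (1 - exp (- (dir_eig i + dir_eig j) * T)) / (dir_eig i + dir_eig j)"

lemma A_dir_alt: "A_dir N = mat_diag N (\<lambda>i. - dir_eig i)"
  by (simp add: A_dir_def dir_eig_def)

lemma A_dir_dim [simp]: "dim_row (A_dir N) = N" "dim_col (A_dir N) = N" "A_dir N \<in> carrier_mat N N"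
  by (simp_all add: A_dir_def mat_diag_def)

lemma mat_diag_pow: "mat_diag n f ^\<^sub>m k = mat_diag n (\<lambda>i. (f i :: real) ^ k)"
proof (induction k)
  case 0
  show ?case by (simp add: mat_diag_def)
next
  case (Suc k)
  show ?case by (simp add: Suc mat_diag_diag mult.commute)
qed

lemma mat_exp_mat_diag: "mat_exp (mat_diag n f) = mat_diag n (\<lambda>i. exp (f i))"
proof (rule eq_matI)
  fix i j assume "i < dim_row (mat_diag n (\<lambda>i. exp (f i)))" "j < dim_col (mat_diag n (\<lambda>i. exp (f i)))"
  then have ij: "i < n" "j < n" by (simp_all add: mat_diag_def)
  have "(\<Sum>k. x ^ k / fact k) = exp x" for x :: real
    by (simp add: exp_def divide_inverse mult.commute)
  then show "mat_exp (mat_diag n f) $$ (i, j) = mat_diag n (\<lambda>i. exp (f i)) $$ (i, j)"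
    using ij by (simp add: mat_exp_def mat_diag_pow) (simp add: mat_diag_def)
qed (simp_all add: mat_exp_def mat_diag_def)

lemma smult_mat_diag: "t \<cdot>\<^sub>m mat_diag n f = mat_diag n (\<lambda>i. t * (f i :: real))"
  by (rule eq_matI) (auto simp: mat_diag_def)

lemma transpose_mat_diag: "transpose_mat (mat_diag n f) = mat_diag n f"
  by (rule eq_matI) (auto simp: mat_diag_def)

lemma exp_has_integral:
  fixes s T :: real
  assumes "s \<noteq> 0" "0 \<le> T"
  shows "((\<lambda>t. exp (- s * t)) has_integral (1 - exp (- s * T)) / s) {0..T}"
proof -
  have "((\<lambda>t. exp (- s * t)) has_integral (- exp (- s * T) / s - - exp (- s * 0) / s)) {0..T}"
    by (rule fundamental_theorem_of_calculus)
      (use assms in \<open>auto intro!: derivative_eq_intros simp: has_real_derivative_iff_has_vector_derivative[symmetric]\<close>)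
  then show ?thesis by (simp add: diff_divide_distrib)
qed

lemma gram_kernel_has_integral:
  assumes "0 \<le> T"
  shows "((\<lambda>t. exp (- dir_eig i * t) * exp (- dir_eig j * t)) has_integral gram_kernel T i j) {0..T}"
proof -
  have "((\<lambda>t. exp (- (dir_eig i + dir_eig j) * t)) has_integral gram_kernel T i j) {0..T}"
    unfolding gram_kernel_def using dir_eig_pos[of i] dir_eig_pos[of j] assms
    by (intro exp_has_integral) auto
  then show ?thesis by (simp add: exp_add[symmetric] algebra_simps)
qed

lemma gramian_A_dir:
  assumes X: "X \<in> carrier_mat N N" and T: "0 \<le> T"
  shows "gramian (A_dir N) T X = mat N N (\<lambda>(i, j). X $$ (i, j) * gram_kernel T i j)"
proof -
  have "integral {0..T} (\<lambda>t. (mat_exp (t \<cdot>\<^sub>m A_dir N) * X * mat_exp (t \<cdot>\<^sub>m transpose_mat (A_dir N))) $$ (i, j))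
      = X $$ (i, j) * gram_kernel T i j" if ij: "i < N" "j < N" for i j
  proof (rule integral_unique)
    have "(mat_exp (t \<cdot>\<^sub>m A_dir N) * X * mat_exp (t \<cdot>\<^sub>m transpose_mat (A_dir N))) $$ (i, j)
      = X $$ (i, j) * (exp (- dir_eig i * t) * exp (- dir_eig j * t))" for t
      using ij X unfolding A_dir_alt transpose_mat_diag smult_mat_diag mat_exp_mat_diag
      by (simp add: mat_diag_mult_left[OF X] mat_diag_mult_right[of _ N N] mult_ac)
    then show "((\<lambda>t. (mat_exp (t \<cdot>\<^sub>m A_dir N) * X * mat_exp (t \<cdot>\<^sub>m transpose_mat (A_dir N))) $$ (i, j))
      has_integral X $$ (i, j) * gram_kernel T i j) {0..T}"
      using has_integral_mult_right[OF gram_kernel_has_integral[OF T]] by simp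
  qed
  then show ?thesis unfolding gramian_def by (intro eq_matI) auto
qed

lemma rank1_gramian_A_dir:
  assumes "b \<in> carrier_vec N" "0 \<le> T"
  shows "rank1_gramian (A_dir N) T b = congruence_mat N (gram_kernel T) (\<lambda>i. b $ i)"
proof -
  have "outer_square b \<in> carrier_mat N N" using assms(1) by (simp add: outer_square_def)
  from gramian_A_dir[OF this assms(2)] show ?thesis
    unfolding rank1_gramian_def using assms(1)
    by (intro eq_matI) (auto simp: congruence_mat_def outer_square_def)
qed

lemma gram_kernel_sym: "gram_kernel T i j = gram_kernel T j i"
  by (simp add: gram_kernel_def add.commute)

lemma gram_kernel_psd:
  assumes "0 \<le> T" shows "0 \<le> bform N (gram_kernel T) u u"
proof -
  have "((\<lambda>t. \<Sum>i<N. \<Sum>j<N. u i * (exp (- dir_eig i * t) * exp (- dir_eig j * t)) * u j)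
      has_integral bform N (gram_kernel T) u u) {0..T}"
    unfolding bform_def
    by (intro has_integral_sum has_integral_mult_right has_integral_mult_left gram_kernel_has_integral assms) auto
  moreover have "0 \<le> (\<Sum>i<N. \<Sum>j<N. u i * (exp (- dir_eig i * t) * exp (- dir_eig j * t)) * u j)" for t
  proof -
    have "(\<Sum>i<N. \<Sum>j<N. u i * (exp (- dir_eig i * t) * exp (- dir_eig j * t)) * u j)
      = (\<Sum>i<N. u i * exp (- dir_eig i * t))\<^sup>2"
      unfolding power2_eq_square sum_product by (simp add: mult_ac)
    then show ?thesis by simp
  qed
  ultimately show ?thesis by (rule has_integral_nonneg)
qed

lemma unit_sphere_iff:
  "b \<in> unit_sphere N \<longleftrightarrow> b \<in> carrier_vec N \<and> (\<Sum>i<N. (b $ i)\<^sup>2) = 1"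
  by (auto simp: unit_sphere_def enorm_def scalar_prod_self)

lemma gamma1_A_dir:
  assumes "checkerboard_inverse N (gram_kernel T) M s" and T: "0 \<le> T"
  defines "p \<equiv> (\<lambda>i. checkerboard_inverse.r N M i / checkerboard_inverse.R N M)"
  shows "gamma1 (A_dir N) T = 1 / checkerboard_inverse.R N M" (is ?g)
    and "gamma1_maximizers (A_dir N) T = {b \<in> carrier_vec N. \<forall>i<N. (b $ i)\<^sup>2 = p i}" (is ?m)
proof -
  interpret checkerboard_inverse N "gram_kernel T" M s by fact
  have p: "p = (\<lambda>i. r i / R)" by (simp add: p_def)
  have psum: "(\<Sum>i<N. p i) = 1" using R_pos by (simp add: p sum_divide_distrib[symmetric] R_def[symmetric])
  have lm: "lambda_min (rank1_gramian (A_dir N) T b) = lambda_min (congruence_mat N (gram_kernel T) (\<lambda>i. b $ i))"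
    if "b \<in> carrier_vec N" for b using rank1_gramian_A_dir[OF that T] by simp
  have opt: "b \<in> unit_sphere N \<and> lambda_min (rank1_gramian (A_dir N) T b) = 1 / R"
    if "b \<in> carrier_vec N" "\<forall>i<N. (b $ i)\<^sup>2 = p i" for b
  proof -
    have "(\<Sum>i<N. (b $ i)\<^sup>2) = 1" using that psum by simp
    then show ?thesis
      using that lambda_min_optimal[of "\<lambda>i. b $ i"] lambda_min_le(1)[of "\<lambda>i. b $ i"] lm
      by (auto simp: unit_sphere_iff p intro: antisym)
  qed
  \<comment> \<open>\<open>max_over\<close> is a maximum, so the bound \<open>1 / R\<close> has to
    be attained; \<open>b0\<close> is the optimal vector with all signs positive.\<close>
  define b0 where "b0 = vec N (\<lambda>i. sqrt (p i))"
  have "0 \<le> p i" if "i < N" for i using r_pos[OF that] R_pos by (simp add: p)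
  then have b0: "b0 \<in> carrier_vec N" "\<forall>i<N. (b0 $ i)\<^sup>2 = p i" by (auto simp: b0_def)
  have le: "lambda_min (rank1_gramian (A_dir N) T b) \<le> 1 / R" if "b \<in> unit_sphere N" for b
    using that lambda_min_le(1)[of "\<lambda>i. b $ i"] lm[of b] by (simp add: unit_sphere_iff)
  show ?g unfolding gamma1_def A_dir_dim using opt[OF b0] le by (intro max_over_eqI[of b0]) auto
  then have g: "gamma1 (A_dir N) T = 1 / R" .
  show ?m
  proof (intro equalityI subsetI)
    fix b assume "b \<in> gamma1_maximizers (A_dir N) T"
    then have b: "b \<in> carrier_vec N" "(\<Sum>i<N. (b $ i)\<^sup>2) = 1"
      "lambda_min (congruence_mat N (gram_kernel T) (\<lambda>i. b $ i)) = 1 / R"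
      using lm[of b] by (simp_all add: gamma1_maximizers_def g unit_sphere_iff)
    show "b \<in> {b \<in> carrier_vec N. \<forall>i<N. (b $ i)\<^sup>2 = p i}"
      using b(1) lambda_min_le(2)[OF b(2,3)] unfolding p by blast
  next
    fix b assume "b \<in> {b \<in> carrier_vec N. \<forall>i<N. (b $ i)\<^sup>2 = p i}"
    then have "b \<in> unit_sphere N \<and> lambda_min (rank1_gramian (A_dir N) T b) = 1 / R"
      using opt[of b] by blast
    then show "b \<in> gamma1_maximizers (A_dir N) T"
      by (simp add: gamma1_maximizers_def g)
  qed
qed

text \<open>Testing on unit vectors gives L \<le> Y_kk g_k for the least eigenvalue L; dividing by
  g_k and summing leaves only the trace of Y. Equality holds for the diagonal X with entries
  proportional to 1 / g_k, whose Gramian is a multiple of the identity.\<close>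

lemma gamma_rel_A_dir:
  assumes N: "1 \<le> N" and T: "0 < T"
  shows "gamma_rel (A_dir N) T = 1 / (\<Sum>i<N. 1 / gram_kernel T i i)"
proof -
  define g where "g = (\<lambda>i. gram_kernel T i i)"
  have gpos: "0 < g i" for i
    using T dir_eig_pos[of i] by (simp add: g_def gram_kernel_def)
  define S where "S = (\<Sum>i<N. 1 / g i)"
  have S: "0 < S" unfolding S_def using gpos N by (intro sum_pos) (auto simp: lessThan_empty_iff)
  define X where "X = mat_diag N (\<lambda>i. 1 / (S * g i))"
  have X: "X \<in> carrier_mat N N" by (simp add: X_def mat_diag_def)
  have sym: "transpose_mat (gramian (A_dir N) T Y) = gramian (A_dir N) T Y"
    and car: "gramian (A_dir N) T Y \<in> carrier_mat N N"
    if "Y \<in> carrier_mat N N" "transpose_mat Y = Y" for Y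
  proof -
    have "Y $$ (i, j) = Y $$ (j, i)" if "i < N" "j < N" for i j
      using that \<open>Y \<in> carrier_mat N N\<close> arg_cong[OF \<open>transpose_mat Y = Y\<close>, of "\<lambda>A. A $$ (i, j)"] by auto
    then show "transpose_mat (gramian (A_dir N) T Y) = gramian (A_dir N) T Y"
      unfolding gramian_A_dir[OF that(1) less_imp_le[OF T]] by (intro eq_matI) (auto simp: gram_kernel_sym)
    show "gramian (A_dir N) T Y \<in> carrier_mat N N"
      unfolding gramian_A_dir[OF that(1) less_imp_le[OF T]] by simp
  qed
  have le: "lambda_min (gramian (A_dir N) T Y) \<le> 1 / S"
    if Y: "Y \<in> carrier_mat N N" "transpose_mat Y = Y" "mat_trace Y = 1" for Y
  proof -
    let ?L = "lambda_min (gramian (A_dir N) T Y)"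
    have "?L * (1 / g k) \<le> Y $$ (k, k)" if k: "k < N" for k
    proof -
      let ?e = "\<lambda>i. if i = k then 1 else (0::real)"
      have one: "(\<Sum>i<N. (?e i)\<^sup>2) = 1"
        using sum_mult_delta[OF k, of ?e] by (simp add: power2_eq_square)
      have "bform N (ent (gramian (A_dir N) T Y)) ?e ?e
          = (\<Sum>i<N. (\<Sum>j<N. ent (gramian (A_dir N) T Y) i j * ?e j) * ?e i)"
        by (simp only: bform_def sum_distrib_right sum_distrib_left mult_ac)
      also have "\<dots> = Y $$ (k, k) * g k"
        unfolding sum_mult_delta[OF k] using k by (simp add: gramian_A_dir[OF Y(1) less_imp_le[OF T]] g_def)
      finally have "?L \<le> Y $$ (k, k) * g k"
        using lambda_min_props(1)[OF car[OF Y(1,2)] sym[OF Y(1,2)] N, of ?e] one by simp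
      then show ?thesis using gpos[of k] by (simp add: divide_le_eq)
    qed
    then have "(\<Sum>k<N. ?L * (1 / g k)) \<le> (\<Sum>k<N. Y $$ (k, k))" by (intro sum_mono) auto
    then have "?L * S \<le> 1" using Y by (simp add: S_def sum_distrib_left mat_trace_def)
    then show ?thesis using S by (simp add: field_simps)
  qed
  have trX: "mat_trace X = 1"
  proof -
    have "mat_trace X = (\<Sum>i<N. 1 / S * (1 / g i))"
      by (simp add: mat_trace_def X_def mat_diag_def)
    also have "\<dots> = 1 / S * S" unfolding S_def sum_distrib_left ..
    finally show ?thesis using S by simp
  qed
  have bX: "bform N (ent X) v v = (\<Sum>i<N. (v i)\<^sup>2 / (S * g i))" for v
  proof -
    have "bform N (ent X) v v = (\<Sum>i<N. \<Sum>j<N. (v j * (1 / (S * g j)) * v j) * (if j = i then 1 else 0))"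
      unfolding bform_def by (intro sum.cong refl) (auto simp: X_def mat_diag_def)
    also have "\<dots> = (\<Sum>i<N. v i * (1 / (S * g i)) * v i)"
      by (intro sum.cong refl sum_mult_delta) auto
    finally show ?thesis by (simp add: power2_eq_square)
  qed
  have "0 \<le> v \<bullet> (X *\<^sub>v v)" if "v \<in> carrier_vec N" for v
    unfolding scalar_prod_mult_mat_vec[OF X that that] bX
    using gpos S by (intro sum_nonneg divide_nonneg_nonneg mult_nonneg_nonneg) (auto simp: less_imp_le)
  then have psdX: "X \<in> psd N"
    using X by (auto simp: psd_def X_def transpose_mat_diag)
  then have tX: "transpose_mat X = X" by (simp add: psd_def)
  have "1 / S \<le> lambda_min (gramian (A_dir N) T X)"
  proof (rule lambda_min_props(2)[OF car[OF X tX] sym[OF X tX] N])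
    fix v :: "nat \<Rightarrow> real"
    have "bform N (ent (gramian (A_dir N) T X)) v v
        = (\<Sum>i<N. \<Sum>j<N. (v j * (1 / S) * v j) * (if j = i then 1 else 0))"
      unfolding bform_def gramian_A_dir[OF X less_imp_le[OF T]] using gpos
      by (intro sum.cong refl) (auto simp: X_def mat_diag_def g_def less_imp_neq[symmetric])
    also have "\<dots> = (\<Sum>i<N. v i * (1 / S) * v i)"
      by (intro sum.cong refl sum_mult_delta) auto
    also have "\<dots> = 1 / S * (\<Sum>i<N. (v i)\<^sup>2)" by (simp add: sum_distrib_left power2_eq_square)
    finally show "1 / S * (\<Sum>i<N. (v i)\<^sup>2) \<le> bform N (ent (gramian (A_dir N) T X)) v v" by simp
  qed
  then have "lambda_min (gramian (A_dir N) T X) = 1 / S" using le[OF X tX trX] by simp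
  then show ?thesis unfolding gamma_rel_def S_def[symmetric, unfolded g_def]
    using psdX trX le by (intro max_over_eqI[of X]) (auto simp: psd_def)
qed

section \<open>Counting vectors and lines with prescribed squared coordinates\<close>

definition sign_vec :: "nat \<Rightarrow> (nat \<Rightarrow> real) \<Rightarrow> nat set \<Rightarrow> real vec" where
  "sign_vec N p S = vec N (\<lambda>i. if i \<in> S then sqrt (p i) else - sqrt (p i))"

text \<open>A choice of signs is encoded by its set of positive coordinates, so that counting
  becomes the cardinality of a power set. Positivity of \<open>p\<close> keeps the two signs
  distinct.\<close>

lemma sign_vecs:
  assumes p: "\<And>i. i < N \<Longrightarrow> 0 < p i"
  shows "{b \<in> carrier_vec N. \<forall>i<N. (b $ i)\<^sup>2 = p i} = sign_vec N p ` Pow {..<N}" (is "?B = _")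
    and "inj_on (sign_vec N p) (Pow {..<N})"
proof -
  show "?B = sign_vec N p ` Pow {..<N}"
  proof (intro equalityI subsetI)
    fix b assume b: "b \<in> ?B"
    define S where "S = {i. i < N \<and> 0 < b $ i}"
    have "b = sign_vec N p S"
    proof (rule eq_vecI)
      fix i assume "i < dim_vec (sign_vec N p S)"
      then have i: "i < N" by (simp add: sign_vec_def)
      then have "sqrt (p i) = \<bar>b $ i\<bar>" using b by (auto simp flip: real_sqrt_abs)
      then show "b $ i = sign_vec N p S $ i" using i by (auto simp: sign_vec_def S_def)
    qed (use b in \<open>auto simp: sign_vec_def\<close>)
    moreover have "S \<in> Pow {..<N}" by (auto simp: S_def)
    ultimately show "b \<in> sign_vec N p ` Pow {..<N}" by blast
  next
    fix b assume "b \<in> sign_vec N p ` Pow {..<N}"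
    then show "b \<in> ?B" using p by (auto simp: sign_vec_def less_imp_le)
  qed
  show "inj_on (sign_vec N p) (Pow {..<N})"
  proof (rule inj_onI)
    fix S S' assume S: "S \<in> Pow {..<N}" "S' \<in> Pow {..<N}" "sign_vec N p S = sign_vec N p S'"
    have "i \<in> S \<longleftrightarrow> i \<in> S'" if i: "i < N" for i
    proof -
      have "sign_vec N p S $ i = sign_vec N p S' $ i" using S by simp
      moreover have "sqrt (p i) \<noteq> - sqrt (p i)" "- sqrt (p i) \<noteq> sqrt (p i)"
        using p[OF i] by (simp_all add: eq_neg_iff_add_eq_0 neg_eq_iff_add_eq_0)
      ultimately show ?thesis using i by (auto simp: sign_vec_def split: if_splits)
    qed
    then show "S = S'" using S by auto
  qed
qed

lemma card_sign_vecs: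
  assumes N: "1 \<le> N" and p: "\<And>i. i < N \<Longrightarrow> 0 < p i"
  defines "B \<equiv> {b \<in> carrier_vec N. \<forall>i<N. (b $ i)\<^sup>2 = p i}"
  shows "card B = 2 ^ N" and "card (line_through ` B) = 2 ^ (N - 1)"
proof -
  have sv: "B = sign_vec N p ` Pow {..<N}" "inj_on (sign_vec N p) (Pow {..<N})"
    using sign_vecs[of N p] p by (simp_all add: B_def)
  show "card B = 2 ^ N" unfolding sv(1) card_image[OF sv(2)] by (simp add: card_Pow)
  \<comment> \<open>The sign sets containing index 0: one representative for each line, namely the
    vector with positive first coordinate.\<close>
  define F where "F = insert 0 ` Pow {1..<N}"
  have FP: "F \<subseteq> Pow {..<N}" using N by (auto simp: F_def)
  have "inj_on (insert (0::nat)) (Pow {1..<N})"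
  proof (rule inj_onI)
    fix S S' :: "nat set" assume S: "S \<in> Pow {1..<N}" "S' \<in> Pow {1..<N}" "insert 0 S = insert 0 S'"
    then have "0 \<notin> S" "0 \<notin> S'" by auto
    then show "S = S'" using S(3) by (simp add: insert_ident)
  qed
  then have cF: "card F = 2 ^ (N - 1)" by (simp add: F_def card_image card_Pow)
  define B' where "B' = sign_vec N p ` F"
  have cB': "card B' = 2 ^ (N - 1)"
    unfolding B'_def using card_image[OF inj_on_subset[OF sv(2) FP]] cF by simp
  have B'B: "B' \<subseteq> B" unfolding sv(1) B'_def using FP by (rule image_mono)
  have B'iff: "b \<in> B' \<longleftrightarrow> 0 < b $ 0" if bB: "b \<in> B" for b
  proof -
    obtain S where S: "S \<subseteq> {..<N}" "b = sign_vec N p S" using bB unfolding sv(1) by auto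
    have "b \<in> B' \<longleftrightarrow> S \<in> F"
      unfolding B'_def S(2) using inj_on_image_mem_iff[OF sv(2) _ FP, of S] S(1) by auto
    also have "\<dots> \<longleftrightarrow> 0 \<in> S"
    proof
      assume "0 \<in> S"
      then have "S = insert 0 (S - {0})" "S - {0} \<in> Pow {1..<N}" using S(1) by auto
      then show "S \<in> F" unfolding F_def by blast
    qed (auto simp: F_def)
    also have "\<dots> \<longleftrightarrow> 0 < b $ 0" using N p[of 0] by (auto simp: S(2) sign_vec_def)
    finally show ?thesis .
  qed
  have "line_through ` B = line_through ` B'"
  proof (rule equalityI[OF subsetI image_mono[OF B'B]])
    fix L assume "L \<in> line_through ` B"
    then obtain b where b: "b \<in> B" "L = line_through b" by auto
    show "L \<in> line_through ` B'"
    proof (cases "b \<in> B'")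
      case False
      then have "b $ 0 \<le> 0" using B'iff[OF b(1)] by simp
      moreover have "b $ 0 \<noteq> 0" using b(1) p[of 0] N by (auto simp: B_def)
      ultimately have neg: "b $ 0 < 0" by simp
      have b': "- 1 \<cdot>\<^sub>v b \<in> B" using b(1) by (auto simp: B_def)
      moreover have "dim_vec b = N" using b(1) by (auto simp: B_def)
      then have "0 < (- 1 \<cdot>\<^sub>v b) $ 0" using neg N by simp
      ultimately have mem: "- 1 \<cdot>\<^sub>v b \<in> B'" using B'iff by blast
      have "c \<cdot>\<^sub>v b = (- c) \<cdot>\<^sub>v (- 1 \<cdot>\<^sub>v b)" for c by (rule eq_vecI) auto
      moreover have "c \<cdot>\<^sub>v (- 1 \<cdot>\<^sub>v b) = (- c) \<cdot>\<^sub>v b" for c by (rule eq_vecI) auto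
      ultimately have "line_through b = line_through (- 1 \<cdot>\<^sub>v b)"
        unfolding line_through_def by blast
      then show ?thesis using b(2) mem by blast
    qed (use b in auto)
  qed
  moreover have "inj_on line_through B'"
  proof (rule inj_onI)
    fix b b' assume bb: "b \<in> B'" "b' \<in> B'" "line_through b = line_through b'"
    then have B: "b \<in> B" "b' \<in> B" "0 < b $ 0" "0 < b' $ 0" using B'B B'iff by auto
    have "b' = 1 \<cdot>\<^sub>v b'" by (rule eq_vecI) auto
    then have "b' \<in> line_through b'" unfolding line_through_def by blast
    then have "b' \<in> line_through b" using bb(3) by simp
    then obtain c where c: "b' = c \<cdot>\<^sub>v b" unfolding line_through_def by blast
    have "(b' $ 0)\<^sup>2 = (b $ 0)\<^sup>2" using B N by (simp add: B_def)
    then have "b' $ 0 = b $ 0" using B by (simp add: power2_eq_iff_nonneg)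
    moreover have "dim_vec b = N" using B(1) by (auto simp: B_def)
    ultimately have "c = 1" using c B(3) N by simp
    then show "b = b'" using c by (auto intro!: eq_vecI)
  qed
  ultimately show "card (line_through ` B) = 2 ^ (N - 1)" using cB' by (simp add: card_image)
qed

section \<open>Small-time expansions\<close>

lemma prod_split_at:
  fixes f :: "nat \<Rightarrow> real"
  assumes "i < N"
  shows "(\<Prod>j\<in>{..<N} - {i}. f j) = (\<Prod>j<i. f j) * (\<Prod>j = Suc i..<N. f j)"
proof -
  have "{..<N} - {i} = {..<i} \<union> {Suc i..<N}" using assms by auto
  moreover have "{..<i} \<inter> {Suc i..<N} = {}" by auto
  ultimately show ?thesis by (simp add: prod.union_disjoint)
qed

text \<open>With 0-based indices the difference of two eigenvalues is (i - j) (i + j + 2). The first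
  factors multiply to two factorials and the sign; the second ones give a quotient of factorials
  once the missing factor 2 i + 2 for \<open>j = i\<close> is restored.\<close>

lemma divdiff_weight_dir_eig:
  assumes i: "i < N"
  shows "divdiff_weight N dir_eig i
    = (-1) ^ (N - Suc i) * (2 * (real (Suc i))\<^sup>2 / (fact (N - Suc i) * fact (N + Suc i)))"
proof -
  have "(\<Prod>j\<in>{..<N} - {i}. dir_eig i - dir_eig j)
      = (\<Prod>j\<in>{..<N} - {i}. (real i - real j) * real (i + j + 2))"
    by (intro prod.cong refl) (simp add: dir_eig_def power2_eq_square algebra_simps)
  also have "\<dots> = (\<Prod>j\<in>{..<N} - {i}. real i - real j) * (\<Prod>j\<in>{..<N} - {i}. real (i + j + 2))"
    by (rule prod.distrib)
  also have "(\<Prod>j\<in>{..<N} - {i}. real i - real j) = fact i * ((-1) ^ (N - Suc i) * fact (N - Suc i))"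
  proof -
    have "(\<Prod>j<i. real i - real j) = (\<Prod>k = 1..i. real k)"
      by (rule prod.reindex_bij_witness[of _ "\<lambda>k. i - k" "\<lambda>j. i - j"]) auto
    moreover have "(\<Prod>j = Suc i..<N. real i - real j) = (\<Prod>k = 1..N - Suc i. - 1 * real k)"
      using i by (intro prod.reindex_bij_witness[of _ "\<lambda>k. i + k" "\<lambda>j. j - i"]) auto
    ultimately show ?thesis unfolding prod_split_at[OF i]
      by (simp only: prod.distrib fact_prod of_nat_prod prod_constant card_atLeastAtMost) simp
  qed
  also have "(\<Prod>j\<in>{..<N} - {i}. real (i + j + 2)) = fact (N + Suc i) / (fact (Suc i) * real (2 * i + 2))"
  proof -
    have "(\<Prod>j<N. real (i + j + 2)) = real (i + i + 2) * (\<Prod>j\<in>{..<N} - {i}. real (i + j + 2))"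
      using i by (subst prod.remove[of _ i]) auto
    moreover have "(\<Prod>j<N. real (i + j + 2)) = (\<Prod>k = 1..N. real (Suc i + k))"
      by (rule prod.reindex_bij_witness[of _ "\<lambda>k. k - 1" Suc]) (auto simp: algebra_simps)
    moreover have "\<dots> = fact (N + Suc i) / fact (Suc i)"
      unfolding prod_shift_eq_fact by (simp add: add.commute)
    moreover have "i + i + 2 = 2 * i + 2" by simp
    ultimately have "fact (N + Suc i) / fact (Suc i) = (\<Prod>j\<in>{..<N} - {i}. real (i + j + 2)) * real (2 * i + 2)"
      by (simp only: mult.commute)
    moreover have "x = y / (z * c)" if "y / z = x * c" "c \<noteq> 0" for x y z c :: real
      using that by (metis divide_divide_eq_left nonzero_mult_div_cancel_right)
    ultimately show ?thesis by simp
  qed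
  finally have P: "(\<Prod>j\<in>{..<N} - {i}. dir_eig i - dir_eig j)
    = (-1) ^ (N - Suc i) * (fact i * fact (N - Suc i) * (fact (N + Suc i) / (fact (Suc i) * real (2 * i + 2))))"
    by (simp only: mult_ac)
  have sg: "1 / ((-1) ^ k * x) = (-1) ^ k * (1 / x)" for k and x :: real
    by (cases "even k") auto
  have "divdiff_weight N dir_eig i
    = (-1) ^ (N - Suc i) * (1 / (fact i * fact (N - Suc i) * (fact (N + Suc i) / (fact (Suc i) * real (2 * i + 2)))))"
    unfolding divdiff_weight_def P by (rule sg)
  also have "1 / (fact i * fact (N - Suc i) * (fact (N + Suc i) / (fact (Suc i) * real (2 * i + 2))))
    = 2 * (real (Suc i))\<^sup>2 / (fact (N - Suc i) * fact (N + Suc i))"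
  proof -
    have "(fact (Suc i) :: real) = real (Suc i) * fact i" by simp
    moreover have "real (2 * i + 2) = 2 * real (Suc i)" by simp
    ultimately show ?thesis by (simp add: power2_eq_square del: fact_Suc of_nat_Suc)
  qed
  finally show ?thesis .
qed

text \<open>The sum of the moduli of the divided-difference weights at \<open>dir_eig\<close>,
  because the numbers \<open>weight N j\<close> sum to 1. Its reciprocal turns out to be
  \<open>delta_max\<close>.\<close>

definition total_weight :: "nat \<Rightarrow> real" where
  "total_weight N = real N * 2 ^ (2 * N - 1) / fact (2 * N)"

lemma total_weight_pos: "1 \<le> N \<Longrightarrow> 0 < total_weight N"
  by (simp add: total_weight_def)

lemma divdiff_weight_eq_weight:
  assumes i: "i < N"
  shows "divdiff_weight N dir_eig i = (-1) ^ (N - Suc i) * (total_weight N * weight N (Suc i))"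
proof -
  have "real ((2 * N) choose (N + Suc i)) = fact (2 * N) / (fact (N + Suc i) * fact (N - Suc i))"
    using i by (subst binomial_fact) (auto simp: mult_2)
  moreover have "(2::real) ^ (2 * N - 1) = 2 * 2 ^ (2 * N - 2)" using i by (cases N) auto
  ultimately have "total_weight N * weight N (Suc i) = 2 * (real (Suc i))\<^sup>2 / (fact (N - Suc i) * fact (N + Suc i))"
    using i by (simp add: total_weight_def weight_def mult_ac del: fact_Suc of_nat_Suc)
  then show ?thesis by (simp only: divdiff_weight_dir_eig[OF i])
qed

lemma sum_shift_Suc: "(\<Sum>i<N. f (Suc i)) = (\<Sum>j = 1..N. f j :: real)"
  by (rule sum.reindex_bij_witness[of _ "\<lambda>j. j - 1" Suc]) auto

section \<open>Calculus of expansions a + b x + O(x^2) at 0 from the right\<close>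

definition lin_exp :: "(real \<Rightarrow> real) \<Rightarrow> real \<Rightarrow> real \<Rightarrow> bool" where
  "lin_exp f a b \<longleftrightarrow> (\<lambda>x. f x - (a + b * x)) \<in> O[at_right 0](\<lambda>x. x\<^sup>2)"

lemma lin_exp_cong:
  assumes "lin_exp f a b" "eventually (\<lambda>x. f x = g x) (at_right 0)"
  shows "lin_exp g a b"
proof -
  have "eventually (\<lambda>x. f x - (a + b * x) = g x - (a + b * x)) (at_right 0)"
    using assms(2) by eventually_elim simp
  then show ?thesis using assms(1) unfolding lin_exp_def by (subst (asm) landau_o.big.in_cong)
qed

lemma lin_exp_linear: "lin_exp (\<lambda>x. a + b * x) a b"
  by (simp add: lin_exp_def)

lemma lin_exp_const: "lin_exp (\<lambda>x. a) a 0"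
  by (simp add: lin_exp_def)

lemma lin_exp_add:
  assumes "lin_exp f a b" "lin_exp g c d"
  shows "lin_exp (\<lambda>x. f x + g x) (a + c) (b + d)"
  using sum_in_bigo(1)[OF assms[unfolded lin_exp_def]] unfolding lin_exp_def
  by (simp add: algebra_simps)

lemma lin_exp_sum:
  "(\<And>i. i \<in> I \<Longrightarrow> lin_exp (f i) (a i) (b i)) \<Longrightarrow> lin_exp (\<lambda>x. \<Sum>i\<in>I. f i x) (\<Sum>i\<in>I. a i) (\<Sum>i\<in>I. b i)"
proof (induction I rule: infinite_finite_induct)
  case (insert i I)
  then show ?case using lin_exp_add[of "f i" "a i" "b i"] by simp
qed (simp_all add: lin_exp_const)

lemma lin_exp_tendsto:
  assumes "lin_exp f a b" shows "(f \<longlongrightarrow> a) (at_right 0)"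
proof -
  have "(\<lambda>x. x\<^sup>2) \<in> o[at_right 0](\<lambda>_. 1 :: real)" by real_asymp
  then have "(\<lambda>x. f x - (a + b * x)) \<in> o[at_right 0](\<lambda>_. 1)"
    using assms unfolding lin_exp_def by (rule landau_o.big_small_trans[rotated])
  then have "((\<lambda>x. f x - (a + b * x)) \<longlongrightarrow> 0) (at_right 0)"
    by (auto dest: smalloD_tendsto)
  moreover have "((\<lambda>x. a + b * x) \<longlongrightarrow> a + b * 0) (at_right 0)" by (intro tendsto_intros)
  ultimately have "((\<lambda>x. f x - (a + b * x) + (a + b * x)) \<longlongrightarrow> 0 + (a + b * 0)) (at_right 0)"
    by (rule tendsto_add)
  then show ?thesis by simp
qed

lemma tendsto_bigo_1: "(f \<longlongrightarrow> (c::real)) F \<Longrightarrow> f \<in> O[F](\<lambda>_. 1 :: real)"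
  by (rule bigoI_tendsto[where c = c]) auto

lemma lin_exp_mult:
  assumes f: "lin_exp f a b" and g: "lin_exp g c d"
  shows "lin_exp (\<lambda>x. f x * g x) (a * c) (a * d + b * c)"
proof -
  have g1: "g \<in> O[at_right 0](\<lambda>_. 1)" by (rule tendsto_bigo_1[OF lin_exp_tendsto[OF g]])
  have p1: "(\<lambda>x. a + b * x) \<in> O[at_right 0](\<lambda>_. 1)"
    by (rule tendsto_bigo_1[OF lin_exp_tendsto[OF lin_exp_linear]])
  have "(\<lambda>x. (f x - (a + b * x)) * g x) \<in> O[at_right 0](\<lambda>x. x\<^sup>2 * 1)"
    using f g1 unfolding lin_exp_def by (rule landau_o.big.mult)
  moreover have "(\<lambda>x. (g x - (c + d * x)) * (a + b * x)) \<in> O[at_right 0](\<lambda>x. x\<^sup>2 * 1)"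
    using g p1 unfolding lin_exp_def by (rule landau_o.big.mult)
  moreover have "(\<lambda>x. b * d * x\<^sup>2) \<in> O[at_right 0](\<lambda>x. x\<^sup>2 * 1)" by simp
  ultimately have "(\<lambda>x. (f x - (a + b * x)) * g x + (g x - (c + d * x)) * (a + b * x) + b * d * x\<^sup>2)
     \<in> O[at_right 0](\<lambda>x. x\<^sup>2 * 1)"
    by (intro sum_in_bigo)
  moreover have "(\<lambda>x. (f x - (a + b * x)) * g x + (g x - (c + d * x)) * (a + b * x) + b * d * x\<^sup>2)
      = (\<lambda>x. f x * g x - (a * c + (a * d + b * c) * x))"
    by (rule ext) (simp add: algebra_simps power2_eq_square)
  ultimately show ?thesis unfolding lin_exp_def by simp
qed

text \<open>The candidate q for the reciprocal satisfies f q = 1 + O(x^2) by the product rule, and 1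
  / f - q = - (f q - 1) / f with 1 / f bounded near 0.\<close>

lemma lin_exp_inverse:
  assumes f: "lin_exp f a b" and a: "a \<noteq> 0"
  shows "lin_exp (\<lambda>x. 1 / f x) (1 / a) (- b / a\<^sup>2)"
proof -
  have lim: "(f \<longlongrightarrow> a) (at_right 0)" by (rule lin_exp_tendsto[OF f])
  then have ne: "eventually (\<lambda>x. f x \<noteq> 0) (at_right 0)" using a by (rule tendsto_imp_eventually_ne)
  have "lin_exp (\<lambda>x. f x * (1 / a + (- b / a\<^sup>2) * x)) (a * (1 / a)) (a * (- b / a\<^sup>2) + b * (1 / a))"
    by (rule lin_exp_mult[OF f lin_exp_linear])
  then have "lin_exp (\<lambda>x. f x * (1 / a + (- b / a\<^sup>2) * x)) 1 0"
    using a by (simp add: power2_eq_square)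
  then have "(\<lambda>x. f x * (1 / a + (- b / a\<^sup>2) * x) - 1) \<in> O[at_right 0](\<lambda>x. x\<^sup>2)"
    by (simp add: lin_exp_def)
  moreover have "(\<lambda>x. - 1 / f x) \<in> O[at_right 0](\<lambda>_. 1)"
    by (rule tendsto_bigo_1[OF tendsto_divide[OF tendsto_const lim a]])
  ultimately have "(\<lambda>x. (f x * (1 / a + (- b / a\<^sup>2) * x) - 1) * (- 1 / f x)) \<in> O[at_right 0](\<lambda>x. x\<^sup>2 * 1)"
    by (rule landau_o.big.mult)
  moreover have "eventually (\<lambda>x. (f x * (1 / a + (- b / a\<^sup>2) * x) - 1) * (- 1 / f x)
      = 1 / f x - (1 / a + (- b / a\<^sup>2) * x)) (at_right 0)"
    using ne by eventually_elim (simp add: field_simps)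
  ultimately show ?thesis unfolding lin_exp_def by (subst (asm) landau_o.big.in_cong) simp_all
qed

lemma lin_exp_exp: "lin_exp (\<lambda>x. exp (c * x)) 1 c"
  unfolding lin_exp_def by real_asymp

text \<open>The expansion y / (1 - exp (- y)) = 1 + y / 2 + O(y^2) at y = 2 l T. For
  \<open>l = dir_eig i\<close> the function is \<open>T / gram_kernel T i i\<close>, the quantity
  entering the relaxed problem.\<close>

lemma lin_exp_self_reciprocal:
  assumes "l > 0"
  shows "lin_exp (\<lambda>T. T * (2 * l / (1 - exp (- (l + l) * T)))) 1 l"
proof -
  have "(\<lambda>y :: real. y / (1 - exp (- y)) - (1 + y / 2)) \<in> O[at_right 0](\<lambda>y. y\<^sup>2)" by real_asymp
  moreover have "filterlim (\<lambda>T. 2 * l * T) (at_right 0) (at_right 0)" using assms by real_asymp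
  ultimately have "(\<lambda>T. 2 * l * T / (1 - exp (- (2 * l * T))) - (1 + 2 * l * T / 2)) \<in> O[at_right 0](\<lambda>T. (2 * l * T)\<^sup>2)"
    by (rule landau_o.big.compose)
  also have "(\<lambda>T. (2 * l * T)\<^sup>2) \<in> O[at_right 0](\<lambda>T. T\<^sup>2 :: real)" by (simp add: power_mult_distrib)
  finally show ?thesis by (simp add: lin_exp_def mult_ac)
qed

lemma lin_exp_half:
  assumes "(\<lambda>h. f h - a) \<in> O[at_right 0](\<lambda>h. h\<^sup>2)"
  shows "lin_exp (\<lambda>T. f (T / 2)) a 0"
proof -
  have "filterlim (\<lambda>T. T / 2) (at_right 0) (at_right (0::real))" by real_asymp
  from landau_o.big.compose[OF assms this]
  have "(\<lambda>T. f (T / 2) - a) \<in> O[at_right 0](\<lambda>T. (T / 2)\<^sup>2)" .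
  also have "(\<lambda>T. (T / 2)\<^sup>2) \<in> O[at_right 0](\<lambda>T. T\<^sup>2 :: real)" by (simp add: power_divide)
  finally show ?thesis by (simp add: lin_exp_def)
qed

section \<open>The inverse Gram matrix and its row sums for small time\<close>

definition scaled_inverse :: "nat \<Rightarrow> real \<Rightarrow> nat \<Rightarrow> nat \<Rightarrow> real" where
  "scaled_inverse N T i j = exp ((dir_eig i + dir_eig j) * (T / 2)) * dual_gram N dir_eig (T / 2) i j"

text \<open>By \<open>gram_kernel_eq_exp_kernel\<close>, centring gives \<open>gram_kernel\<close>
  an exponential and a factor \<open>T / 2\<close>. Inverting both and removing the power
  \<open>(T / 2) ^ (2 * N - 2)\<close> built into \<open>dual_gram\<close> yields this formula, with
  total power \<open>2 * N - 1\<close>.\<close>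

definition inverse_gram :: "nat \<Rightarrow> real \<Rightarrow> nat \<Rightarrow> nat \<Rightarrow> real" where
  "inverse_gram N T i j = scaled_inverse N T i j / (T / 2) ^ (2 * N - 1)"

definition alt_sign :: "nat \<Rightarrow> nat \<Rightarrow> real" where
  "alt_sign N i = (-1) ^ (N - Suc i)"

text \<open>Limit at \<open>T = 0\<close> of \<open>R\<close> times
  \<open>(T / 2) ^ (2 * N - 1)\<close>, where \<open>R\<close> is the sum of the moduli of all
  entries of the inverse.\<close>

definition lead_const :: "nat \<Rightarrow> real" where
  "lead_const N = gram_const (N - 1) * (total_weight N)\<^sup>2"

lemma lead_const_pos: "1 \<le> N \<Longrightarrow> 0 < lead_const N"
  unfolding lead_const_def gram_const_def
  by (intro divide_pos_pos mult_pos_pos zero_less_power fact_gt_zero total_weight_pos) simp_all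

lemma alt_sign_sq: "alt_sign N i * alt_sign N i = 1"
  by (simp add: alt_sign_def flip: power_add mult_2)

lemma gram_kernel_eq_exp_kernel:
  assumes "T > 0"
  shows "gram_kernel T i j = exp (- (dir_eig i + dir_eig j) * (T / 2)) * (T / 2) * exp_kernel (dir_eig i + dir_eig j) (T / 2)"
proof -
  define s where "s = dir_eig i + dir_eig j"
  have s: "s > 0" using dir_eig_pos[of i] dir_eig_pos[of j] by (simp add: s_def)
  have "exp (- s * (T / 2)) * (exp (s * (T / 2)) - exp (- s * (T / 2))) = 1 - exp (- s * T)"
    by (simp add: right_diff_distrib exp_add[symmetric])
  moreover have "exp (- s * (T / 2)) * (T / 2) * exp_kernel s (T / 2)
      = exp (- s * (T / 2)) * (exp (s * (T / 2)) - exp (- s * (T / 2))) / s"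
  proof -
    have k: "exp_kernel s (T / 2) = (exp (s * (T / 2)) - exp (- s * (T / 2))) / (s * (T / 2))"
      using assms by (simp add: exp_kernel_def)
    have g: "e * h * (X / (s * h)) = e * X / s" if "h \<noteq> 0" for e h X :: real
      using that by simp
    show ?thesis unfolding k by (rule g) (use assms in simp)
  qed
  ultimately have "exp (- s * (T / 2)) * (T / 2) * exp_kernel s (T / 2) = (1 - exp (- s * T)) / s"
    by (simp only:)
  then show ?thesis unfolding gram_kernel_def s_def by (simp only:)
qed

lemma lin_exp_scaled_inverse:
  assumes N: "1 \<le> N" and ij: "i < N" "j < N"
  shows "lin_exp (\<lambda>T. alt_sign N i * alt_sign N j * scaled_inverse N T i j)
    (lead_const N * weight N (Suc i) * weight N (Suc j))
    (lead_const N * weight N (Suc i) * weight N (Suc j) * ((dir_eig i + dir_eig j) / 2))"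
proof -
  have D: "lin_exp (\<lambda>T. dual_gram N dir_eig (T / 2) i j)
      (gram_const (N - 1) * divdiff_weight N dir_eig i * divdiff_weight N dir_eig j) 0"
    by (rule lin_exp_half) (intro dual_gram_asymptotics N inj_dir_eig dir_eig_pos ij)
  have E: "lin_exp (\<lambda>T. exp ((dir_eig i + dir_eig j) * (T / 2))) 1 ((dir_eig i + dir_eig j) / 2)"
    using lin_exp_exp[of "(dir_eig i + dir_eig j) / 2"] by (simp add: mult_ac)
  let ?c = "gram_const (N - 1) * divdiff_weight N dir_eig i * divdiff_weight N dir_eig j"
  have "lin_exp (\<lambda>T. alt_sign N i * alt_sign N j * scaled_inverse N T i j)
    (alt_sign N i * alt_sign N j * ?c) (alt_sign N i * alt_sign N j * ?c * ((dir_eig i + dir_eig j) / 2))"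
    using lin_exp_mult[OF lin_exp_const[of "alt_sign N i * alt_sign N j"] lin_exp_mult[OF E D]]
    by (simp add: scaled_inverse_def mult_ac)
  moreover have "alt_sign N i * alt_sign N j * ?c = (alt_sign N i * alt_sign N i) * (alt_sign N j * alt_sign N j) *
     (lead_const N * weight N (Suc i) * weight N (Suc j))"
    unfolding divdiff_weight_eq_weight[OF ij(1)] divdiff_weight_eq_weight[OF ij(2)] alt_sign_def lead_const_def
    by (simp only: power2_eq_square mult_ac)
  ultimately show ?thesis by (simp only: alt_sign_sq mult_1)
qed

text \<open>The signed entries of \<open>scaled_inverse\<close> tend to \<open>lead_const N\<close>
  times products of weights, which are positive, so the finitely many sign conditions hold for small
  \<open>T\<close>. In the inverse relation the exponentials combine to exp ((l j - l i) T / 2),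
  independent of the summation index and equal to 1 on the diagonal.\<close>

lemma eventually_checkerboard_inverse:
  assumes N: "1 \<le> N"
  shows "\<forall>\<^sub>F T in at_right 0. checkerboard_inverse N (gram_kernel T) (inverse_gram N T) (alt_sign N)"
proof -
  have "\<forall>\<^sub>F h in at 0. \<forall>i<N. \<forall>j<N.
    (\<Sum>k<N. exp_kernel (dir_eig i + dir_eig k) h * dual_gram N dir_eig h k j) = (if i = j then h ^ (2 * (N - 1)) else 0)"
    by (rule eventually_gram_times_dual_gram[OF inj_dir_eig dir_eig_pos])
  then have "\<forall>\<^sub>F h in at_right 0. \<forall>i<N. \<forall>j<N.
    (\<Sum>k<N. exp_kernel (dir_eig i + dir_eig k) h * dual_gram N dir_eig h k j) = (if i = j then h ^ (2 * (N - 1)) else 0)"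
    by (simp add: eventually_at_split)
  moreover have "filterlim (\<lambda>T. T / 2) (at_right 0) (at_right (0::real))" by real_asymp
  ultimately have inv: "\<forall>\<^sub>F T in at_right 0. \<forall>i<N. \<forall>j<N.
    (\<Sum>k<N. exp_kernel (dir_eig i + dir_eig k) (T / 2) * dual_gram N dir_eig (T / 2) k j) = (if i = j then (T / 2) ^ (2 * (N - 1)) else 0)"
    by (rule eventually_compose_filterlim)
  have "\<forall>\<^sub>F T in at_right 0. \<forall>p\<in>{..<N} \<times> {..<N}. 0 < alt_sign N (fst p) * alt_sign N (snd p) * scaled_inverse N T (fst p) (snd p)"
  proof (intro eventually_ball_finite ballI)
    fix p assume "p \<in> {..<N} \<times> {..<N}"
    then obtain i j where p: "p = (i, j)" "i < N" "j < N" by auto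
    from lin_exp_tendsto[OF lin_exp_scaled_inverse[OF N p(2,3)]]
    have "\<forall>\<^sub>F T in at_right 0. 0 < alt_sign N i * alt_sign N j * scaled_inverse N T i j"
      by (rule order_tendstoD) (use N p in \<open>simp add: lead_const_pos weight_pos\<close>)
    then show "\<forall>\<^sub>F T in at_right 0. 0 < alt_sign N (fst p) * alt_sign N (snd p) * scaled_inverse N T (fst p) (snd p)"
      by (simp add: p)
  qed auto
  with inv eventually_at_right_less[of 0] show ?thesis
  proof eventually_elim
    case (elim T)
    show ?case
    proof
      show "1 \<le> N" by (rule N)
      show "gram_kernel T i j = gram_kernel T j i" for i j by (rule gram_kernel_sym)
      show "0 \<le> bform N (gram_kernel T) u u" for u using elim by (intro gram_kernel_psd) simp
      show "\<bar>alt_sign N i\<bar> = 1" for i by (simp add: alt_sign_def)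
      show "0 < alt_sign N i * alt_sign N j * inverse_gram N T i j" if "i < N" "j < N" for i j
      proof -
        have "0 < alt_sign N i * alt_sign N j * scaled_inverse N T i j / (T / 2) ^ (2 * N - 1)"
          using elim that by (intro divide_pos_pos) force+
        then show ?thesis by (simp add: inverse_gram_def)
      qed
      show "(\<Sum>k<N. gram_kernel T i k * inverse_gram N T k j) = (if i = j then 1 else 0)" if ij: "i < N" "j < N" for i j
      proof -
        have T: "T > 0" using elim by simp
        have "2 * N - 1 = Suc (2 * (N - 1))" using N by simp
        then have pw: "(T / 2) ^ (2 * N - 1) = (T / 2) * (T / 2) ^ (2 * (N - 1))" by simp
        have term_eq: "gram_kernel T i k * inverse_gram N T k j
          = exp ((dir_eig j - dir_eig i) * (T / 2)) / (T / 2) ^ (2 * (N - 1)) *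
            (exp_kernel (dir_eig i + dir_eig k) (T / 2) * dual_gram N dir_eig (T / 2) k j)" for k
        proof -
          have e: "exp (- (dir_eig i + dir_eig k) * (T / 2)) * exp ((dir_eig k + dir_eig j) * (T / 2))
             = exp ((dir_eig j - dir_eig i) * (T / 2))"
            by (simp add: exp_add[symmetric] algebra_simps)
          have "a * h * K * (b * D / (h * q)) = (a * b) / q * (K * D)" if "h \<noteq> 0" for a h K b D q :: real
            using that by simp
          from this[of "T / 2"] show ?thesis
            unfolding gram_kernel_eq_exp_kernel[OF T] inverse_gram_def scaled_inverse_def pw e[symmetric] using T by simp
        qed
        show ?thesis
          unfolding term_eq sum_distrib_left[symmetric] using elim ij T by auto
      qed
    qed
  qed
qed

text \<open>Once the sign pattern holds, this is \<open>r i\<close> times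
  \<open>(T / 2) ^ (2 * N - 1)\<close>. It is written with signs instead of absolute values so that
  it can be expanded in \<open>T\<close> term by term.\<close>

definition row_mass :: "nat \<Rightarrow> real \<Rightarrow> nat \<Rightarrow> real" where
  "row_mass N T i = (\<Sum>j<N. alt_sign N i * alt_sign N j * scaled_inverse N T i j)"

text \<open>Summation over \<open>j\<close> replaces the weight of the column by 1 and its
  eigenvalue by the weighted mean (3 N - 1) / 2.\<close>

lemma lin_exp_row_mass:
  assumes N: "1 \<le> N" and i: "i < N"
  shows "lin_exp (\<lambda>T. row_mass N T i) (lead_const N * weight N (Suc i))
    (lead_const N * weight N (Suc i) * ((dir_eig i + (3 * real N - 1) / 2) / 2))"
proof -
  let ?w = "\<lambda>j. weight N (Suc j)"
  have w1: "(\<Sum>j<N. ?w j) = 1" using sum_shift_Suc[of "weight N" N] sum_weight[OF N] by simp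
  have w2: "(\<Sum>j<N. dir_eig j * ?w j) = (3 * real N - 1) / 2"
    using sum_shift_Suc[of "\<lambda>j. (real j)\<^sup>2 * weight N j" N] sum_weight_squares[OF N]
    by (simp add: dir_eig_def)
  have L: "lin_exp (\<lambda>T. row_mass N T i) (\<Sum>j<N. lead_const N * ?w i * ?w j)
      (\<Sum>j<N. lead_const N * ?w i * ?w j * ((dir_eig i + dir_eig j) / 2))"
    unfolding row_mass_def by (rule lin_exp_sum) (use lin_exp_scaled_inverse[OF N i] in auto)
  have e1: "(\<Sum>j<N. lead_const N * ?w i * ?w j) = lead_const N * ?w i"
    unfolding sum_distrib_left[symmetric] w1 by simp
  have "(\<Sum>j<N. lead_const N * ?w i * ?w j * ((dir_eig i + dir_eig j) / 2))
      = lead_const N * ?w i / 2 * (dir_eig i * (\<Sum>j<N. ?w j) + (\<Sum>j<N. dir_eig j * ?w j))"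
    unfolding sum_distrib_left sum.distrib[symmetric] by (intro sum.cong refl) (simp add: field_simps)
  also have "\<dots> = lead_const N * ?w i * ((dir_eig i + (3 * real N - 1) / 2) / 2)"
    unfolding w1 w2 by simp
  finally show ?thesis using L unfolding e1 by (simp only:)
qed

lemma lin_exp_total_mass:
  assumes N: "1 \<le> N"
  shows "lin_exp (\<lambda>T. \<Sum>i<N. row_mass N T i) (lead_const N) (lead_const N * ((3 * real N - 1) / 2))"
proof -
  let ?w = "\<lambda>j. weight N (Suc j)"
  define m where "m = (3 * real N - 1) / 2"
  have w1: "(\<Sum>j<N. ?w j) = 1" using sum_shift_Suc[of "weight N" N] sum_weight[OF N] by simp
  have w2: "(\<Sum>j<N. dir_eig j * ?w j) = m"
    using sum_shift_Suc[of "\<lambda>j. (real j)\<^sup>2 * weight N j" N] sum_weight_squares[OF N]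
    by (simp add: dir_eig_def m_def)
  have L: "lin_exp (\<lambda>T. \<Sum>i<N. row_mass N T i) (\<Sum>i<N. lead_const N * ?w i)
      (\<Sum>i<N. lead_const N * ?w i * ((dir_eig i + m) / 2))"
    by (rule lin_exp_sum) (use lin_exp_row_mass[OF N] in \<open>auto simp: m_def\<close>)
  have e1: "(\<Sum>i<N. lead_const N * ?w i) = lead_const N"
    unfolding sum_distrib_left[symmetric] w1 by simp
  have "(\<Sum>i<N. lead_const N * ?w i * ((dir_eig i + m) / 2))
      = lead_const N / 2 * ((\<Sum>j<N. dir_eig j * ?w j) + m * (\<Sum>j<N. ?w j))"
    unfolding sum_distrib_left sum.distrib[symmetric] by (intro sum.cong refl) (simp add: field_simps)
  also have "\<dots> = lead_const N * m" unfolding w1 w2 by simp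
  finally show ?thesis using L unfolding e1 m_def by (simp only:)
qed

lemma checkerboard_row_sums:
  assumes "checkerboard_inverse N (gram_kernel T) (inverse_gram N T) (alt_sign N)" and T: "T > 0"
  shows "i < N \<Longrightarrow> checkerboard_inverse.r N (inverse_gram N T) i = row_mass N T i / (T / 2) ^ (2 * N - 1)"
    and "checkerboard_inverse.R N (inverse_gram N T) = (\<Sum>i<N. row_mass N T i) / (T / 2) ^ (2 * N - 1)"
proof -
  interpret checkerboard_inverse N "gram_kernel T" "inverse_gram N T" "alt_sign N" by fact
  show r: "r i = row_mass N T i / (T / 2) ^ (2 * N - 1)" if "i < N" for i
    unfolding r_def row_mass_def sum_divide_distrib using that
    by (intro sum.cong refl) (simp add: abs_M, simp add: inverse_gram_def)
  show "R = (\<Sum>i<N. row_mass N T i) / (T / 2) ^ (2 * N - 1)"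
    unfolding R_def sum_divide_distrib by (intro sum.cong refl) (simp add: r)
qed

text \<open>With m = (3 N - 1) / 2, the relative slope of the row is (l + m) / 2 and that of the
  total is m. The difference (l - m) / 2 is half the excess of the eigenvalue over its weighted
  mean.\<close>

lemma lin_exp_optimal_weights:
  assumes N: "1 \<le> N" and i: "i < N"
  shows "lin_exp (\<lambda>T. row_mass N T i / (\<Sum>k<N. row_mass N T k)) (weight N (Suc i))
    (weight N (Suc i) * ((2 * (real (Suc i))\<^sup>2 - 3 * real N + 1) / 4))"
proof -
  let ?w = "weight N (Suc i)" and ?m = "(3 * real N - 1) / 2" and ?c = "lead_const N"
  have c: "?c \<noteq> 0" using lead_const_pos[OF N] by simp
  have key: "c * w * (- (c * m) / c\<^sup>2) + c * w * ((l + m) / 2) * (1 / c) = w * ((l - m) / 2)"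
    if "c \<noteq> 0" for c w l m :: real
    using that by (simp add: field_simps power2_eq_square)
  have L: "lin_exp (\<lambda>T. row_mass N T i * (1 / (\<Sum>k<N. row_mass N T k)))
      (?c * ?w * (1 / ?c)) (?c * ?w * (- (?c * ?m) / ?c\<^sup>2) + ?c * ?w * ((dir_eig i + ?m) / 2) * (1 / ?c))"
    by (rule lin_exp_mult[OF lin_exp_row_mass[OF N i] lin_exp_inverse[OF lin_exp_total_mass[OF N] c]])
  have e1: "?c * ?w * (1 / ?c) = ?w" using c by simp
  have e2: "(dir_eig i - ?m) / 2 = (2 * (real (Suc i))\<^sup>2 - 3 * real N + 1) / 4"
    by (simp add: dir_eig_def field_simps)
  have "(\<lambda>T. row_mass N T i * (1 / (\<Sum>k<N. row_mass N T k))) = (\<lambda>T. row_mass N T i / (\<Sum>k<N. row_mass N T k))"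
    by simp
  with L show ?thesis unfolding key[OF c] e1 e2 by (simp only:)
qed

section \<open>The ratio of the rank-one optimum to the relaxed one\<close>

lemma sum_dir_eig: "(\<Sum>i<N. dir_eig i) = real N * (real N + 1) * (2 * real N + 1) / 6"
  by (induction N) (simp_all add: dir_eig_def field_simps power2_eq_square)

lemma lead_const_eq:
  assumes N: "1 \<le> N"
  shows "real N / (lead_const N * 2 ^ (2 * N - 1)) = real N * (2 * real N - 1) * (fact (N - 1))\<^sup>2 / 16 ^ (N - 1)"
proof -
  obtain n where n: "N = Suc n" using N by (cases N) auto
  define a where "a = (fact (2 * n) :: real)"
  define f where "f = (fact n :: real)"
  define p where "p = (4 :: real) ^ n"
  have a: "a > 0" and f: "f > 0" and p: "p > 0" by (simp_all add: a_def f_def p_def)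
  have f1: "(fact (2 * n + 1) :: real) = (2 * real n + 1) * a" by (simp add: a_def algebra_simps)
  have f2: "(fact (2 * Suc n) :: real) = (2 * real n + 2) * ((2 * real n + 1) * a)"
    by (simp add: a_def algebra_simps)
  have p1: "(2::real) ^ (2 * n + 1) = 2 * p" by (simp add: p_def power_mult)
  have p2: "2 * Suc n - 1 = 2 * n + 1" by simp
  have p3: "(16::real) ^ n = p * p" by (simp add: p_def flip: power_mult_distrib)
  have pos: "2 * real n + 1 > 0" "2 * real n + 2 > 0" "real n + 1 > 0" by (simp_all add: add_pos_pos add_nonneg_pos)
  have "lead_const N = a * ((2 * real n + 1) * a) / (2 * p * f\<^sup>2) * (real (Suc n) * (2 * p) / ((2 * real n + 2) * ((2 * real n + 1) * a)))\<^sup>2"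
    unfolding n lead_const_def gram_const_def total_weight_def f2 p2 p1
    by (simp only: diff_Suc_1 f1 p1 a_def[symmetric] f_def[symmetric])
  also have "\<dots> = p / (2 * (2 * real n + 1) * f\<^sup>2)"
  proof -
    have key: "a * (v * a) / (2 * p * f\<^sup>2) * (k * (2 * p) / (u * (v * a)))\<^sup>2 = p / (2 * v * f\<^sup>2)"
      if "u > 0" "v > 0" "k = u / 2" for u v k :: real
      unfolding that(3) using that(1,2) a f p by (simp add: power2_eq_square divide_simps)
    show ?thesis by (rule key) (use pos in auto)
  qed
  finally have L: "lead_const N = p / (2 * (2 * real n + 1) * f\<^sup>2)" .
  have key: "M / (p / (2 * q * f\<^sup>2) * (2 * p)) = M * (q * f\<^sup>2) / (p * p)" if "q > 0" for M q :: real
    using that p f by (simp add: divide_simps)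
  have "2 * N - 1 = 2 * n + 1" by (simp add: n)
  then have "real N / (lead_const N * 2 ^ (2 * N - 1)) = real N * ((2 * real n + 1) * f\<^sup>2) / (p * p)"
    unfolding L by (simp only: p1 key[OF pos(1)])
  then show ?thesis by (simp add: n p3 f_def algebra_simps)
qed

text \<open>The ratio is \<open>G T / (T * R)\<close>, where \<open>G T / T\<close> is the
  reciprocal of \<open>gamma_rel\<close>. Its relative slope is the plain mean (N + 1) (2 N + 1) / 6
  of the eigenvalues minus their weighted mean (3 N - 1) / 2, which is (N - 1) (N - 2) / 3.\<close>

lemma rho1_expansion:
  assumes N: "1 \<le> N"
  shows "\<exists>r. r \<in> O[at_right 0](\<lambda>T. T\<^sup>2) \<and>
         (\<forall>\<^sub>F T in at_right (0::real).
           rho1 (A_dir N) T =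
             real N * (2 * real N - 1) * (fact (N - 1))\<^sup>2 / 16 ^ (N - 1) * T ^ (2 * N - 2)
               * (1 + (real N - 1) * (real N - 2) / 3 * T + r T))"
proof -
  let ?c = "lead_const N" and ?m = "(3 * real N - 1) / 2"
  define P where "P = (\<lambda>T. \<Sum>i<N. row_mass N T i)"
  define G where "G = (\<lambda>T. \<Sum>i<N. T * (2 * dir_eig i / (1 - exp (- (dir_eig i + dir_eig i) * T))))"
  have c: "?c > 0" by (rule lead_const_pos[OF N])
  have lG: "lin_exp G (\<Sum>i<N. 1) (\<Sum>i<N. dir_eig i)"
    unfolding G_def by (intro lin_exp_sum lin_exp_self_reciprocal dir_eig_pos)
  have lP: "lin_exp P ?c (?c * ?m)" unfolding P_def by (rule lin_exp_total_mass[OF N])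
  have L: "lin_exp (\<lambda>T. ?c / real N * (G T * (1 / P T))) (?c / real N * ((\<Sum>i<N. 1) * (1 / ?c)))
      (?c / real N * ((\<Sum>i<N. 1) * (- (?c * ?m) / ?c\<^sup>2) + (\<Sum>i<N. dir_eig i) * (1 / ?c)) + 0 * ((\<Sum>i<N. 1) * (1 / ?c)))"
    by (rule lin_exp_mult[OF lin_exp_const lin_exp_mult[OF lG lin_exp_inverse[OF lP]]]) (use c in simp)
  have e1: "?c / real N * ((\<Sum>i<N. 1) * (1 / ?c)) = 1" using c N by simp
  have e2: "?c / real N * ((\<Sum>i<N. 1) * (- (?c * ?m) / ?c\<^sup>2) + (\<Sum>i<N. dir_eig i) * (1 / ?c)) + 0 * ((\<Sum>i<N. 1) * (1 / ?c))
      = (real N - 1) * (real N - 2) / 3"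
  proof -
    have key: "c / n * (n * (- (c * m) / c\<^sup>2) + S * (1 / c)) + 0 * x = - m + S / n"
      if "c \<noteq> 0" "n \<noteq> 0" for c n m S x :: real
      using that by (simp add: field_simps power2_eq_square)
    have "(\<Sum>i<N. 1 :: real) = real N" by simp
    then have E: "?c / real N * ((\<Sum>i<N. 1) * (- (?c * ?m) / ?c\<^sup>2) + (\<Sum>i<N. dir_eig i) * (1 / ?c)) + 0 * ((\<Sum>i<N. 1) * (1 / ?c))
      = - ?m + (\<Sum>i<N. dir_eig i) / real N"
      using c N by (simp only: key)
    have "(\<Sum>i<N. dir_eig i) / real N = (real N + 1) * (2 * real N + 1) / 6" unfolding sum_dir_eig using N by simp
    then show ?thesis unfolding E by (simp add: field_simps)
  qed
  have l: "lin_exp (\<lambda>T. ?c / real N * (G T * (1 / P T))) 1 ((real N - 1) * (real N - 2) / 3)"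
    using L unfolding e1 e2 .
  define err where "err = (\<lambda>T. ?c / real N * (G T * (1 / P T)) - (1 + (real N - 1) * (real N - 2) / 3 * T))"
  have "err \<in> O[at_right 0](\<lambda>T. T\<^sup>2)" using l unfolding lin_exp_def err_def .
  moreover have "\<forall>\<^sub>F T in at_right (0::real). rho1 (A_dir N) T =
             real N * (2 * real N - 1) * (fact (N - 1))\<^sup>2 / 16 ^ (N - 1) * T ^ (2 * N - 2)
               * (1 + (real N - 1) * (real N - 2) / 3 * T + err T)"
    using eventually_checkerboard_inverse[OF N] eventually_at_right_less[of 0]
  proof eventually_elim
    case (elim T)
    then have T: "T > 0" by simp
    interpret checkerboard_inverse N "gram_kernel T" "inverse_gram N T" "alt_sign N" by (rule elim(1))
    have RP: "R = P T / (T / 2) ^ (2 * N - 1)"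
      using checkerboard_row_sums(2)[OF elim(1) T] by (simp add: P_def)
    have P: "P T > 0" using R_pos T unfolding RP by (simp add: zero_less_divide_iff)
    have "(\<Sum>i<N. 1 / gram_kernel T i i) = G T / T"
      using T by (simp add: G_def gram_kernel_def sum_divide_distrib)
    then have "rho1 (A_dir N) T = (1 / R) / (1 / (G T / T))"
      unfolding rho1_def gamma1_A_dir(1)[OF elim(1) less_imp_le[OF T]] gamma_rel_A_dir[OF N T] by simp
    also have "\<dots> = (T / 2) ^ (2 * N - 1) / T * (G T / P T)" unfolding RP by simp
    also have "(T / 2) ^ (2 * N - 1) / T = T ^ (2 * N - 2) / 2 ^ (2 * N - 1)"
    proof -
      have "2 * N - 1 = Suc (2 * N - 2)" using N by simp
      then have "T ^ (2 * N - 1) = T * T ^ (2 * N - 2)" by (simp only: power_Suc)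
      then show ?thesis using T by (simp add: power_divide)
    qed
    also have "T ^ (2 * N - 2) / 2 ^ (2 * N - 1) * (G T / P T)
       = real N / (?c * 2 ^ (2 * N - 1)) * T ^ (2 * N - 2) * (?c / real N * (G T * (1 / P T)))"
      using c N by simp
    also have "\<dots> = real N * (2 * real N - 1) * (fact (N - 1))\<^sup>2 / 16 ^ (N - 1) * T ^ (2 * N - 2)
               * (1 + (real N - 1) * (real N - 2) / 3 * T + err T)"
    proof -
      have rr: "?c / real N * (G T * (1 / P T)) = 1 + (real N - 1) * (real N - 2) / 3 * T + err T"
        unfolding err_def by simp
      show ?thesis unfolding lead_const_eq[OF N] rr ..
    qed
    finally show ?case .
  qed
  ultimately show ?thesis by blast
qed

section \<open>The maximisers for small time\<close>

lemma maximizers_small_time: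
  assumes N: "1 \<le> N"
  shows "\<forall>\<^sub>F T in at_right 0. (\<forall>i<N. 0 < row_mass N T i / (\<Sum>k<N. row_mass N T k)) \<and>
    gamma1_maximizers (A_dir N) T
      = {b \<in> carrier_vec N. \<forall>i<N. (b $ i)\<^sup>2 = row_mass N T i / (\<Sum>k<N. row_mass N T k)}"
  using eventually_checkerboard_inverse[OF N] eventually_at_right_less[of 0]
proof eventually_elim
  case (elim T)
  then have T: "T > 0" by simp
  interpret checkerboard_inverse N "gram_kernel T" "inverse_gram N T" "alt_sign N" by (rule elim(1))
  have q: "r i / R = row_mass N T i / (\<Sum>k<N. row_mass N T k)" if "i < N" for i
    using checkerboard_row_sums[OF elim(1) T] that T by simp
  have "gamma1_maximizers (A_dir N) T = {b \<in> carrier_vec N. \<forall>i<N. (b $ i)\<^sup>2 = r i / R}"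
    by (rule gamma1_A_dir(2)[OF elim(1) less_imp_le[OF T]])
  moreover have "0 < r i / R" if "i < N" for i using r_pos[OF that] R_pos by simp
  ultimately show ?case using q by auto
qed

lemma eventually_maximizers_sign_symmetric:
  assumes N: "1 \<le> N"
  shows "(\<forall>\<^sub>F T in at_right (0::real).
         (\<forall>b\<in>gamma1_maximizers (A_dir N) T. \<forall>b'\<in>gamma1_maximizers (A_dir N) T.
            \<forall>j\<in>{1..N}. \<bar>coef b j\<bar>\<^sup>2 = \<bar>coef b' j\<bar>\<^sup>2) \<and>
         (\<forall>b\<in>gamma1_maximizers (A_dir N) T. \<forall>b'\<in>carrier_vec N.
            (\<forall>j\<in>{1..N}. \<bar>coef b' j\<bar> = \<bar>coef b j\<bar>) \<longrightarrow> b' \<in> gamma1_maximizers (A_dir N) T) \<and>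
         card (gamma1_maximizers (A_dir N) T) = 2 ^ N \<and>
         card (line_through ` gamma1_maximizers (A_dir N) T) = 2 ^ (N - 1))"
  using maximizers_small_time[OF N]
proof eventually_elim
  case (elim T)
  define p where "p = (\<lambda>i. row_mass N T i / (\<Sum>k<N. row_mass N T k))"
  have p: "\<And>i. i < N \<Longrightarrow> 0 < p i" using elim by (simp add: p_def)
  have B: "gamma1_maximizers (A_dir N) T = {b \<in> carrier_vec N. \<forall>i<N. (b $ i)\<^sup>2 = p i}"
    using elim by (simp add: p_def)
  have "\<bar>coef b j\<bar>\<^sup>2 = p (j - 1)" if "b \<in> gamma1_maximizers (A_dir N) T" "j \<in> {1..N}" for b j
    using that by (auto simp: B coef_def)
  moreover have "b' \<in> gamma1_maximizers (A_dir N) T"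
    if b: "b \<in> gamma1_maximizers (A_dir N) T" "b' \<in> carrier_vec N"
      and eq: "\<forall>j\<in>{1..N}. \<bar>coef b' j\<bar> = \<bar>coef b j\<bar>" for b b'
  proof -
    have "(b' $ i)\<^sup>2 = p i" if i: "i < N" for i
    proof -
      have "\<bar>coef b' (Suc i)\<bar> = \<bar>coef b (Suc i)\<bar>" using i by (intro bspec[OF eq]) auto
      then have "\<bar>b' $ i\<bar> = \<bar>b $ i\<bar>" by (simp add: coef_def)
      then have "(b' $ i)\<^sup>2 = (b $ i)\<^sup>2" by (metis power2_abs)
      then show ?thesis using b i by (simp add: B)
    qed
    then show ?thesis using b by (simp add: B)
  qed
  moreover have "card (gamma1_maximizers (A_dir N) T) = 2 ^ N"
    "card (line_through ` gamma1_maximizers (A_dir N) T) = 2 ^ (N - 1)"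
    unfolding B using card_sign_vecs[OF N p] by auto
  ultimately show ?case by simp
qed

lemma maximizers_expansion:
  assumes N: "1 \<le> N" and b: "\<forall>\<^sub>F T in at_right 0. b T \<in> gamma1_maximizers (A_dir N) T" and j: "j \<in> {1..N}"
  shows "(\<lambda>T. \<bar>coef (b T) j\<bar>\<^sup>2
                 - weight N j * (1 + (2 * (real j)\<^sup>2 - 3 * real N + 1) / 4 * T))
              \<in> O[at_right 0](\<lambda>T. T\<^sup>2)"
proof -
  define i where "i = j - 1"
  have i: "i < N" "Suc i = j" using j by (auto simp: i_def)
  have "\<forall>\<^sub>F T in at_right 0. row_mass N T i / (\<Sum>k<N. row_mass N T k) = \<bar>coef (b T) j\<bar>\<^sup>2"
    using b maximizers_small_time[OF N]
    by eventually_elim (use i in \<open>auto simp: coef_def i_def\<close>)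
  with lin_exp_optimal_weights[OF N i(1)]
  have "lin_exp (\<lambda>T. \<bar>coef (b T) j\<bar>\<^sup>2) (weight N j) (weight N j * ((2 * (real j)\<^sup>2 - 3 * real N + 1) / 4))"
    unfolding i(2) by (rule lin_exp_cong)
  then show ?thesis unfolding lin_exp_def by (simp add: algebra_simps)
qed

section \<open>Krylov quantities\<close>

text \<open>Passing through the list of the \<open>f k\<close> allows coefficients indexed by
  \<open>k\<close>, also when some of these vectors coincide and the image set is smaller.\<close>

lemma vspan_image:
  fixes f :: "nat \<Rightarrow> real vec"
  assumes f: "\<And>k. k < m \<Longrightarrow> f k \<in> carrier_vec N"
  shows "vspan N (f ` {..<m}) = {vec N (\<lambda>i. \<Sum>k<m. c k * f k $ i) | c. True}"
proof -
  interpret vs: vec_space "TYPE(real)" N .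
  have set: "set (map f [0..<m]) = f ` {..<m}" by (simp add: lessThan_atLeast0)
  have car: "set (map f [0..<m]) \<subseteq> carrier_vec N" using f by auto
  have "vspan N (f ` {..<m}) = vs.span_list (map f [0..<m])"
    unfolding vspan_def using vs.span_list_as_span[OF car] unfolding set by simp
  also have "\<dots> = {vec N (\<lambda>i. \<Sum>k<m. c k * f k $ i) | c. True}"
  proof -
    have "vs.lincomb_list c (map f [0..<m]) = vec N (\<lambda>i. \<Sum>k<m. c k * f k $ i)" for c
    proof (rule eq_vecI)
      let ?xs = "map (\<lambda>i. c i \<cdot>\<^sub>v map f [0..<m] ! i) [0..<length (map f [0..<m])]"
      have xs: "\<And>x. x \<in> set ?xs \<Longrightarrow> x \<in> carrier_vec N" using f by auto
      fix i assume "i < dim_vec (vec N (\<lambda>i. \<Sum>k<m. c k * f k $ i))"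
      then have i: "i < N" by simp
      have "vs.lincomb_list c (map f [0..<m]) $ i = sum_list (map (\<lambda>x. x $ i) ?xs)"
        unfolding vs.lincomb_list_def by (rule vs.sumlist_vec_index[OF xs i])
      also have "\<dots> = (\<Sum>k<m. c k * f k $ i)"
        using i carrier_vecD[OF f] by (simp add: sum_list_sum_nth lessThan_atLeast0)
      finally show "vs.lincomb_list c (map f [0..<m]) $ i = vec N (\<lambda>i. \<Sum>k<m. c k * f k $ i) $ i"
        using i by simp
    next
      show "dim_vec (vs.lincomb_list c (map f [0..<m])) = dim_vec (vec N (\<lambda>i. \<Sum>k<m. c k * f k $ i))"
        using vs.lincomb_list_carrier[OF car, of c] by (simp add: carrier_vecD)
    qed
    then show ?thesis unfolding vs.span_list_def by auto
  qed
  finally show ?thesis .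
qed

text \<open>The eigenvalues of \<open>A_dir\<close> itself, with their sign: the Krylov matrix is a
  Vandermonde matrix in them. Compared with \<open>dir_eig\<close> the divided-difference weights
  change by a global sign only, so their moduli agree.\<close>

definition node :: "nat \<Rightarrow> real" where "node i = - dir_eig i"

lemma inj_node: "inj_on node S"
  using inj_dir_eig unfolding node_def inj_on_def by auto

lemma krylov_vec_A_dir:
  assumes b: "b \<in> carrier_vec N"
  shows "krylov_vec (A_dir N) b k = vec N (\<lambda>i. node i ^ k * b $ i)"
proof (rule eq_vecI)
  fix i assume "i < dim_vec (vec N (\<lambda>i. node i ^ k * b $ i))"
  then have i: "i < N" by simp
  have "krylov_vec (A_dir N) b k $ i = (\<Sum>j<N. (b $ j * node j ^ k) * (if j = i then 1 else 0))"
    using i b unfolding krylov_vec_def A_dir_alt mat_diag_pow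
    by (simp add: mat_diag_def scalar_prod_def node_def lessThan_atLeast0) (intro sum.cong; auto)
  also have "\<dots> = b $ i * node i ^ k" by (rule sum_mult_delta[OF i])
  finally show "krylov_vec (A_dir N) b k $ i = vec N (\<lambda>i. node i ^ k * b $ i) $ i" using i by simp
qed (simp add: krylov_vec_def A_dir_alt mat_diag_pow, simp add: mat_diag_def)

lemma krylov_span:
  assumes b: "b \<in> carrier_vec N"
  shows "vspan N (krylov_vec (A_dir N) b ` {..<m}) = {vec N (\<lambda>i. \<Sum>k<m. c k * (node i ^ k * b $ i)) | c. True}"
proof -
  have "vspan N (krylov_vec (A_dir N) b ` {..<m}) = {vec N (\<lambda>i. \<Sum>k<m. c k * krylov_vec (A_dir N) b k $ i) | c. True}"
    by (rule vspan_image) (simp add: krylov_vec_A_dir[OF b])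
  moreover have "vec N (\<lambda>i. \<Sum>k<m. c k * krylov_vec (A_dir N) b k $ i) = vec N (\<lambda>i. \<Sum>k<m. c k * (node i ^ k * b $ i))" for c
    by (rule eq_vecI) (auto simp: krylov_vec_A_dir[OF b])
  ultimately show ?thesis by (simp only:)
qed

lemma krylov_coefficients:
  assumes "\<And>i. i < N \<Longrightarrow> b i \<noteq> (0::real)" and i: "i < N"
  shows "(\<Sum>k<N. (\<Sum>j<N. vdm_inv N node k j * (y j / b j)) * (node i ^ k * b i)) = y i"
proof -
  have "(\<Sum>k<N. (\<Sum>j<N. vdm_inv N node k j * (y j / b j)) * (node i ^ k * b i))
      = (\<Sum>k<N. \<Sum>j<N. b i * (y j / b j) * (node i ^ k * vdm_inv N node k j))"
    by (simp add: sum_distrib_left sum_distrib_right mult_ac)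
  also have "\<dots> = (\<Sum>j<N. b i * (y j / b j) * (\<Sum>k<N. node i ^ k * vdm_inv N node k j))"
    by (subst sum.swap) (simp add: sum_distrib_left)
  also have "\<dots> = (\<Sum>j<N. b i * (y j / b j) * (if j = i then 1 else 0))"
    by (intro sum.cong refl arg_cong2[of _ _ _ _ "(*)"]) (use vdm_inv_right[OF inj_node] i in auto)
  also have "\<dots> = b i * (y i / b i)" by (rule sum_mult_delta[OF i])
  finally show ?thesis using assms by simp
qed

lemma cyclic_A_dir_iff:
  "cyclic (A_dir N) b \<longleftrightarrow> b \<in> carrier_vec N \<and> (\<forall>i<N. b $ i \<noteq> 0)"
proof (intro iffI conjI allI impI)
  assume c: "cyclic (A_dir N) b"
  then show b: "b \<in> carrier_vec N" by (simp add: cyclic_def)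
  fix i assume i: "i < N"
  show "b $ i \<noteq> 0"
  proof
    assume z: "b $ i = 0"
    have "unit_vec N i \<in> vspan N (krylov_vec (A_dir N) b ` {..<N})" using c by (simp add: cyclic_def)
    then obtain c where "unit_vec N i = vec N (\<lambda>i. \<Sum>k<N. c k * (node i ^ k * b $ i))"
      unfolding krylov_span[OF b] by blast
    then have "unit_vec N i $ i = (\<Sum>k<N. c k * (node i ^ k * b $ i))" using i by simp
    then show False using i z by simp
  qed
next
  assume a: "b \<in> carrier_vec N \<and> (\<forall>i<N. b $ i \<noteq> 0)"
  have "y \<in> vspan N (krylov_vec (A_dir N) b ` {..<N})" if y: "y \<in> carrier_vec N" for y
  proof -
    define c where "c = (\<lambda>k. \<Sum>j<N. vdm_inv N node k j * (y $ j / b $ j))"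
    have "y = vec N (\<lambda>i. \<Sum>k<N. c k * (node i ^ k * b $ i))"
      unfolding c_def
      using y a krylov_coefficients[of N "\<lambda>i. b $ i" _ "\<lambda>i. y $ i"] by (intro eq_vecI) auto
    then show ?thesis unfolding krylov_span[OF conjunct1[OF a]] by blast
  qed
  moreover have "vspan N (krylov_vec (A_dir N) b ` {..<N}) \<subseteq> carrier_vec N"
    unfolding krylov_span[OF conjunct1[OF a]] by auto
  ultimately show "cyclic (A_dir N) b" using a by (auto simp: cyclic_def)
qed

definition kdual :: "nat \<Rightarrow> real vec \<Rightarrow> nat \<Rightarrow> real" where
  "kdual N b i = divdiff_weight N node i / b $ i"

lemma kdual_pairing:
  assumes "\<And>i. i < N \<Longrightarrow> b $ i \<noteq> 0" "k < N"
  shows "(\<Sum>i<N. kdual N b i * (node i ^ k * b $ i)) = (if k = N - 1 then 1 else 0)"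
proof -
  have "(\<Sum>i<N. kdual N b i * (node i ^ k * b $ i)) = (\<Sum>i<N. divdiff_weight N node i * node i ^ k)"
    using assms(1) by (intro sum.cong refl) (auto simp: kdual_def)
  then show ?thesis using divdiff_weight_moments[OF inj_node assms(2)] by simp
qed

lemma abs_divdiff_weight_node:
  assumes "i < N"
  shows "\<bar>divdiff_weight N node i\<bar> = total_weight N * weight N (Suc i)"
proof -
  have "\<bar>divdiff_weight N node i\<bar> = \<bar>divdiff_weight N dir_eig i\<bar>"
    unfolding divdiff_weight_def node_def abs_divide abs_prod
    by (intro arg_cong2[of _ _ _ _ "(/)"] refl prod.cong) auto
  also have "\<dots> = \<bar>total_weight N * weight N (Suc i)\<bar>"
    unfolding divdiff_weight_eq_weight[OF assms] abs_mult by simp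
  also have "\<dots> = total_weight N * weight N (Suc i)"
    using assms total_weight_pos[of N] weight_pos[of "Suc i" N] by (simp add: less_imp_le)
  finally show ?thesis .
qed

lemma kdual_norm_pos:
  assumes "1 \<le> N" "\<And>i. i < N \<Longrightarrow> b $ i \<noteq> 0"
  shows "0 < (\<Sum>i<N. (kdual N b i)\<^sup>2)"
proof (rule sum_squares_pos[of 0])
  have "\<bar>divdiff_weight N node 0\<bar> \<noteq> 0"
    using assms(1) total_weight_pos[of N] weight_pos[of "Suc 0" N] by (subst abs_divdiff_weight_node) auto
  then show "kdual N b 0 \<noteq> 0" using assms by (auto simp: kdual_def)
qed (use assms in simp)

lemma enorm_minus:
  assumes "u \<in> carrier_vec N" "w \<in> carrier_vec N"
  shows "enorm (u - w) = sqrt (\<Sum>i<N. (u $ i - w $ i)\<^sup>2)"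
  using assms by (simp add: enorm_def scalar_prod_self[of _ N])

text \<open>\<open>kdual N b\<close> pairs to 0 with the Krylov vectors spanning the hyperplane and
  to 1 with the last one, so the distance is the reciprocal of its norm.\<close>

lemma d_last_eq:
  assumes N: "1 \<le> N" and b: "b \<in> carrier_vec N" and nz: "\<And>i. i < N \<Longrightarrow> b $ i \<noteq> 0"
  shows "d_last (A_dir N) b = 1 / sqrt (\<Sum>i<N. (kdual N b i)\<^sup>2)"
proof -
  define u where "u = kdual N b"
  define U where "U = (\<Sum>i<N. (u i)\<^sup>2)"
  have U: "U > 0" unfolding U_def u_def by (rule kdual_norm_pos[OF N nz])
  define v where "v = krylov_vec (A_dir N) b (N - 1)"
  have v: "v = vec N (\<lambda>i. node i ^ (N - 1) * b $ i)" unfolding v_def by (rule krylov_vec_A_dir[OF b])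
  define S where "S = vspan N (krylov_vec (A_dir N) b ` {..<N - 1})"
  have S: "S = {vec N (\<lambda>i. \<Sum>k<N - 1. c k * (node i ^ k * b $ i)) | c. True}"
    unfolding S_def by (rule krylov_span[OF b])
  have pair: "(\<Sum>i<N. u i * (\<Sum>k<m. c k * (node i ^ k * b $ i))) = (\<Sum>k<m. c k * (if k = N - 1 then 1 else 0))"
    if "m \<le> N" for m c
  proof -
    have "(\<Sum>i<N. u i * (\<Sum>k<m. c k * (node i ^ k * b $ i))) = (\<Sum>k<m. \<Sum>i<N. c k * (u i * (node i ^ k * b $ i)))"
      unfolding sum_distrib_left by (subst sum.swap) (simp only: mult_ac)
    also have "\<dots> = (\<Sum>k<m. c k * (if k = N - 1 then 1 else 0))"
      unfolding sum_distrib_left[symmetric] u_def using kdual_pairing[of N b, OF nz] that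
      by (intro sum.cong refl) auto
    finally show ?thesis .
  qed
  have lower: "1 / sqrt U \<le> enorm (v - s)" if s: "s \<in> S" for s
  proof -
    obtain c where c: "s = vec N (\<lambda>i. \<Sum>k<N - 1. c k * (node i ^ k * b $ i))" using s S by auto
    have "(\<Sum>i<N. u i * (v $ i - s $ i)) = (\<Sum>i<N. u i * (node i ^ (N - 1) * b $ i))
        - (\<Sum>i<N. u i * (\<Sum>k<N - 1. c k * (node i ^ k * b $ i)))"
      by (simp add: v c sum_subtractf right_diff_distrib)
    also have "\<dots> = 1 - 0"
      using kdual_pairing[of N b "N - 1", OF nz] N pair[of "N - 1" c] by (simp add: u_def)
    finally have "1 = (\<Sum>i<N. u i * (v $ i - s $ i))\<^sup>2" by simp
    also have "\<dots> \<le> U * (\<Sum>i<N. (v $ i - s $ i)\<^sup>2)"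
      unfolding U_def by (rule Cauchy_Schwarz_ineq_sum)
    finally have "sqrt 1 \<le> sqrt (U * (\<Sum>i<N. (v $ i - s $ i)\<^sup>2))" by (rule real_sqrt_le_mono)
    also have "\<dots> = sqrt U * enorm (v - s)"
      by (subst enorm_minus[of _ N]) (simp_all add: v c real_sqrt_mult)
    finally show ?thesis using U by (simp add: divide_le_eq mult.commute)
  qed
  \<comment> \<open>The orthogonal projection of \<open>v\<close> onto the hyperplane. It belongs to
    \<open>S\<close> because its coefficient at the last Krylov vector equals its pairing with
    \<open>u\<close>, which is 0.\<close>
  define s0 where "s0 = vec N (\<lambda>i. v $ i - u i / U)"
  define c0 where "c0 = (\<lambda>k. \<Sum>j<N. vdm_inv N node k j * (s0 $ j / b $ j))"
  have c0: "s0 $ i = (\<Sum>k<N. c0 k * (node i ^ k * b $ i))" if "i < N" for i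
    unfolding c0_def by (rule krylov_coefficients[of N "\<lambda>i. b $ i" i "\<lambda>i. s0 $ i", OF nz that, symmetric])
  have "(\<Sum>i<N. u i * s0 $ i) = (\<Sum>i<N. u i * (node i ^ (N - 1) * b $ i)) - (\<Sum>i<N. (u i)\<^sup>2) / U"
    by (simp add: s0_def v right_diff_distrib sum_subtractf sum_divide_distrib power2_eq_square)
  also have "\<dots> = 0"
    using kdual_pairing[of N b "N - 1", OF nz] N U by (simp add: u_def[symmetric] U_def[symmetric])
  also have "(\<Sum>i<N. u i * s0 $ i) = (\<Sum>i<N. u i * (\<Sum>k<N. c0 k * (node i ^ k * b $ i)))"
    by (intro sum.cong refl) (simp add: c0)
  also have "\<dots> = c0 (N - 1)" unfolding pair[OF order_refl] by (rule sum_mult_delta) (use N in simp)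
  finally have c0z: "c0 (N - 1) = 0" .
  have "s0 = vec N (\<lambda>i. \<Sum>k<N - 1. c0 k * (node i ^ k * b $ i))"
  proof (rule eq_vecI)
    fix i assume "i < dim_vec (vec N (\<lambda>i. \<Sum>k<N - 1. c0 k * (node i ^ k * b $ i)))"
    then have i: "i < N" by simp
    have "{..<N} = insert (N - 1) {..<N - 1}" using N by auto
    then have "s0 $ i = (\<Sum>k<N - 1. c0 k * (node i ^ k * b $ i))" using c0[OF i] c0z by simp
    then show "s0 $ i = vec N (\<lambda>i. \<Sum>k<N - 1. c0 k * (node i ^ k * b $ i)) $ i" using i by simp
  qed (simp add: s0_def)
  then have s0S: "s0 \<in> S" unfolding S by blast
  have "enorm (v - s0) = sqrt (\<Sum>i<N. (u i / U)\<^sup>2)"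
    by (subst enorm_minus[of _ N]) (simp_all add: v s0_def)
  also have "\<dots> = sqrt (U / U\<^sup>2)" by (simp add: power_divide U_def sum_divide_distrib)
  also have "\<dots> = 1 / sqrt U" using U by (simp add: power2_eq_square real_sqrt_divide)
  finally have "enorm (v - s0) = 1 / sqrt U" .
  then have "1 / sqrt U \<in> (\<lambda>s. enorm (v - s)) ` S" using s0S by (metis image_eqI)
  then have "vec_dist v S = 1 / sqrt U"
    unfolding vec_dist_def by (rule cInf_eq_minimum) (use lower in blast)
  moreover have "cyclic (A_dir N) b" using b nz by (simp add: cyclic_A_dir_iff)
  ultimately show ?thesis unfolding d_last_def v_def S_def U_def u_def by simp
qed

text \<open>The completed squares of \<open>lambda_min_le\<close> with
  \<open>total_weight N * weight N (Suc i)\<close> in place of \<open>r i\<close>; equality again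
  means that every square vanishes. A vector with a zero coordinate is not cyclic, so its value is 0
  by definition and lies strictly below the bound.\<close>

lemma d_last_bound:
  assumes N: "1 \<le> N" and b: "b \<in> unit_sphere N"
  shows "d_last (A_dir N) b \<le> 1 / total_weight N"
    and "d_last (A_dir N) b = 1 / total_weight N \<longleftrightarrow> (\<forall>i<N. (b $ i)\<^sup>2 = weight N (Suc i))"
proof -
  let ?V = "total_weight N"
  have V: "?V > 0" by (rule total_weight_pos[OF N])
  have bc: "b \<in> carrier_vec N" and b1: "(\<Sum>i<N. (b $ i)\<^sup>2) = 1" using b by (auto simp: unit_sphere_iff)
  have w1: "(\<Sum>i<N. weight N (Suc i)) = 1" using sum_shift_Suc[of "weight N" N] sum_weight[OF N] by simp
  have wp: "weight N (Suc i) > 0" if "i < N" for i using that by (intro weight_pos) auto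
  have "d_last (A_dir N) b \<le> 1 / ?V \<and> (d_last (A_dir N) b = 1 / ?V \<longleftrightarrow> (\<forall>i<N. (b $ i)\<^sup>2 = weight N (Suc i)))"
  proof (cases "\<forall>i<N. b $ i \<noteq> 0")
    case False
    then have "\<not> cyclic (A_dir N) b" by (auto simp: cyclic_A_dir_iff)
    then have "d_last (A_dir N) b = 0" by (simp only: d_last_def if_False)
    moreover have "\<not> (\<forall>i<N. (b $ i)\<^sup>2 = weight N (Suc i))" using False wp by force
    ultimately show ?thesis using V by simp
  next
    case True
    then have nz: "\<And>i. i < N \<Longrightarrow> b $ i \<noteq> 0" by blast
    define Y where "Y = (\<Sum>i<N. (kdual N b i)\<^sup>2)"
    have Y0: "Y > 0" unfolding Y_def by (rule kdual_norm_pos[OF N nz])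
    have d: "d_last (A_dir N) b = 1 / sqrt Y" unfolding Y_def by (rule d_last_eq[OF N bc nz])
    let ?t = "\<lambda>i. ?V * weight N (Suc i) / \<bar>b $ i\<bar> - ?V * \<bar>b $ i\<bar>"
    have t2: "(?t i)\<^sup>2 = (kdual N b i)\<^sup>2 - 2 * ?V\<^sup>2 * weight N (Suc i) + ?V\<^sup>2 * (b $ i)\<^sup>2" if i: "i < N" for i
    proof -
      have k: "(kdual N b i)\<^sup>2 = (?V * weight N (Suc i) / \<bar>b $ i\<bar>)\<^sup>2"
        unfolding kdual_def abs_divdiff_weight_node[OF i, symmetric] by (simp add: power_divide)
      have "(a / \<beta> - V * \<beta>)\<^sup>2 = (a / \<beta>)\<^sup>2 - 2 * V * a + V\<^sup>2 * \<beta>\<^sup>2" if "\<beta> \<noteq> 0" for a \<beta> V :: real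
        using that by (simp add: power2_eq_square algebra_simps)
      from this[of "\<bar>b $ i\<bar>" "?V * weight N (Suc i)" ?V] show ?thesis unfolding k using nz[OF i]
        by (simp add: power2_eq_square)
    qed
    have "(\<Sum>i<N. (?t i)\<^sup>2) = (\<Sum>i<N. (kdual N b i)\<^sup>2 - 2 * ?V\<^sup>2 * weight N (Suc i) + ?V\<^sup>2 * (b $ i)\<^sup>2)"
      by (intro sum.cong refl t2) simp
    also have "\<dots> = Y - 2 * ?V\<^sup>2 * 1 + ?V\<^sup>2 * 1"
      unfolding sum.distrib sum_subtractf sum_distrib_left[symmetric] w1 b1 Y_def ..
    finally have sq: "(\<Sum>i<N. (?t i)\<^sup>2) = Y - ?V\<^sup>2" by simp
    moreover have "0 \<le> (\<Sum>i<N. (?t i)\<^sup>2)" by (intro sum_nonneg) auto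
    ultimately have YV: "?V\<^sup>2 \<le> Y" by simp
    then have "?V \<le> sqrt Y" using V by (simp add: real_le_rsqrt)
    then have le: "d_last (A_dir N) b \<le> 1 / ?V" unfolding d using V Y0 by (intro divide_left_mono) auto
    have "d_last (A_dir N) b = 1 / ?V \<longleftrightarrow> sqrt Y = ?V" unfolding d using V Y0 by (auto simp: field_simps)
    also have "\<dots> \<longleftrightarrow> Y = ?V\<^sup>2" by (metis V Y0 less_imp_le real_sqrt_pow2 real_sqrt_unique)
    also have "\<dots> \<longleftrightarrow> (\<Sum>i<N. (?t i)\<^sup>2) = 0" unfolding sq by simp
    also have "\<dots> \<longleftrightarrow> (\<forall>i<N. ?t i = 0)" by (subst sum_nonneg_eq_0_iff) auto
    also have "\<dots> \<longleftrightarrow> (\<forall>i<N. (b $ i)\<^sup>2 = weight N (Suc i))"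
    proof (intro all_cong1 imp_cong refl)
      fix i assume i: "i < N"
      have "?t i = 0 \<longleftrightarrow> weight N (Suc i) = \<bar>b $ i\<bar> * \<bar>b $ i\<bar>"
        using V nz[OF i] by (simp add: field_simps)
      then show "?t i = 0 \<longleftrightarrow> (b $ i)\<^sup>2 = weight N (Suc i)" by (auto simp: power2_eq_square)
    qed
    finally show ?thesis using le by blast
  qed
  then show "d_last (A_dir N) b \<le> 1 / ?V"
    and "d_last (A_dir N) b = 1 / ?V \<longleftrightarrow> (\<forall>i<N. (b $ i)\<^sup>2 = weight N (Suc i))" by auto
qed

lemma optimal_profile:
  assumes N: "1 \<le> N"
  shows "vec N (\<lambda>i. sqrt (weight N (Suc i))) \<in> unit_sphere N"
    and "i < N \<Longrightarrow> (vec N (\<lambda>i. sqrt (weight N (Suc i))) $ i)\<^sup>2 = weight N (Suc i)"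
proof -
  show sq: "(vec N (\<lambda>i. sqrt (weight N (Suc i))) $ i)\<^sup>2 = weight N (Suc i)" if "i < N" for i
    using that weight_pos[of "Suc i" N] by simp
  show "vec N (\<lambda>i. sqrt (weight N (Suc i))) \<in> unit_sphere N"
    using sq sum_shift_Suc[of "weight N" N] sum_weight[OF N] by (simp add: unit_sphere_iff)
qed

lemma delta_max_A_dir:
  assumes N: "1 \<le> N"
  shows "delta_max (A_dir N) = 1 / total_weight N"
  unfolding delta_max_def A_dir_dim
  using optimal_profile[OF N] d_last_bound[OF N]
  by (intro max_over_eqI[of "vec N (\<lambda>i. sqrt (weight N (Suc i)))"]) blast+

text \<open>A reduced QR factorisation of the columns \<open>K k\<close>, \<open>k < m\<close>. The array \<open>C\<close> records that each
  \<open>Q j\<close> lies in their span, which keeps the next Gram--Schmidt residual from vanishing.\<close>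

definition triangular_factors ::
  "nat \<Rightarrow> (nat \<Rightarrow> nat \<Rightarrow> real) \<Rightarrow> nat \<Rightarrow> (nat \<Rightarrow> nat \<Rightarrow> real) \<Rightarrow> (nat \<Rightarrow> nat \<Rightarrow> real) \<Rightarrow> (nat \<Rightarrow> nat \<Rightarrow> real) \<Rightarrow> bool"
  where "triangular_factors N K m Q R C \<longleftrightarrow>
    (\<forall>j<m. \<forall>k<m. (\<Sum>i<N. Q j i * Q k i) = (if j = k then 1 else 0)) \<and>
    (\<forall>k<m. \<forall>i<N. K k i = (\<Sum>j<m. R j k * Q j i)) \<and>
    (\<forall>k<m. \<forall>j<m. k < j \<longrightarrow> R j k = 0) \<and> (\<forall>k<m. 0 < R k k) \<and>
    (\<forall>j<m. \<forall>i<N. Q j i = (\<Sum>k<m. C j k * K k i))"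

lemma gram_schmidt_columns:
  fixes K :: "nat \<Rightarrow> nat \<Rightarrow> real"
  assumes indep: "\<forall>c. (\<forall>i<N. (\<Sum>k<n. c k * K k i) = 0) \<longrightarrow> (\<forall>k<n. c k = 0)"
  shows "m \<le> n \<Longrightarrow> \<exists>Q R C. triangular_factors N K m Q R C"
proof (induction m)
  case 0
  show ?case by (simp add: triangular_factors_def)
next
  case (Suc m)
  then obtain Q R C where "triangular_factors N K m Q R C" by (auto simp: Suc_le_eq)
  then have
    orth: "\<And>j k. j < m \<Longrightarrow> k < m \<Longrightarrow> (\<Sum>i<N. Q j i * Q k i) = (if j = k then 1 else 0)" and
    KR: "\<And>k i. k < m \<Longrightarrow> i < N \<Longrightarrow> K k i = (\<Sum>j<m. R j k * Q j i)" and
    tri: "\<And>j k. k < m \<Longrightarrow> j < m \<Longrightarrow> k < j \<Longrightarrow> R j k = 0" and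
    pos: "\<And>k. k < m \<Longrightarrow> 0 < R k k" and
    QC: "\<And>j i. j < m \<Longrightarrow> i < N \<Longrightarrow> Q j i = (\<Sum>k<m. C j k * K k i)"
    unfolding triangular_factors_def by (elim conjE, blast)+
  define t where "t = (\<lambda>j. \<Sum>i<N. Q j i * K m i)"
  define w where "w = (\<lambda>i. K m i - (\<Sum>j<m. t j * Q j i))"
  \<comment> \<open>Coefficients of the residual \<open>w\<close> in the columns of
    \<open>K\<close>. The entry 1 at column \<open>m\<close> makes a vanishing residual contradict
    independence.\<close>
  define d where "d = (\<lambda>k. if k = m then 1 else if k < m then - (\<Sum>j<m. t j * C j k) else 0)"
  have wd: "w i = (\<Sum>k<Suc m. d k * K k i)" if i: "i < N" for i
  proof -
    have "(\<Sum>j<m. t j * Q j i) = (\<Sum>j<m. \<Sum>k<m. t j * C j k * K k i)"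
      using QC i by (simp add: sum_distrib_left mult.assoc)
    also have "\<dots> = (\<Sum>k<m. (\<Sum>j<m. t j * C j k) * K k i)"
      by (subst sum.swap) (simp add: sum_distrib_right)
    finally show ?thesis by (simp add: w_def d_def sum_negf)
  qed
  define W where "W = (\<Sum>i<N. (w i)\<^sup>2)"
  have "W \<noteq> 0"
  proof
    assume "W = 0"
    then have z: "w i = 0" if "i < N" for i using that sum_nonneg_eq_0_iff[of "{..<N}" "\<lambda>i. (w i)\<^sup>2"] unfolding W_def by simp
    have "(\<Sum>k<n. d k * K k i) = 0" if i: "i < N" for i
    proof -
      have "(\<Sum>k<n. d k * K k i) = (\<Sum>k<Suc m. d k * K k i)"
        using Suc.prems by (intro sum.mono_neutral_right) (auto simp: d_def)
      then show ?thesis using wd[OF i] z[OF i] by simp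
    qed
    then have "\<forall>i<N. (\<Sum>k<n. d k * K k i) = 0" by blast
    with spec[OF indep, of d] have "\<forall>k<n. d k = 0" by (rule mp)
    then have "d m = 0" using Suc.prems by simp
    then show False by (simp add: d_def)
  qed
  moreover have "0 \<le> W" unfolding W_def by (intro sum_nonneg) auto
  ultimately have W: "0 < W" by simp
  define Q' where "Q' = (\<lambda>j i. if j = m then w i / sqrt W else Q j i)"
  define R' where "R' = (\<lambda>j k. if k = m then (if j = m then sqrt W else if j < m then t j else 0) else if j = m then 0 else R j k)"
  define C' where "C' = (\<lambda>j k. if j = m then d k / sqrt W else if k = m then 0 else C j k)"
  have Qw: "(\<Sum>i<N. Q j i * w i) = 0" if j: "j < m" for j
  proof -
    have "(\<Sum>i<N. Q j i * w i) = t j - (\<Sum>i<N. \<Sum>k<m. t k * (Q j i * Q k i))"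
      by (simp add: w_def t_def right_diff_distrib sum_subtractf sum_distrib_left mult_ac)
    also have "(\<Sum>i<N. \<Sum>k<m. t k * (Q j i * Q k i)) = (\<Sum>k<m. t k * (\<Sum>i<N. Q j i * Q k i))"
      by (subst sum.swap) (simp add: sum_distrib_left)
    also have "\<dots> = (\<Sum>k<m. t k * (if k = j then 1 else 0))"
      by (intro sum.cong refl) (use orth[OF j] in auto)
    also have "\<dots> = t j" by (rule sum_mult_delta[OF j])
    finally show ?thesis by simp
  qed
  have ww: "(\<Sum>i<N. w i / sqrt W * (w i / sqrt W)) = 1"
  proof -
    have "w i / sqrt W * (w i / sqrt W) = (w i)\<^sup>2 / W" for i using W by (simp add: power2_eq_square)
    then have "(\<Sum>i<N. w i / sqrt W * (w i / sqrt W)) = W / W"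
      by (simp only: sum_divide_distrib[symmetric] W_def[symmetric])
    then show ?thesis using W by simp
  qed
  have Qw': "(\<Sum>i<N. Q j i * (w i / sqrt W)) = 0" "(\<Sum>i<N. w i / sqrt W * Q j i) = 0" if "j < m" for j
    using Qw[OF that] by (simp_all add: sum_divide_distrib[symmetric] mult.commute)
  have "triangular_factors N K (Suc m) Q' R' C'"
    unfolding triangular_factors_def
  proof (intro conjI allI impI)
    show "(\<Sum>i<N. Q' j i * Q' k i) = (if j = k then 1 else 0)" if "j < Suc m" "k < Suc m" for j k
      using that ww Qw' orth by (auto simp: Q'_def less_Suc_eq)
    show "K k i = (\<Sum>j<Suc m. R' j k * Q' j i)" if "k < Suc m" "i < N" for k i
    proof (cases "k = m")
      case True
      have "(\<Sum>j<m. R' j m * Q' j i) = (\<Sum>j<m. t j * Q j i)" by (intro sum.cong refl) (auto simp: R'_def Q'_def)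
      then show ?thesis using True W by (simp add: R'_def Q'_def w_def)
    next
      case False
      then have k: "k < m" using that by simp
      have "(\<Sum>j<m. R' j k * Q' j i) = (\<Sum>j<m. R j k * Q j i)" using False by (intro sum.cong refl) (auto simp: R'_def Q'_def)
      then show ?thesis using KR[OF k that(2)] False by (simp add: R'_def)
    qed
    show "R' j k = 0" if "k < Suc m" "j < Suc m" "k < j" for j k
      using that tri[of k j] by (auto simp: R'_def less_Suc_eq)
    show "0 < R' k k" if "k < Suc m" for k using that pos W by (auto simp: R'_def less_Suc_eq)
    show "Q' j i = (\<Sum>k<Suc m. C' j k * K k i)" if "j < Suc m" "i < N" for j i
    proof (cases "j = m")
      case True
      have "(\<Sum>k<Suc m. d k / sqrt W * K k i) = (\<Sum>k<Suc m. d k * K k i) / sqrt W"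
        unfolding sum_divide_distrib by simp
      then show ?thesis using True wd[OF that(2)] by (simp add: Q'_def C'_def del: sum.lessThan_Suc)
    next
      case False
      then have j: "j < m" using that by simp
      have "(\<Sum>k<m. C' j k * K k i) = (\<Sum>k<m. C j k * K k i)" using False by (intro sum.cong refl) (auto simp: C'_def)
      then show ?thesis using QC[OF j that(2)] False by (simp add: Q'_def C'_def)
    qed
  qed
  then show ?case by blast
qed

section \<open>The QR factorisation of the Krylov matrix and its last column\<close>

lemma krylov_mat_A_dir:
  assumes "b \<in> carrier_vec N"
  shows "krylov_mat (A_dir N) b = mat N N (\<lambda>(i, k). node i ^ k * b $ i)"
  unfolding krylov_mat_def A_dir_dim
  by (rule eq_matI) (auto simp: mat_of_cols_index krylov_vec_A_dir[OF assms])

text \<open>Independence of the Krylov columns follows from the Vandermonde inverse and the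
  nonvanishing coordinates of \<open>b\<close>. Existence supports the definite description in
  \<open>q_last\<close>, whose uniqueness is supplied by \<open>pos_QR_last_col\<close>.\<close>

lemma pos_QR_exists:
  assumes b: "b \<in> carrier_vec N" and nz: "\<And>i. i < N \<Longrightarrow> b $ i \<noteq> 0"
  shows "\<exists>Q R. is_pos_QR (krylov_mat (A_dir N) b) Q R"
proof -
  have "c k = 0" if c: "\<And>i. i < N \<Longrightarrow> (\<Sum>k<N. c k * (node i ^ k * b $ i)) = 0" and k: "k < N" for c k
  proof -
    have z: "(\<Sum>m<N. node i ^ m * c m) = 0" if i: "i < N" for i
    proof -
      have "b $ i * (\<Sum>m<N. node i ^ m * c m) = (\<Sum>k<N. c k * (node i ^ k * b $ i))"
        by (simp add: sum_distrib_left mult_ac)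
      then show ?thesis using c[OF i] nz[OF i] by simp
    qed
    have "c k = (\<Sum>m<N. c m * (if m = k then 1 else 0))" using sum_mult_delta[OF k, of c] by simp
    also have "\<dots> = (\<Sum>m<N. c m * (\<Sum>i<N. vdm_inv N node k i * node i ^ m))"
      by (intro sum.cong refl arg_cong2[of _ _ _ _ "(*)"]) (use vdm_inv_left[OF inj_node k] in auto)
    also have "\<dots> = (\<Sum>i<N. vdm_inv N node k i * (\<Sum>m<N. node i ^ m * c m))"
      unfolding sum_distrib_left by (subst sum.swap) (simp only: mult_ac)
    also have "\<dots> = 0" using z by simp
    finally show ?thesis .
  qed
  then have "\<forall>c. (\<forall>i<N. (\<Sum>k<N. c k * (node i ^ k * b $ i)) = 0) \<longrightarrow> (\<forall>k<N. c k = 0)"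
    by blast
  from gram_schmidt_columns[where N = N and n = N and m = N and K = "\<lambda>k i. node i ^ k * b $ i", OF this order_refl]
  obtain Q R C where "triangular_factors N (\<lambda>k i. node i ^ k * b $ i) N Q R C" by blast
  then have
    orth: "\<And>j k. j < N \<Longrightarrow> k < N \<Longrightarrow> (\<Sum>i<N. Q j i * Q k i) = (if j = k then 1 else 0)" and
    KR: "\<And>k i. k < N \<Longrightarrow> i < N \<Longrightarrow> node i ^ k * b $ i = (\<Sum>j<N. R j k * Q j i)" and
    tri: "\<And>j k. k < N \<Longrightarrow> j < N \<Longrightarrow> k < j \<Longrightarrow> R j k = 0" and
    pos: "\<And>k. k < N \<Longrightarrow> 0 < R k k"
    unfolding triangular_factors_def by (elim conjE, blast)+
  define Q' where "Q' = mat N N (\<lambda>(i, j). Q j i :: real)"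
  define R' where "R' = mat N N (\<lambda>(j, k). R j k :: real)"
  have "transpose_mat Q' * Q' = 1\<^sub>m N"
    by (rule eq_matI) (auto simp: Q'_def scalar_prod_def orth lessThan_atLeast0[symmetric])
  moreover have "krylov_mat (A_dir N) b = Q' * R'"
    unfolding krylov_mat_A_dir[OF b]
  proof (rule eq_matI)
    fix i k assume "i < dim_row (Q' * R')" "k < dim_col (Q' * R')"
    then have ik: "i < N" "k < N" by (simp_all add: Q'_def R'_def)
    then have "(Q' * R') $$ (i, k) = (\<Sum>j<N. R j k * Q j i)"
      by (simp add: Q'_def R'_def scalar_prod_def lessThan_atLeast0 mult.commute)
    then show "mat N N (\<lambda>(i, k). node i ^ k * b $ i) $$ (i, k) = (Q' * R') $$ (i, k)"
      using KR[OF ik(2,1)] ik by simp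
  qed (simp_all add: Q'_def R'_def)
  moreover have "upper_triangular R'" by (auto simp: R'_def tri)
  ultimately have "is_pos_QR (krylov_mat (A_dir N) b) Q' R'"
    unfolding is_pos_QR_def using pos by (simp add: krylov_mat_A_dir[OF b]) (simp add: Q'_def R'_def)
  then show ?thesis by blast
qed

text \<open>Since Q^T times the Krylov matrix is \<open>R\<close>, its last row shows that the last
  column of \<open>Q\<close> pairs to 0 with all Krylov vectors but the last, where it gives a
  diagonal entry of \<open>R\<close>. Hence it is a multiple of \<open>kdual\<close>; the unit norm
  and the positive diagonal fix the multiple.\<close>

lemma pos_QR_last_col:
  assumes N: "1 \<le> N" and b: "b \<in> carrier_vec N" and nz: "\<And>i. i < N \<Longrightarrow> b $ i \<noteq> 0"
    and QR: "is_pos_QR (krylov_mat (A_dir N) b) Q R"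
  shows "col Q (N - 1) = vec N (\<lambda>i. kdual N b i / sqrt (\<Sum>i<N. (kdual N b i)\<^sup>2))"
proof -
  define U where "U = (\<Sum>i<N. (kdual N b i)\<^sup>2)"
  have U: "U > 0" unfolding U_def by (rule kdual_norm_pos[OF N nz])
  have dim: "dim_row (krylov_mat (A_dir N) b) = N" by (simp add: krylov_mat_A_dir[OF b])
  have Q: "Q \<in> carrier_mat N N" "transpose_mat Q * Q = 1\<^sub>m N" and R: "R \<in> carrier_mat N N"
    and tri: "upper_triangular R" and pos: "\<And>i. i < N \<Longrightarrow> 0 < R $$ (i, i)"
    and K: "krylov_mat (A_dir N) b = Q * R"
    using QR unfolding is_pos_QR_def dim by auto
  define q where "q = (\<lambda>i. Q $$ (i, N - 1))"
  define \<rho> where "\<rho> = R $$ (N - 1, N - 1)"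
  have \<rho>: "\<rho> > 0" unfolding \<rho>_def using pos N by simp
  have "transpose_mat Q * krylov_mat (A_dir N) b = R"
    unfolding K using Q R by (simp add: assoc_mult_mat[of _ N N _ N _ N, symmetric])
  then have RK: "R $$ (N - 1, k) = (\<Sum>i<N. q i * (node i ^ k * b $ i))" if "k < N" for k
    using that Q N by (auto simp: krylov_mat_A_dir[OF b] scalar_prod_def q_def lessThan_atLeast0)
  have RK': "(\<Sum>i<N. q i * (node i ^ k * b $ i)) = (if k = N - 1 then \<rho> else 0)" if "k < N" for k
  proof (cases "k = N - 1")
    case True
    then show ?thesis using RK[OF that] by (simp add: \<rho>_def)
  next
    case False
    then have "k < N - 1" using that by simp
    then have "R $$ (N - 1, k) = 0" using tri R N by (intro upper_triangularD[of R]) auto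
    then show ?thesis using RK[OF that] False by simp
  qed
  have qb: "q j * b $ j = \<rho> * divdiff_weight N node j" if j: "j < N" for j
  proof -
    have "q j * b $ j = (\<Sum>i<N. q i * b $ i * (if i = j then 1 else 0))"
      by (rule sum_mult_delta[OF j, symmetric])
    also have "\<dots> = (\<Sum>i<N. q i * b $ i * (\<Sum>k<N. node i ^ k * vdm_inv N node k j))"
      by (intro sum.cong refl arg_cong2[of _ _ _ _ "(*)"]) (use vdm_inv_right[OF inj_node j] in auto)
    also have "\<dots> = (\<Sum>k<N. vdm_inv N node k j * (\<Sum>i<N. q i * (node i ^ k * b $ i)))"
      unfolding sum_distrib_left by (subst sum.swap) (simp only: mult_ac)
    also have "\<dots> = (\<Sum>k<N. (vdm_inv N node k j * \<rho>) * (if k = N - 1 then 1 else 0))"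
      by (intro sum.cong refl) (simp add: RK')
    also have "\<dots> = vdm_inv N node (N - 1) j * \<rho>" by (rule sum_mult_delta) (use N in simp)
    finally show ?thesis by (simp add: vdm_inv_last[OF j, unfolded One_nat_def])
  qed
  then have q: "q j = \<rho> * kdual N b j" if "j < N" for j
    using nz[OF that] that by (simp add: kdual_def field_simps)
  have "(transpose_mat Q * Q) $$ (N - 1, N - 1) = 1" unfolding Q(2) using N by simp
  then have "(\<Sum>i<N. q i * q i) = 1" using Q(1) N by (simp add: scalar_prod_def q_def lessThan_atLeast0)
  then have "\<rho>\<^sup>2 * U = 1" using q by (simp add: U_def sum_distrib_left power2_eq_square mult_ac)
  then have "\<rho>\<^sup>2 = 1 / U" using U by (simp add: field_simps)
  then have "\<rho> = 1 / sqrt U" using \<rho> by (metis less_imp_le real_sqrt_divide real_sqrt_one real_sqrt_unique)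
  then show ?thesis unfolding U_def[symmetric] using Q(1) q N
    by (intro eq_vecI) (auto simp: q_def)
qed

lemma q_last_eq:
  assumes N: "1 \<le> N" and b: "b \<in> carrier_vec N" and nz: "\<And>i. i < N \<Longrightarrow> b $ i \<noteq> 0"
  shows "q_last (A_dir N) b = vec N (\<lambda>i. kdual N b i / sqrt (\<Sum>i<N. (kdual N b i)\<^sup>2))"
  unfolding q_last_def A_dir_dim
proof (rule the_equality)
  obtain Q R where "is_pos_QR (krylov_mat (A_dir N) b) Q R" using pos_QR_exists[OF b nz] by blast
  then show "\<exists>Q R. is_pos_QR (krylov_mat (A_dir N) b) Q R \<and>
      vec N (\<lambda>i. kdual N b i / sqrt (\<Sum>i<N. (kdual N b i)\<^sup>2)) = col Q (N - 1)"
    using pos_QR_last_col[OF N b nz] by metis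
qed (use pos_QR_last_col[OF N b nz] in blast)

text \<open>For a maximiser of \<open>d_last\<close> the squared coordinates of
  \<open>q_last\<close> are the weights themselves. The signs drop out of the diagonal form, whose
  value is minus the second moment for every maximiser.\<close>

lemma alpha_max_A_dir:
  assumes N: "1 \<le> N"
  shows "alpha_max (A_dir N) = - (3 * real N - 1) / 2"
proof -
  define S where "S = {b \<in> unit_sphere N. d_last (A_dir N) b = delta_max (A_dir N)}"
  have val: "q_last (A_dir N) b \<bullet> (A_dir N *\<^sub>v q_last (A_dir N) b) = - (3 * real N - 1) / 2" if "b \<in> S" for b
  proof -
    let ?V = "total_weight N"
    have V: "?V > 0" by (rule total_weight_pos[OF N])
    have bc: "b \<in> carrier_vec N" using that by (simp add: S_def unit_sphere_iff)
    have b2: "(b $ i)\<^sup>2 = weight N (Suc i)" if "i < N" for i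
      using \<open>b \<in> S\<close> d_last_bound(2)[OF N, of b] that by (simp add: S_def delta_max_A_dir[OF N])
    have nz: "b $ i \<noteq> 0" if "i < N" for i using b2[OF that] weight_pos[of "Suc i" N] that by auto
    have k2: "(kdual N b i)\<^sup>2 = ?V\<^sup>2 * weight N (Suc i)" if i: "i < N" for i
    proof -
      have "(kdual N b i)\<^sup>2 = \<bar>divdiff_weight N node i\<bar>\<^sup>2 / weight N (Suc i)"
        by (simp add: kdual_def power_divide b2[OF i])
      then show ?thesis unfolding abs_divdiff_weight_node[OF i]
        using weight_pos[of "Suc i" N] i by (simp add: power2_eq_square)
    qed
    have w1: "(\<Sum>i<N. weight N (Suc i)) = 1" using sum_shift_Suc[of "weight N" N] sum_weight[OF N] by simp
    have U: "(\<Sum>i<N. (kdual N b i)\<^sup>2) = ?V\<^sup>2"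
    proof -
      have "(\<Sum>i<N. (kdual N b i)\<^sup>2) = (\<Sum>i<N. ?V\<^sup>2 * weight N (Suc i))" by (intro sum.cong refl) (simp add: k2)
      then show ?thesis unfolding sum_distrib_left[symmetric] w1 by simp
    qed
    define q where "q = q_last (A_dir N) b"
    have q: "q = vec N (\<lambda>i. kdual N b i / ?V)" using q_last_eq[OF N bc nz] V unfolding U q_def by simp
    have qc: "q \<in> carrier_vec N" by (simp add: q)
    have "q \<bullet> (A_dir N *\<^sub>v q) = (\<Sum>i<N. \<Sum>j<N. (q $ i * q $ j * - dir_eig j) * (if j = i then 1 else 0))"
      unfolding scalar_prod_mult_mat_vec[OF A_dir_dim(3) qc qc] bform_def
      by (intro sum.cong refl) (auto simp: A_dir_alt mat_diag_def)
    also have "\<dots> = (\<Sum>i<N. q $ i * q $ i * - dir_eig i)"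
      by (intro sum.cong refl sum_mult_delta) auto
    also have "\<dots> = (\<Sum>i<N. - (dir_eig i * weight N (Suc i)))"
    proof (intro sum.cong refl)
      fix i assume "i \<in> {..<N}"
      then have i: "i < N" by simp
      have "q $ i * q $ i = (kdual N b i)\<^sup>2 / ?V\<^sup>2" using i by (simp add: q power2_eq_square)
      also have "\<dots> = weight N (Suc i)" unfolding k2[OF i] using V by simp
      finally show "q $ i * q $ i * - dir_eig i = - (dir_eig i * weight N (Suc i))" by (simp add: mult.commute)
    qed
    also have "\<dots> = - (\<Sum>j = 1..N. (real j)\<^sup>2 * weight N j)"
      using sum_shift_Suc[of "\<lambda>j. (real j)\<^sup>2 * weight N j" N] by (simp add: sum_negf dir_eig_def)
    finally show ?thesis unfolding sum_weight_squares[OF N] q_def minus_divide_left .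
  qed
  let ?b = "vec N (\<lambda>i. sqrt (weight N (Suc i)))"
  have "?b \<in> S"
    unfolding S_def delta_max_A_dir[OF N] using optimal_profile[OF N] d_last_bound(2)[OF N, of ?b] by blast
  then show ?thesis unfolding alpha_max_def A_dir_dim S_def[symmetric]
    using val by (intro max_over_eqI[of ?b]) auto
qed

section \<open>Weak convergence of the profiles\<close>

abbreviation dirM :: "real measure" where "dirM \<equiv> lebesgue_on {0<..<pi}"

lemma dirM_bounded_continuous:
  assumes "continuous_on UNIV (f :: real \<Rightarrow> real)"
  shows "f \<in> borel_measurable dirM"
  using assms by (intro continuous_imp_measurable_on_sets_lebesgue) (auto intro: continuous_on_subset)

lemma integrable_dirM_continuous:
  assumes "continuous_on UNIV (f :: real \<Rightarrow> real)"
  shows "integrable dirM f"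
proof -
  have "f absolutely_integrable_on {0..pi}"
    by (intro absolutely_integrable_continuous_real continuous_on_subset[OF assms]) auto
  then have "f absolutely_integrable_on {0<..<pi}"
    by (rule set_integrable_subset) auto
  then show ?thesis by (simp add: integrable_restrict_space set_integrable_def)
qed

lemma integral_dirM_continuous:
  assumes "continuous_on UNIV (f :: real \<Rightarrow> real)"
  shows "(LINT x|dirM. f x) = integral {0..pi} f"
proof -
  have "(LINT x|dirM. f x) = integral {0<..<pi} f"
    by (rule lebesgue_integral_eq_integral[OF integrable_dirM_continuous[OF assms]]) auto
  also have "\<dots> = integral {0..pi} f" using integral_open_interval[of 0 pi f] by simp
  finally show ?thesis .
qed

lemma continuous_phi: "continuous_on A (phi j)"
  unfolding phi_def[abs_def] by (intro continuous_intros)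

lemma phi_bounded: "\<bar>phi j x\<bar> \<le> 1"
proof -
  have "2 / pi \<le> 1" using pi_ge_two by simp
  then have "sqrt (2 / pi) \<le> 1" by simp
  then have "sqrt (2 / pi) * \<bar>sin (real j * x)\<bar> \<le> 1 * 1" by (intro mult_mono) auto
  then show ?thesis by (simp add: phi_def abs_mult)
qed

lemma integral_cos_int:
  fixes k :: int
  shows "integral {0..pi} (\<lambda>x. cos (of_int k * x)) = (if k = 0 then pi else 0)"
proof (cases "k = 0")
  case False
  have "((\<lambda>x. cos (of_int k * x)) has_integral (sin (of_int k * pi) / of_int k - sin (of_int k * 0) / of_int k)) {0..pi}"
    by (rule fundamental_theorem_of_calculus)
      (use False in \<open>auto intro!: derivative_eq_intros simp: has_real_derivative_iff_has_vector_derivative[symmetric]\<close>)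
  moreover have "sin (of_int k * pi) = 0" using sin_zero_iff_int2 by blast
  ultimately show ?thesis using False by (simp add: integral_unique)
qed simp

lemma phi_orthonormal:
  assumes "1 \<le> i" "1 \<le> j"
  shows "(LINT x|dirM. phi i x * phi j x) = (if i = j then 1 else 0)"
proof -
  have eq: "phi i x * phi j x = (cos (of_int (int i - int j) * x) - cos (of_int (int i + int j) * x)) / pi" for x
  proof -
    have "phi i x * phi j x = (sqrt (2 / pi) * sqrt (2 / pi)) * (sin (real i * x) * sin (real j * x))"
      unfolding phi_def by (simp only: mult_ac)
    also have "sqrt (2 / pi) * sqrt (2 / pi) = 2 / pi" by simp
    also have "2 / pi * (sin (real i * x) * sin (real j * x))
        = 2 / pi * ((cos (real i * x - real j * x) - cos (real i * x + real j * x)) / 2)"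
      by (simp only: sin_times_sin)
    also have "real i * x - real j * x = of_int (int i - int j) * x" by (simp add: algebra_simps)
    also have "real i * x + real j * x = of_int (int i + int j) * x" by (simp add: algebra_simps)
    finally have "phi i x * phi j x
        = 2 / pi * ((cos (of_int (int i - int j) * x) - cos (of_int (int i + int j) * x)) / 2)" .
    moreover have "2 / pi * ((a - b) / 2) = (a - b) / pi" for a b :: real by (simp add: field_simps)
    ultimately show ?thesis by (simp only:)
  qed
  have "(LINT x|dirM. phi i x * phi j x) = integral {0..pi} (\<lambda>x. phi i x * phi j x)"
    by (intro integral_dirM_continuous continuous_on_mult continuous_phi)
  also have "\<dots> = integral {0..pi} (\<lambda>x. (cos (of_int (int i - int j) * x) - cos (of_int (int i + int j) * x)) / pi)"
    by (simp only: eq)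
  also have "\<dots> = (integral {0..pi} (\<lambda>x. cos (of_int (int i - int j) * x))
      - integral {0..pi} (\<lambda>x. cos (of_int (int i + int j) * x))) / pi"
    unfolding integral_divide
    by (subst integral_diff) (auto intro!: integrable_continuous_real continuous_intros)
  also have "\<dots> = (if i = j then 1 else 0)"
    unfolding integral_cos_int using assms by auto
  finally show ?thesis .
qed

lemma L2_phi_integrable:
  assumes g: "g \<in> L2_on {0<..<pi}"
  shows "integrable dirM (\<lambda>x. phi j x * g x)"
proof (rule Bochner_Integration.integrable_bound)
  have "integrable dirM (\<lambda>x. (g x)\<^sup>2)" using g by (simp add: L2_on_def)
  then show "integrable dirM (\<lambda>x. 1 + (g x)\<^sup>2)"
    by (rule Bochner_Integration.integrable_add[OF integrable_dirM_continuous[OF continuous_on_const]])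
  show "(\<lambda>x. phi j x * g x) \<in> borel_measurable dirM"
    by (rule borel_measurable_times[OF dirM_bounded_continuous[OF continuous_phi]]) (use g in \<open>simp add: L2_on_def\<close>)
  show "AE x in dirM. norm (phi j x * g x) \<le> norm (1 + (g x)\<^sup>2)"
  proof (rule AE_I2)
    fix x
    have "\<bar>phi j x\<bar> * \<bar>g x\<bar> \<le> 1 * \<bar>g x\<bar>" by (intro mult_right_mono phi_bounded) auto
    also have "\<dots> \<le> 1 + (g x)\<^sup>2"
      using sum_squares_bound[of 1 "\<bar>g x\<bar>"] by simp
    finally show "norm (phi j x * g x) \<le> norm (1 + (g x)\<^sup>2)" by (simp add: abs_mult)
  qed
qed

definition fourier :: "(real \<Rightarrow> real) \<Rightarrow> nat \<Rightarrow> real" where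
  "fourier g j = (LINT x|dirM. phi j x * g x)"

lemma bessel:
  assumes g: "g \<in> L2_on {0<..<pi}" and J: "finite J" "J \<subseteq> {1..}"
  shows "(\<Sum>j\<in>J. (fourier g j)\<^sup>2) \<le> (LINT x|dirM. (g x)\<^sup>2)"
proof -
  let ?S = "\<lambda>x. \<Sum>j\<in>J. fourier g j * phi j x"
  have ig: "integrable dirM (\<lambda>x. (g x)\<^sup>2)" using g by (simp add: L2_on_def)
  have ip: "integrable dirM (\<lambda>x. phi i x * phi j x)" for i j
    by (intro integrable_dirM_continuous continuous_on_mult continuous_phi)
  have "0 \<le> (LINT x|dirM. (g x - ?S x)\<^sup>2)" by (rule integral_nonneg_AE) simp
  also have "(\<lambda>x. (g x - ?S x)\<^sup>2) = (\<lambda>x. (g x)\<^sup>2 - (\<Sum>j\<in>J. 2 * fourier g j * (phi j x * g x))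
      + (\<Sum>i\<in>J. \<Sum>j\<in>J. fourier g i * fourier g j * (phi i x * phi j x)))"
  proof
    fix x
    have "(?S x)\<^sup>2 = (\<Sum>i\<in>J. \<Sum>j\<in>J. fourier g i * fourier g j * (phi i x * phi j x))"
      unfolding power2_eq_square sum_product by (simp add: mult_ac)
    moreover have "2 * g x * ?S x = (\<Sum>j\<in>J. 2 * fourier g j * (phi j x * g x))"
      by (simp add: sum_distrib_left mult_ac)
    ultimately show "(g x - ?S x)\<^sup>2 = (g x)\<^sup>2 - (\<Sum>j\<in>J. 2 * fourier g j * (phi j x * g x))
      + (\<Sum>i\<in>J. \<Sum>j\<in>J. fourier g i * fourier g j * (phi i x * phi j x))"
      by (simp add: power2_diff)
  qed
  also have "(LINT x|dirM. (g x)\<^sup>2 - (\<Sum>j\<in>J. 2 * fourier g j * (phi j x * g x))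
      + (\<Sum>i\<in>J. \<Sum>j\<in>J. fourier g i * fourier g j * (phi i x * phi j x)))
    = (LINT x|dirM. (g x)\<^sup>2) - (\<Sum>j\<in>J. 2 * fourier g j * fourier g j)
      + (\<Sum>i\<in>J. \<Sum>j\<in>J. fourier g i * fourier g j * (LINT x|dirM. phi i x * phi j x))"
    using ig ip L2_phi_integrable[OF g]
    by (simp add: fourier_def)
  also have "(\<Sum>i\<in>J. \<Sum>j\<in>J. fourier g i * fourier g j * (LINT x|dirM. phi i x * phi j x)) = (\<Sum>i\<in>J. (fourier g i)\<^sup>2)"
  proof (rule sum.cong[OF refl])
    fix i assume i: "i \<in> J"
    have "(\<Sum>j\<in>J. fourier g i * fourier g j * (LINT x|dirM. phi i x * phi j x))
      = (\<Sum>j\<in>J. if i = j then fourier g i * fourier g j else 0)"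
      using i J by (intro sum.cong refl) (subst phi_orthonormal, auto)
    then show "(\<Sum>j\<in>J. fourier g i * fourier g j * (LINT x|dirM. phi i x * phi j x)) = (fourier g i)\<^sup>2"
      using i J by (simp add: power2_eq_square)
  qed
  also have "(\<Sum>j\<in>J. 2 * fourier g j * fourier g j) = 2 * (\<Sum>j\<in>J. (fourier g j)\<^sup>2)"
    by (simp add: sum_distrib_left power2_eq_square mult_ac)
  finally show ?thesis by simp
qed

lemma profile_L2: "profile b \<in> L2_on {0<..<pi}"
proof -
  have c: "continuous_on A (profile b)" for A
    unfolding profile_def[abs_def] by (intro continuous_on_sum continuous_on_mult continuous_on_const continuous_phi)
  then show ?thesis unfolding L2_on_def
    by (auto intro!: dirM_bounded_continuous integrable_dirM_continuous continuous_on_power)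
qed

lemma weight_le: "1 \<le> N \<Longrightarrow> weight N j \<le> 4 * (real j)\<^sup>2 / real N"
proof -
  assume N: "1 \<le> N"
  have "real ((2 * N) choose (N + j)) \<le> real (2 ^ (2 * N))"
    unfolding of_nat_le_iff by (rule binomial_le_pow2)
  then have "real ((2 * N) choose (N + j)) / 4 ^ N \<le> 1" by (simp add: power_mult)
  then have "4 * (real j)\<^sup>2 / real N * (real ((2 * N) choose (N + j)) / 4 ^ N) \<le> 4 * (real j)\<^sup>2 / real N * 1"
    by (intro mult_left_mono) auto
  then show ?thesis unfolding weight_alt[OF N] by simp
qed

lemma weight_nonneg: "0 \<le> weight N j"
  by (simp add: weight_def)

lemma weight_tendsto_0: "(\<lambda>N. weight N j) \<longlonglongrightarrow> 0"
proof (rule tendsto_sandwich)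
  show "\<forall>\<^sub>F N in sequentially. 0 \<le> weight N j" by (simp add: weight_nonneg)
  show "\<forall>\<^sub>F N in sequentially. weight N j \<le> 4 * (real j)\<^sup>2 / real N"
    using eventually_ge_at_top[of 1] by eventually_elim (rule weight_le)
  show "(\<lambda>N. 4 * (real j)\<^sup>2 / real N) \<longlonglongrightarrow> 0" by (rule lim_const_over_n)
qed simp

text \<open>The pairing with \<open>g\<close> is split at an index \<open>J\<close>: the finitely
  many leading coefficients tend to 0, while the tail is bounded by Cauchy-Schwarz, the coefficients
  having total square 1 and the Fourier coefficients of \<open>g\<close> having a small square tail
  by \<open>bessel\<close>.\<close>

lemma profile_weak_conv:
  assumes b: "\<forall>N\<ge>1. b0 N \<in> carrier_vec N \<and> (\<forall>j\<in>{1..N}. \<bar>coef (b0 N) j\<bar>\<^sup>2 = weight N j)"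
  shows "weak_conv_L2 {0<..<pi} (\<lambda>N. profile (b0 N)) (\<lambda>x. 0)"
  unfolding weak_conv_L2_def
proof (intro conjI allI ballI)
  show "profile (b0 n) \<in> L2_on {0<..<pi}" for n by (rule profile_L2)
  show "(\<lambda>x. 0) \<in> L2_on {0<..<pi}" by (simp add: L2_on_def)
  fix g assume g: "g \<in> L2_on {0<..<pi}"
  let ?I = "\<lambda>N. LINT x|dirM. profile (b0 N) x * g x"
  have I: "?I N = (\<Sum>j = 1..N. coef (b0 N) j * fourier g j)" if "1 \<le> N" for N
  proof -
    have "dim_vec (b0 N) = N" using b that by auto
    then have "(\<lambda>x. profile (b0 N) x * g x) = (\<lambda>x. \<Sum>j = 1..N. coef (b0 N) j * (phi j x * g x))"
      by (simp add: profile_def sum_distrib_right mult.assoc)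
    then show ?thesis using L2_phi_integrable[OF g] by (simp add: fourier_def)
  qed
  have "summable (\<lambda>j. (fourier g (Suc j))\<^sup>2)"
  proof (rule summableI_nonneg_bounded)
    fix n
    have "(\<Sum>j<n. (fourier g (Suc j))\<^sup>2) = (\<Sum>j\<in>Suc ` {..<n}. (fourier g j)\<^sup>2)"
      by (subst sum.reindex) auto
    also have "\<dots> \<le> (LINT x|dirM. (g x)\<^sup>2)" by (rule bessel[OF g]) auto
    finally show "(\<Sum>j<n. (fourier g (Suc j))\<^sup>2) \<le> (LINT x|dirM. (g x)\<^sup>2)" .
  qed simp
  then have sm: "summable (\<lambda>j. (fourier g j)\<^sup>2)"
    using summable_Suc_iff[of "\<lambda>j. (fourier g j)\<^sup>2"] by simp
  have "?I \<longlonglongrightarrow> 0"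
  proof (rule LIMSEQ_I)
    fix e :: real assume e: "0 < e"
    have "0 < (e / 2)\<^sup>2" using e by simp
    then obtain J where J: "\<And>n m. J \<le> m \<Longrightarrow> norm (\<Sum>j = m..<n. (fourier g j)\<^sup>2) < (e / 2)\<^sup>2"
      using sm unfolding summable_Cauchy by blast
    have "(\<lambda>N. \<Sum>j = 1..<Suc J. sqrt (weight N j) * \<bar>fourier g j\<bar>) \<longlonglongrightarrow> (\<Sum>j = 1..<Suc J. sqrt 0 * \<bar>fourier g j\<bar>)"
      by (intro tendsto_intros weight_tendsto_0)
    then have "(\<lambda>N. \<Sum>j = 1..<Suc J. sqrt (weight N j) * \<bar>fourier g j\<bar>) \<longlonglongrightarrow> 0" by simp
    then have "\<forall>\<^sub>F N in sequentially. (\<Sum>j = 1..<Suc J. sqrt (weight N j) * \<bar>fourier g j\<bar>) < e / 2"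
      by (rule order_tendstoD) (use e in simp)
    then have "\<forall>\<^sub>F N in sequentially. norm (?I N - 0) < e"
      using eventually_ge_at_top[of "max 1 J"]
    proof eventually_elim
      case (elim N)
      then have N: "1 \<le> N" "J \<le> N" by auto
      have cf: "\<bar>coef (b0 N) j\<bar> = sqrt (weight N j)" if "j \<in> {1..N}" for j
        using b N that by (metis abs_ge_zero real_sqrt_unique)
      have "\<bar>\<Sum>j = 1..<Suc J. coef (b0 N) j * fourier g j\<bar> \<le> (\<Sum>j = 1..<Suc J. sqrt (weight N j) * \<bar>fourier g j\<bar>)"
        using N by (intro order.trans[OF sum_abs] sum_mono) (auto simp: abs_mult cf)
      then have head: "\<bar>\<Sum>j = 1..<Suc J. coef (b0 N) j * fourier g j\<bar> < e / 2" using elim by linarith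
      have "(\<Sum>j = Suc J..<Suc N. coef (b0 N) j * fourier g j)\<^sup>2
          \<le> (\<Sum>j = Suc J..<Suc N. (coef (b0 N) j)\<^sup>2) * (\<Sum>j = Suc J..<Suc N. (fourier g j)\<^sup>2)"
        by (rule Cauchy_Schwarz_ineq_sum)
      also have "\<dots> \<le> 1 * (e / 2)\<^sup>2"
      proof (intro mult_mono)
        have "(\<Sum>j = Suc J..<Suc N. (coef (b0 N) j)\<^sup>2) \<le> (\<Sum>j = 1..N. (coef (b0 N) j)\<^sup>2)"
          by (intro sum_mono2) auto
        also have "\<dots> = (\<Sum>j = 1..N. weight N j)" using b N by (intro sum.cong) auto
        finally show "(\<Sum>j = Suc J..<Suc N. (coef (b0 N) j)\<^sup>2) \<le> 1" using sum_weight[OF N(1)] by simp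
        show "(\<Sum>j = Suc J..<Suc N. (fourier g j)\<^sup>2) \<le> (e / 2)\<^sup>2"
          using J[of "Suc J" "Suc N"] unfolding real_norm_def by linarith
        show "0 \<le> (\<Sum>j = Suc J..<Suc N. (fourier g j)\<^sup>2)" by (rule sum_nonneg) simp
      qed simp
      finally have "\<bar>\<Sum>j = Suc J..<Suc N. coef (b0 N) j * fourier g j\<bar> \<le> e / 2"
        using e by (simp add: abs_le_square_iff[symmetric])
      moreover have "?I N = (\<Sum>j = 1..<Suc J. coef (b0 N) j * fourier g j) + (\<Sum>j = Suc J..<Suc N. coef (b0 N) j * fourier g j)"
        unfolding I[OF N(1)] using N by (subst sum.atLeastLessThan_concat) (auto simp: atLeastLessThanSuc_atLeastAtMost)
      ultimately show ?case using head by simp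
    qed
    then show "\<exists>no. \<forall>n\<ge>no. norm (?I n - 0) < e" by (simp add: eventually_sequentially)
  qed
  then show "?I \<longlonglongrightarrow> (LINT x|dirM. 0 * g x)" by simp
qed

lemma coef_ratio_tendsto:
  assumes b: "\<forall>N\<ge>1. b0 N \<in> carrier_vec N \<and> (\<forall>j\<in>{1..N}. \<bar>coef (b0 N) j\<bar>\<^sup>2 = weight N j)" and j: "1 \<le> j"
  shows "(\<lambda>N. \<bar>coef (b0 N) j\<bar> / \<bar>coef (b0 N) 1\<bar>) \<longlonglongrightarrow> real j"
proof -
  let ?c = "\<lambda>N j. real ((2 * N) choose (N + j)) / real ((2 * N) choose N)"
  have "(\<lambda>N. sqrt ((real j)\<^sup>2 * ?c N j / ?c N 1)) \<longlonglongrightarrow> sqrt ((real j)\<^sup>2 * 1 / 1)"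
    by (intro tendsto_intros choose_ratio_tendsto_1) simp
  moreover have "\<forall>\<^sub>F N in sequentially. sqrt ((real j)\<^sup>2 * ?c N j / ?c N 1) = \<bar>coef (b0 N) j\<bar> / \<bar>coef (b0 N) 1\<bar>"
    using eventually_ge_at_top[of j]
  proof eventually_elim
    case (elim N)
    then have N: "1 \<le> N" using j by simp
    have cf: "\<bar>coef (b0 N) j\<bar> = sqrt (weight N j)" if "j \<in> {1..N}" for j
      using b N that by (metis abs_ge_zero real_sqrt_unique)
    have pos: "real ((2 * N) choose N) > 0" "real ((2 * N) choose (N + 1)) > 0"
      using N by (auto simp: zero_less_binomial_iff)
    have "weight N j / weight N 1 = (real j)\<^sup>2 * ?c N j / ?c N 1"
      unfolding weight_alt[OF N] using N pos by simp
    then show ?case using elim j N by (simp add: cf real_sqrt_divide[symmetric])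
  qed
  ultimately show ?thesis using tendsto_cong by force
qed

lemma H_D_minus_iff:
  assumes c: "(c::real) \<noteq> 0" and b: "\<forall>j\<ge>1. \<bar>b j\<bar> = c * real j"
  shows "b \<in> H_D_minus s \<longleftrightarrow> s > 3 / 2"
proof -
  have eq: "real (Suc k) powr (- 2 * s) * \<bar>b (Suc k)\<bar>\<^sup>2 = c\<^sup>2 * real (Suc k) powr (2 - 2 * s)" for k
  proof -
    have "\<bar>b (Suc k)\<bar> = c * real (Suc k)" using b by simp
    then have "\<bar>b (Suc k)\<bar>\<^sup>2 = c\<^sup>2 * real (Suc k) powr 2" by (simp only: power_mult_distrib powr_numeral of_nat_0_le_iff)
    moreover have "real (Suc k) powr (2 - 2 * s) = real (Suc k) powr (- 2 * s) * real (Suc k) powr 2"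
      by (simp only: powr_add[symmetric]) simp
    ultimately show ?thesis by simp
  qed
  have "b \<in> H_D_minus s \<longleftrightarrow> summable (\<lambda>k. c\<^sup>2 * real (Suc k) powr (2 - 2 * s))"
    unfolding H_D_minus_def mem_Collect_eq eq ..
  also have "\<dots> \<longleftrightarrow> summable (\<lambda>k. real (Suc k) powr (2 - 2 * s))"
    using c by (simp only: summable_cmult_iff) simp
  also have "\<dots> \<longleftrightarrow> summable (\<lambda>k. real k powr (2 - 2 * s))"
    by (rule summable_Suc_iff)
  also have "\<dots> \<longleftrightarrow> 2 - 2 * s < - 1" by (rule summable_real_powr_iff)
  also have "\<dots> \<longleftrightarrow> s > 3 / 2" by auto
  finally show ?thesis .
qed

section \<open>The Maxwell law\<close>

text \<open>Boxes determine the product measure, and on a box the integral of the product density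
  factorises over the coordinates.\<close>

lemma gauss3_density:
  "gauss3 = density (PiM {..<3} (\<lambda>_. lborel)) (\<lambda>z. ennreal ((1 / sqrt (2 * pi)) ^ 3 * exp (- (\<Sum>i<3. (z i)\<^sup>2) / 2)))"
proof -
  define f where "f = (\<lambda>x :: real. ennreal (std_normal_density x))"
  interpret N: product_sigma_finite "\<lambda>_ :: nat. density lborel f"
    unfolding f_def product_sigma_finite_def
    using prob_space_normal_density[of 1 0] prob_space_imp_sigma_finite by auto
  interpret L: product_sigma_finite "\<lambda>_ :: nat. lborel :: real measure"
    by standard
  let ?P = "PiM {..<3 :: nat} (\<lambda>_. lborel :: real measure)"
  have [measurable]: "f \<in> borel_measurable borel" by (simp add: f_def)
  have "density ?P (\<lambda>z. \<Prod>i<3. f (z i)) = PiM {..<3} (\<lambda>_. density lborel f)"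
  proof (rule N.PiM_eqI)
    show "sets (density ?P (\<lambda>z. \<Prod>i<3. f (z i))) = sets (PiM {..<3} (\<lambda>_. density lborel f))"
      unfolding sets_density by (rule sets_PiM_cong) simp_all
    fix A :: "nat \<Rightarrow> real set" assume A: "\<And>i. i \<in> {..<3} \<Longrightarrow> A i \<in> sets (density lborel f)"
    then have A': "\<And>i. i \<in> {..<3} \<Longrightarrow> A i \<in> sets lborel" by simp
    have "emeasure (density ?P (\<lambda>z. \<Prod>i<3. f (z i))) (Pi\<^sub>E {..<3} A)
        = (\<integral>\<^sup>+z. (\<Prod>i<3. f (z i)) * indicator (Pi\<^sub>E {..<3} A) z \<partial>?P)"
      using A' by (intro emeasure_density) (auto intro!: sets_PiM_I_finite)
    also have "\<dots> = (\<integral>\<^sup>+z. (\<Prod>i<3. f (z i) * indicator (A i) (z i)) \<partial>?P)"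
    proof (rule nn_integral_cong)
      fix z assume "z \<in> space ?P"
      then have "indicator (Pi\<^sub>E {..<3} A) z = (\<Prod>i<3. indicator (A i) (z i) :: ennreal)"
        by (auto simp: space_PiM indicator_def PiE_def Pi_def numeral_3_eq_3 lessThan_Suc split: if_splits)
      then show "(\<Prod>i<3. f (z i)) * indicator (Pi\<^sub>E {..<3} A) z = (\<Prod>i<3. f (z i) * indicator (A i) (z i))"
        by (simp add: prod.distrib)
    qed
    also have "\<dots> = (\<Prod>i<3. \<integral>\<^sup>+x. f x * indicator (A i) x \<partial>lborel)"
      using A' by (intro L.product_nn_integral_prod) auto
    also have "\<dots> = (\<Prod>i<3. emeasure (density lborel f) (A i))"
      using A' by (intro prod.cong refl emeasure_density[symmetric]) auto
    finally show "emeasure (density ?P (\<lambda>z. \<Prod>i<3. f (z i))) (Pi\<^sub>E {..<3} A) = (\<Prod>i<3. emeasure (density lborel f) (A i))" .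
  qed auto
  moreover have "(\<Prod>i<3. f (z i)) = ennreal ((1 / sqrt (2 * pi)) ^ 3 * exp (- (\<Sum>i<3. (z i)\<^sup>2) / 2))" for z :: "nat \<Rightarrow> real"
  proof -
    have "(\<Prod>i<3. f (z i)) = ennreal (\<Prod>i<3. std_normal_density (z i))"
      unfolding f_def by (rule prod_ennreal) simp
    also have "(\<Prod>i<3. std_normal_density (z i)) = (1 / sqrt (2 * pi)) ^ 3 * exp (- (\<Sum>i<3. (z i)\<^sup>2) / 2)"
    proof -
      have "(\<Prod>i<3. exp (- (z i)\<^sup>2 / 2)) = exp (\<Sum>i<3. - (z i)\<^sup>2 / 2)" by (simp add: exp_sum)
      also have "(\<Sum>i<3. - (z i)\<^sup>2 / 2) = - (\<Sum>i<3. (z i)\<^sup>2) / 2"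
        by (simp only: sum_negf sum_divide_distrib[symmetric])
      finally show ?thesis unfolding std_normal_density_def prod.distrib by simp
    qed
    finally show ?thesis .
  qed
  ultimately show ?thesis by (simp add: gauss3_def f_def)
qed

text \<open>For positive r the sublevel set is a ball of radius r sqrt 2 and volume 8 sqrt 2 pi r^3
  / 3, whose derivative in r is the density. Half-lines are stable under intersection and generate
  the Borel sets, so agreement on them suffices.\<close>

lemma radial_lborel3:
  "distr (PiM {..<3} (\<lambda>_. lborel)) borel (\<lambda>z :: nat \<Rightarrow> real. sqrt (\<Sum>i<3. (z i)\<^sup>2) / sqrt 2)
    = density lborel (\<lambda>x. ennreal (indicator {0<..} x * (8 * sqrt 2 * pi * x\<^sup>2)))"
  (is "distr ?P borel ?S = density lborel ?h")
proof (rule measure_eqI_generator_eq)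
  let ?c = "8 * sqrt 2 * pi / 3"
  have [measurable]: "?S \<in> borel_measurable ?P" by measurable
  have ball: "emeasure ?P {z \<in> space ?P. ?S z \<le> r} = ennreal (?c * r ^ 3)" if r: "r > 0" for r
  proof -
    have "{z \<in> space ?P. ?S z \<le> r} = {z. sqrt (\<Sum>i<3. (z i)\<^sup>2) \<le> r * sqrt 2} \<inter> space ?P"
      by (auto simp: divide_le_eq)
    then have "emeasure ?P {z \<in> space ?P. ?S z \<le> r} = ennreal (unit_ball_vol (real (card {..<3::nat})) * (r * sqrt 2) ^ card {..<3::nat})"
      using emeasure_cball_aux[of "{..<3::nat}" "r * sqrt 2"] r by simp
    also have "unit_ball_vol (real (card {..<3::nat})) * (r * sqrt 2) ^ card {..<3::nat} = ?c * r ^ 3"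
    proof -
      have "unit_ball_vol 3 = 4 / 3 * pi" by (simp add: eval_unit_ball_vol)
      moreover have "sqrt 2 ^ 3 = 2 * sqrt (2::real)" by (simp add: power3_eq_cube)
      ultimately show ?thesis by (simp add: power_mult_distrib)
    qed
    finally show ?thesis .
  qed
  show "Int_stable (range (\<lambda>a::real. {..a}))" by (auto simp: Int_stable_def)
  show "range (\<lambda>a::real. {..a}) \<subseteq> Pow UNIV" by simp
  show "sets (distr ?P borel ?S) = sigma_sets UNIV (range (\<lambda>a::real. {..a}))"
    by (simp add: borel_eq_atMost)
  show "sets (density lborel ?h) = sigma_sets UNIV (range (\<lambda>a::real. {..a}))"
    by (simp add: borel_eq_atMost)
  show "range (\<lambda>n::nat. {..real n}) \<subseteq> range (\<lambda>a::real. {..a})" by auto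
  show "(\<Union>n. {..real n}) = (UNIV :: real set)" by (auto intro: real_arch_simple)
  have dist: "emeasure (distr ?P borel ?S) {..r} = ennreal (if r > 0 then ?c * r ^ 3 else 0)" for r
  proof -
    have e: "emeasure (distr ?P borel ?S) {..r} = emeasure ?P {z \<in> space ?P. ?S z \<le> r}"
      by (subst emeasure_distr) (auto intro!: arg_cong[of _ _ "emeasure ?P"])
    show ?thesis
    proof (cases "r > 0")
      case False
      have "emeasure ?P {z \<in> space ?P. ?S z \<le> r} \<le> 0 + ennreal \<epsilon>" if "\<epsilon> > 0" for \<epsilon>
      proof -
        \<comment> \<open>The volume formula is available for positive radii; for nonpositive
          \<open>r\<close> the sublevel set lies in a ball of arbitrarily small volume
          \<epsilon>.\<close>
        define t where "t = root 3 (\<epsilon> / ?c)"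
        have "\<epsilon> / ?c > 0" using that by simp
        then have t: "t > 0" "?c * t ^ 3 = \<epsilon>" by (simp_all add: t_def odd_real_root_pow)
        have "r \<le> t" using False t(1) by linarith
        then have "{z \<in> space ?P. ?S z \<le> r} \<subseteq> {z \<in> space ?P. ?S z \<le> t}" by (blast intro: order.trans)
        moreover have "{z \<in> space ?P. ?S z \<le> t} \<in> sets ?P" by measurable
        ultimately have "emeasure ?P {z \<in> space ?P. ?S z \<le> r} \<le> emeasure ?P {z \<in> space ?P. ?S z \<le> t}"
          by (rule emeasure_mono)
        also have "\<dots> = 0 + ennreal \<epsilon>" unfolding ball[OF t(1)] t(2) by (simp only: add_0)
        finally show ?thesis .
      qed
      note eps = this
      have "emeasure ?P {z \<in> space ?P. ?S z \<le> r} \<le> 0" by (rule ennreal_le_epsilon) (rule eps)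
      then show ?thesis using False unfolding e by simp
    qed (simp add: e ball)
  qed
  show "emeasure (distr ?P borel ?S) {..real n} \<noteq> \<infinity>" for n by (simp add: dist)
  fix X assume "X \<in> range (\<lambda>a::real. {..a})"
  then obtain r where X: "X = {..r}" by auto
  have "emeasure (density lborel ?h) {..r} = (\<integral>\<^sup>+x. ?h x * indicator {..r} x \<partial>lborel)"
    by (intro emeasure_density) auto
  also have "\<dots> = ennreal (if r > 0 then ?c * r ^ 3 else 0)"
  proof (cases "r > 0")
    case True
    have "(\<integral>\<^sup>+x. ?h x * indicator {..r} x \<partial>lborel) = (\<integral>\<^sup>+x. ennreal (8 * sqrt 2 * pi * x\<^sup>2) * indicator {0..r} x \<partial>lborel)"
      by (intro nn_integral_cong) (auto simp: indicator_def)
    also have "\<dots> = ennreal (?c * r ^ 3 - ?c * 0 ^ 3)"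
      by (rule nn_integral_FTC_Icc) (use True in \<open>auto intro!: derivative_eq_intros simp: power2_eq_square\<close>)
    finally show ?thesis using True by simp
  next
    case False
    then have "(\<integral>\<^sup>+x. ?h x * indicator {..r} x \<partial>lborel) = (\<integral>\<^sup>+x. 0 \<partial>(lborel :: real measure))"
      by (intro nn_integral_cong) (auto simp: indicator_def)
    then show ?thesis using False by simp
  qed
  finally show "emeasure (distr ?P borel ?S) X = emeasure (density lborel ?h) X"
    unfolding X dist by simp
qed

text \<open>The Gaussian density depends on the point only through its radius, so it multiplies the
  radial image of Lebesgue measure. The constants combine to 8 sqrt 2 pi / (2 pi)^(3/2) = 4 / sqrt
  pi.\<close>

lemma maxwell_law_eq:
  "maxwell_law = distr gauss3 borel (\<lambda>z. sqrt (\<Sum>i<3. (z i)\<^sup>2) / sqrt 2)"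
proof -
  let ?P = "PiM {..<3 :: nat} (\<lambda>_. lborel :: real measure)"
  let ?S = "\<lambda>z :: nat \<Rightarrow> real. sqrt (\<Sum>i<3. (z i)\<^sup>2) / sqrt 2"
  let ?f = "\<lambda>x :: real. ennreal ((1 / sqrt (2 * pi)) ^ 3 * exp (- x\<^sup>2))"
  have [measurable]: "?S \<in> borel_measurable ?P" by measurable
  have sq: "(?S z)\<^sup>2 = (\<Sum>i<3. (z i)\<^sup>2) / 2" for z by (simp add: power_divide sum_nonneg)
  have "gauss3 = density ?P (\<lambda>z. ?f (?S z))" unfolding gauss3_density sq by simp
  then have "distr gauss3 borel ?S = density (distr ?P borel ?S) ?f"
    by (simp add: density_distr)
  also have "\<dots> = density lborel (\<lambda>x. ennreal (indicator {0<..} x * (8 * sqrt 2 * pi * x\<^sup>2)) * ?f x)"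
    unfolding radial_lborel3 by (subst density_density_eq) auto
  also have "(\<lambda>x. ennreal (indicator {0<..} x * (8 * sqrt 2 * pi * x\<^sup>2)) * ?f x)
      = (\<lambda>x. ennreal (indicator {0<..} x * (4 / sqrt pi * x\<^sup>2 * exp (- x\<^sup>2))))"
  proof
    fix x :: real
    have s: "sqrt pi * sqrt pi = pi" "sqrt 2 * sqrt 2 = (2::real)" by simp_all
    have "c * (1 / y) ^ 3 = c / y ^ 3" for c y :: real by (simp add: power_one_over)
    then have "8 * sqrt 2 * pi * (1 / sqrt (2 * pi)) ^ 3 = 8 * sqrt 2 * pi / (sqrt 2 * sqrt pi) ^ 3"
      unfolding real_sqrt_mult .
    also have "(sqrt 2 * sqrt pi) ^ 3 = (sqrt 2 * sqrt 2) * sqrt 2 * ((sqrt pi * sqrt pi) * sqrt pi)"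
      by (simp only: power3_eq_cube mult_ac)
    also have "8 * sqrt 2 * pi / ((sqrt 2 * sqrt 2) * sqrt 2 * ((sqrt pi * sqrt pi) * sqrt pi)) = 4 / sqrt pi"
      unfolding s by simp
    finally have c: "8 * sqrt 2 * pi * (1 / sqrt (2 * pi)) ^ 3 = 4 / sqrt pi" .
    have "ennreal (indicator {0<..} x * (8 * sqrt 2 * pi * x\<^sup>2)) * ?f x
      = ennreal (indicator {0<..} x * (8 * sqrt 2 * pi * x\<^sup>2) * ((1 / sqrt (2 * pi)) ^ 3 * exp (- x\<^sup>2)))"
      by (subst ennreal_mult) auto
    also have "indicator {0<..} x * (8 * sqrt 2 * pi * x\<^sup>2) * ((1 / sqrt (2 * pi)) ^ 3 * exp (- x\<^sup>2))
      = indicator {0<..} x * ((8 * sqrt 2 * pi * (1 / sqrt (2 * pi)) ^ 3) * x\<^sup>2 * exp (- x\<^sup>2))"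
      by (simp only: mult_ac)
    finally show "ennreal (indicator {0<..} x * (8 * sqrt 2 * pi * x\<^sup>2)) * ?f x
      = ennreal (indicator {0<..} x * (4 / sqrt pi * x\<^sup>2 * exp (- x\<^sup>2)))" unfolding c .
  qed
  finally show ?thesis unfolding maxwell_law_def ..
qed

text \<open>The total mass 1 is inherited from \<open>gauss3\<close> through the representation as
  an image law.\<close>

lemma real_distribution_maxwell: "real_distribution maxwell_law"
proof -
  have "prob_space (PiM {..<3 :: nat} (\<lambda>_. density lborel (\<lambda>x. ennreal (std_normal_density x))))"
    by (intro prob_space_PiM prob_space_normal_density) simp
  then interpret prob_space gauss3 unfolding gauss3_def .
  have "(\<lambda>z :: nat \<Rightarrow> real. sqrt (\<Sum>i<3. (z i)\<^sup>2) / sqrt 2) \<in> borel_measurable gauss3"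
    unfolding gauss3_def by measurable
  then show ?thesis unfolding maxwell_law_eq by (rule real_distribution_distr)
qed

section \<open>Distribution functions of the weight laws and their limit\<close>

lemma emeasure_weight_law_eq:
  assumes A: "A \<in> sets borel"
  shows "emeasure (weight_law N) A = ennreal (\<Sum>j\<in>{j\<in>{1..N}. real j / sqrt (real N) \<in> A}. weight N j)"
proof -
  have "emeasure (weight_law N) A = emeasure (point_measure {1..N} (\<lambda>j. ennreal (weight N j))) {j\<in>{1..N}. real j / sqrt (real N) \<in> A}"
    unfolding weight_law_def using A
    by (subst emeasure_distr) (auto simp: space_point_measure sets_point_measure measurable_def intro!: arg_cong[of _ _ "emeasure _"])
  also have "\<dots> = (\<Sum>j\<in>{j\<in>{1..N}. real j / sqrt (real N) \<in> A}. ennreal (weight N j))"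
    by (rule emeasure_point_measure_finite) auto
  also have "\<dots> = ennreal (\<Sum>j\<in>{j\<in>{1..N}. real j / sqrt (real N) \<in> A}. weight N j)"
    by (rule sum_ennreal) (auto simp: weight_def)
  finally show ?thesis .
qed

lemma real_distribution_weight_law:
  assumes "1 \<le> N" shows "real_distribution (weight_law N)"
proof -
  have "emeasure (weight_law N) (space (weight_law N)) = ennreal (\<Sum>j = 1..N. weight N j)"
  proof -
    have "space (weight_law N) = UNIV" by (simp add: weight_law_def)
    moreover have "{j \<in> {1..N}. real j / sqrt (real N) \<in> UNIV} = {1..N}" by auto
    ultimately show ?thesis using emeasure_weight_law_eq[of UNIV N] by (metis borel_open open_UNIV)
  qed
  then have "prob_space (weight_law N)" using sum_weight[OF assms] by (intro prob_spaceI) simp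
  then show ?thesis unfolding real_distribution_def real_distribution_axioms_def
    by (simp add: weight_law_def)
qed

text \<open>The upper summation limit may exceed \<open>N\<close>; the weights beyond
  \<open>N\<close> are 0, so a single formula serves for all nonnegative \<open>x\<close>.\<close>

lemma cdf_weight_law:
  assumes N: "1 \<le> N" and x: "0 \<le> x"
  shows "cdf (weight_law N) x = (\<Sum>j = 1..nat \<lfloor>x * sqrt (real N)\<rfloor>. weight N j)"
proof -
  have "cdf (weight_law N) x = (\<Sum>j\<in>{j\<in>{1..N}. real j / sqrt (real N) \<in> {..x}}. weight N j)"
    unfolding cdf_def measure_def by (simp add: emeasure_weight_law_eq sum_nonneg weight_nonneg)
  also have "\<dots> = (\<Sum>j = 1..nat \<lfloor>x * sqrt (real N)\<rfloor>. weight N j)"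
  proof (rule sum.mono_neutral_left)
    show "{j \<in> {1..N}. real j / sqrt (real N) \<in> {..x}} \<subseteq> {1..nat \<lfloor>x * sqrt (real N)\<rfloor>}"
    proof
      fix j assume "j \<in> {j \<in> {1..N}. real j / sqrt (real N) \<in> {..x}}"
      then have j: "1 \<le> j" "real j \<le> x * sqrt (real N)" using N by (auto simp: divide_le_eq)
      then have "int j \<le> \<lfloor>x * sqrt (real N)\<rfloor>" by (simp add: le_floor_iff)
      then show "j \<in> {1..nat \<lfloor>x * sqrt (real N)\<rfloor>}" using j by auto
    qed
    show "\<forall>j\<in>{1..nat \<lfloor>x * sqrt (real N)\<rfloor>} - {j \<in> {1..N}. real j / sqrt (real N) \<in> {..x}}. weight N j = 0"
    proof
      fix j assume j: "j \<in> {1..nat \<lfloor>x * sqrt (real N)\<rfloor>} - {j \<in> {1..N}. real j / sqrt (real N) \<in> {..x}}"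
      then have "int j \<le> \<lfloor>x * sqrt (real N)\<rfloor>" by auto
      then have "real j \<le> x * sqrt (real N)" by (simp add: le_floor_iff)
      then have "real j / sqrt (real N) \<le> x" using N by (simp add: divide_le_eq)
      then have "N < j" using j by auto
      then show "weight N j = 0" by (rule weight_eq_0)
    qed
  qed simp
  finally show ?thesis .
qed

text \<open>The step density carrying mass \<open>weight N j\<close> on the cell ending at \<open>j / sqrt N\<close>.\<close>

definition step_density :: "nat \<Rightarrow> nat \<Rightarrow> real \<Rightarrow> real" where
  "step_density N m y = (\<Sum>j = 1..m. sqrt (real N) * weight N j *
     indicator {real (j - 1) / sqrt (real N)<..real j / sqrt (real N)} y)"

lemma integral_step_density:
  assumes N: "1 \<le> N"
  shows "(LINT y|lborel. step_density N m y) = (\<Sum>j = 1..m. weight N j)"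
proof -
  have "integrable lborel (indicator {a<..b} :: real \<Rightarrow> real)" for a b :: real
    by (cases "a \<le> b") (auto intro!: integrable_real_indicator)
  then have "(LINT y|lborel. step_density N m y) = (\<Sum>j = 1..m. sqrt (real N) * weight N j *
     measure lborel {real (j - 1) / sqrt (real N)<..real j / sqrt (real N)})"
    unfolding step_density_def by (subst Bochner_Integration.integral_sum) auto
  also have "\<dots> = (\<Sum>j = 1..m. weight N j)"
  proof (rule sum.cong[OF refl])
    fix j assume j: "j \<in> {1..m}"
    have "measure lborel {real (j - 1) / sqrt (real N)<..real j / sqrt (real N)} = 1 / sqrt (real N)"
      using j N by (subst measure_lborel_Ioc) (auto simp: divide_right_mono diff_divide_distrib[symmetric] of_nat_diff)
    then show "sqrt (real N) * weight N j * measure lborel {real (j - 1) / sqrt (real N)<..real j / sqrt (real N)} = weight N j"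
      using N by simp
  qed
  finally show ?thesis .
qed

text \<open>The cells are disjoint and half-open on the left, so for positive \<open>y\<close> the
  only possible index is the ceiling of \<open>y * sqrt N\<close>.\<close>

lemma step_density_eq:
  assumes N: "1 \<le> N"
  shows "step_density N m y = (if 0 < y \<and> nat \<lceil>y * sqrt (real N)\<rceil> \<le> m
    then sqrt (real N) * weight N (nat \<lceil>y * sqrt (real N)\<rceil>) else 0)"
proof -
  let ?J = "nat \<lceil>y * sqrt (real N)\<rceil>"
  have ind: "indicator {real (j - 1) / sqrt (real N)<..real j / sqrt (real N)} y = (if 0 < y \<and> j = ?J then 1 else (0::real))"
    if j: "j \<in> {1..m}" for j
  proof -
    have "y \<in> {real (j - 1) / sqrt (real N)<..real j / sqrt (real N)} \<longleftrightarrow> real j - 1 < y * sqrt (real N) \<and> y * sqrt (real N) \<le> real j"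
      using N j by (auto simp: divide_less_eq le_divide_eq of_nat_diff)
    also have "\<dots> \<longleftrightarrow> \<lceil>y * sqrt (real N)\<rceil> = int j" by (auto simp: ceiling_eq_iff)
    also have "\<dots> \<longleftrightarrow> 0 < y \<and> j = ?J"
    proof
      assume c: "\<lceil>y * sqrt (real N)\<rceil> = int j"
      then have "0 < \<lceil>y * sqrt (real N)\<rceil>" using j by simp
      then have "0 < y * sqrt (real N)" by simp
      then have "0 < y" by (simp add: zero_less_mult_iff)
      then show "0 < y \<and> j = ?J" using c by simp
    next
      assume c: "0 < y \<and> j = ?J"
      then have "0 < y * sqrt (real N)" using N by simp
      then have "0 \<le> \<lceil>y * sqrt (real N)\<rceil>" by linarith
      then show "\<lceil>y * sqrt (real N)\<rceil> = int j" using c by simp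
    qed
    finally show ?thesis by (simp add: indicator_def)
  qed
  have "step_density N m y = (\<Sum>j = 1..m. if j = ?J then (if 0 < y then sqrt (real N) * weight N j else 0) else 0)"
    unfolding step_density_def by (intro sum.cong refl) (subst ind, auto)
  also have "\<dots> = (if ?J \<in> {1..m} then (if 0 < y then sqrt (real N) * weight N ?J else 0) else 0)"
    by simp
  also have "\<dots> = (if 0 < y \<and> ?J \<le> m then sqrt (real N) * weight N ?J else 0)"
  proof (cases "0 < y")
    case True
    then have "0 < y * sqrt (real N)" using N by simp
    then have "1 \<le> ?J" by linarith
    then show ?thesis by simp
  qed simp
  finally show ?thesis .
qed

definition maxwell_density :: "real \<Rightarrow> real" where
  "maxwell_density y = 4 / sqrt pi * y\<^sup>2 * exp (- y\<^sup>2)"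

text \<open>By \<open>weight_alt\<close> the density is 4 (J / sqrt N)^2 times the scaled central
  binomial coefficient times a binomial ratio. The ratio is squeezed between exponentials of - J^2 /
  (N - J) and - J^2 / (N + J), both tending to exp (- y^2) because J / sqrt N tends to y and J / N
  to 0.\<close>

lemma local_limit:
  assumes y: "0 < y"
  shows "(\<lambda>N. sqrt (real N) * weight N (nat \<lceil>y * sqrt (real N)\<rceil>)) \<longlonglongrightarrow> maxwell_density y"
proof -
  define J where "J = (\<lambda>N. nat \<lceil>y * sqrt (real N)\<rceil>)"
  have Jreal: "real (J N) = of_int \<lceil>y * sqrt (real N)\<rceil>" for N
  proof -
    have "0 \<le> y * sqrt (real N)" using y by simp
    then have "0 \<le> \<lceil>y * sqrt (real N)\<rceil>" by linarith
    then show ?thesis unfolding J_def by (rule of_nat_nat)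
  qed
  have Jl: "(\<lambda>N. real (J N) / sqrt (real N)) \<longlonglongrightarrow> y"
    unfolding Jreal using y by real_asymp
  have JN: "\<forall>\<^sub>F N in sequentially. J N < N"
  proof -
    have "(\<lambda>N. real (J N) / real N) \<longlonglongrightarrow> 0" unfolding Jreal using y by real_asymp
    then have "\<forall>\<^sub>F N in sequentially. real (J N) / real N < 1" by (rule order_tendstoD) simp
    then show ?thesis using eventually_gt_at_top[of 0] by eventually_elim (simp add: divide_less_eq)
  qed
  have small: "(\<lambda>N. real (J N) / sqrt (real N) * (1 / sqrt (real N))) \<longlonglongrightarrow> y * 0"
    by (intro tendsto_mult Jl) real_asymp
  have expo: "(\<lambda>N. exp (- ((real (J N) / sqrt (real N))\<^sup>2 / (1 + c * (real (J N) / sqrt (real N) * (1 / sqrt (real N))))))) \<longlonglongrightarrow> exp (- y\<^sup>2)" for c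
  proof -
    have "(\<lambda>N. exp (- ((real (J N) / sqrt (real N))\<^sup>2 / (1 + c * (real (J N) / sqrt (real N) * (1 / sqrt (real N)))))))
      \<longlonglongrightarrow> exp (- (y\<^sup>2 / (1 + c * (y * 0))))"
      by (intro tendsto_intros Jl small) simp
    then show ?thesis by simp
  qed
  let ?r = "\<lambda>N. real ((2 * N) choose (N + J N)) / real ((2 * N) choose N)"
  have "?r \<longlonglongrightarrow> exp (- y\<^sup>2)"
  proof (rule tendsto_sandwich)
    show "\<forall>\<^sub>F N in sequentially. exp (- ((real (J N) / sqrt (real N))\<^sup>2 / (1 + (-1) * (real (J N) / sqrt (real N) * (1 / sqrt (real N)))))) \<le> ?r N"
      using JN eventually_gt_at_top[of 0]
    proof eventually_elim
      case (elim N)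
      have "(real (J N) / sqrt (real N))\<^sup>2 / (1 + (-1) * (real (J N) / sqrt (real N) * (1 / sqrt (real N)))) = (real (J N))\<^sup>2 / real (N - J N)"
        using elim by (simp add: power_divide of_nat_diff field_simps)
      then show ?case using choose_ratio_lower[OF elim(1)] by simp
    qed
    show "\<forall>\<^sub>F N in sequentially. ?r N \<le> exp (- ((real (J N) / sqrt (real N))\<^sup>2 / (1 + 1 * (real (J N) / sqrt (real N) * (1 / sqrt (real N))))))"
      using JN eventually_gt_at_top[of 0]
    proof eventually_elim
      case (elim N)
      have "(real (J N) / sqrt (real N))\<^sup>2 / (1 + 1 * (real (J N) / sqrt (real N) * (1 / sqrt (real N)))) = (real (J N))\<^sup>2 / real (N + J N)"
        using elim by (simp add: power_divide field_simps)
      then show ?case using choose_ratio_upper[of "J N" N] elim by simp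
    qed
  qed (rule expo)+
  then have "(\<lambda>N. 4 * (real (J N) / sqrt (real N))\<^sup>2 * (sqrt (real N) * (real ((2 * N) choose N) / 4 ^ N)) * ?r N)
      \<longlonglongrightarrow> 4 * y\<^sup>2 * (1 / sqrt pi) * exp (- y\<^sup>2)"
    by (intro tendsto_intros Jl central_binomial_asymptotics)
  moreover have "\<forall>\<^sub>F N in sequentially. 4 * (real (J N) / sqrt (real N))\<^sup>2 * (sqrt (real N) * (real ((2 * N) choose N) / 4 ^ N)) * ?r N
      = sqrt (real N) * weight N (J N)"
    using eventually_ge_at_top[of 1]
  proof eventually_elim
    case (elim N)
    have "real ((2 * N) choose N) \<noteq> 0" by simp
    then show ?case unfolding weight_alt[OF elim] using elim by (simp add: power_divide)
  qed
  ultimately have "(\<lambda>N. sqrt (real N) * weight N (J N)) \<longlonglongrightarrow> 4 * y\<^sup>2 * (1 / sqrt pi) * exp (- y\<^sup>2)"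
    by (rule Lim_transform_eventually)
  moreover have "4 * y\<^sup>2 * (1 / sqrt pi) * exp (- y\<^sup>2) = maxwell_density y" by (simp add: maxwell_density_def)
  ultimately show ?thesis unfolding J_def by (simp only:)
qed

text \<open>Supplies the dominating function: only cells ending at most at \<open>x\<close> are
  kept, which bounds the quadratic factor, and off-centre binomial coefficients are at most the
  central one, controlled by \<open>C\<close>.\<close>

lemma step_density_bound:
  assumes N: "1 \<le> N" and x: "0 \<le> x"
    and C: "sqrt (real N) * (real ((2 * N) choose N) / 4 ^ N) \<le> C"
  shows "\<bar>step_density N (nat \<lfloor>x * sqrt (real N)\<rfloor>) y\<bar> \<le> 4 * x\<^sup>2 * C * indicator {0..x} y"
proof (cases "0 < y \<and> nat \<lceil>y * sqrt (real N)\<rceil> \<le> nat \<lfloor>x * sqrt (real N)\<rfloor>")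
  case False
  have "0 \<le> sqrt (real N) * (real ((2 * N) choose N) / 4 ^ N)" by simp
  then have "0 \<le> C" using C by linarith
  moreover have "step_density N (nat \<lfloor>x * sqrt (real N)\<rfloor>) y = 0"
    using False unfolding step_density_eq[OF N] by (simp only: if_False)
  ultimately show ?thesis by simp
next
  case True
  define j where "j = nat \<lceil>y * sqrt (real N)\<rceil>"
  have sN: "0 < sqrt (real N)" using N by simp
  have xN: "0 \<le> x * sqrt (real N)" using x by simp
  have "y * sqrt (real N) \<le> real j" unfolding j_def using True by linarith
  moreover have jx: "real j \<le> x * sqrt (real N)"
  proof -
    have "real j \<le> real (nat \<lfloor>x * sqrt (real N)\<rfloor>)"
      using conjunct2[OF True] unfolding j_def of_nat_le_iff .
    also have "\<dots> \<le> x * sqrt (real N)" using xN by simp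
    finally show ?thesis .
  qed
  ultimately have "y * sqrt (real N) \<le> x * sqrt (real N)" by linarith
  then have yx: "y \<le> x" using sN by simp
  have sq: "(real j / sqrt (real N))\<^sup>2 \<le> x\<^sup>2" using jx sN by (intro power_mono) (auto simp: divide_le_eq)
  have "real ((2 * N) choose (N + j)) \<le> real ((2 * N) choose N)"
  proof (cases "j \<le> N")
    case True
    have "real ((2 * N) choose (N + j)) / real ((2 * N) choose N) \<le> exp (- ((real j)\<^sup>2 / real (N + j)))"
      by (rule choose_ratio_upper[OF True])
    also have "\<dots> \<le> 1" by simp
    finally show ?thesis by (simp add: divide_le_eq)
  next
    case False
    then have z: "(2 * N) choose (N + j) = 0" by (intro binomial_eq_0) simp
    show ?thesis unfolding z by simp
  qed
  then have "real ((2 * N) choose (N + j)) / 4 ^ N \<le> real ((2 * N) choose N) / 4 ^ N" by (simp add: divide_right_mono)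
  then have "sqrt (real N) * (real ((2 * N) choose (N + j)) / 4 ^ N) \<le> sqrt (real N) * (real ((2 * N) choose N) / 4 ^ N)"
    using sN by (intro mult_left_mono) auto
  then have le: "sqrt (real N) * (real ((2 * N) choose (N + j)) / 4 ^ N) \<le> C" using C by linarith
  have "sqrt (real N) * weight N j = 4 * (real j / sqrt (real N))\<^sup>2 * (sqrt (real N) * (real ((2 * N) choose (N + j)) / 4 ^ N))"
    unfolding weight_alt[OF N] using N by (simp add: power_divide)
  also have "\<dots> \<le> 4 * x\<^sup>2 * C" using sq le by (intro mult_mono) auto
  finally have "sqrt (real N) * weight N j \<le> 4 * x\<^sup>2 * C" .
  moreover have "0 \<le> sqrt (real N) * weight N j" by (simp add: weight_def)
  ultimately show ?thesis using True yx unfolding step_density_eq[OF N] j_def[symmetric] by simp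
qed

text \<open>For \<open>0 < y < x\<close> the cell of \<open>y\<close> is kept as soon as (x - y)
  sqrt N is at least 2, since ceiling and floor each cost less than 1. At \<open>y = x\<close>
  membership is undecided, but this is a null set.\<close>

lemma step_density_tendsto:
  assumes x: "0 < x" and y: "y \<noteq> x"
  shows "(\<lambda>N. step_density N (nat \<lfloor>x * sqrt (real N)\<rfloor>) y) \<longlonglongrightarrow> indicator {0<..<x} y * maxwell_density y"
proof -
  consider "y \<le> 0" | "0 < y" "y < x" | "x < y" using y by linarith
  then show ?thesis
  proof cases
    case 1
    have "\<forall>\<^sub>F N in sequentially. step_density N (nat \<lfloor>x * sqrt (real N)\<rfloor>) y = 0"
      using eventually_ge_at_top[of 1] by eventually_elim (use 1 in \<open>simp add: step_density_eq\<close>)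
    then show ?thesis using 1 by (simp add: tendsto_eventually)
  next
    case 2
    have "filterlim (\<lambda>N. (x - y) * sqrt (real N)) at_top sequentially" using 2 by real_asymp
    then have "\<forall>\<^sub>F N in sequentially. 2 \<le> (x - y) * sqrt (real N)" by (simp add: filterlim_at_top)
    then have "\<forall>\<^sub>F N in sequentially. sqrt (real N) * weight N (nat \<lceil>y * sqrt (real N)\<rceil>) = step_density N (nat \<lfloor>x * sqrt (real N)\<rfloor>) y"
      using eventually_ge_at_top[of 1]
    proof eventually_elim
      case (elim N)
      have "y * sqrt (real N) + 2 \<le> x * sqrt (real N)" using elim by (simp add: algebra_simps)
      then have "\<lceil>y * sqrt (real N)\<rceil> \<le> \<lfloor>x * sqrt (real N)\<rfloor>" by linarith
      then have "nat \<lceil>y * sqrt (real N)\<rceil> \<le> nat \<lfloor>x * sqrt (real N)\<rfloor>" by (rule nat_mono)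
      then show ?case using 2 elim by (simp add: step_density_eq)
    qed
    then have "(\<lambda>N. step_density N (nat \<lfloor>x * sqrt (real N)\<rfloor>) y) \<longlonglongrightarrow> maxwell_density y"
      using local_limit[OF 2(1)] by (simp add: tendsto_cong)
    then show ?thesis using 2 by simp
  next
    case 3
    have "\<forall>\<^sub>F N in sequentially. step_density N (nat \<lfloor>x * sqrt (real N)\<rfloor>) y = 0"
      using eventually_ge_at_top[of 1]
    proof eventually_elim
      case (elim N)
      have "\<bar>step_density N (nat \<lfloor>x * sqrt (real N)\<rfloor>) y\<bar>
          \<le> 4 * x\<^sup>2 * (sqrt (real N) * (real ((2 * N) choose N) / 4 ^ N)) * indicator {0..x} y"
        by (rule step_density_bound[OF elim]) (use x in auto)
      then show ?case using 3 by simp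
    qed
    then show ?thesis using 3 by (simp add: tendsto_eventually)
  qed
qed

lemma maxwell_density_nonneg: "0 \<le> maxwell_density y"
  by (simp add: maxwell_density_def)

lemma maxwell_density_measurable [measurable]: "maxwell_density \<in> borel_measurable borel"
  unfolding maxwell_density_def[abs_def] by measurable

lemma emeasure_maxwell:
  assumes [measurable]: "A \<in> sets borel"
  shows "emeasure maxwell_law A = (\<integral>\<^sup>+y. ennreal (indicator (A \<inter> {0<..}) y * maxwell_density y) \<partial>lborel)"
  unfolding maxwell_law_def maxwell_density_def
  by (subst emeasure_density) (auto intro!: nn_integral_cong simp: indicator_def)

lemma cdf_maxwell:
  "cdf maxwell_law x = (LINT y|lborel. indicator {0<..<x} y * maxwell_density y)"
proof -
  have "emeasure maxwell_law {..x} = (\<integral>\<^sup>+y. ennreal (indicator {0<..<x} y * maxwell_density y) \<partial>lborel)"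
  proof (subst emeasure_maxwell, simp, rule nn_integral_cong_AE)
    have "AE y in lborel. y \<noteq> x" by (rule AE_lborel_singleton)
    then show "AE y in lborel. ennreal (indicator ({..x} \<inter> {0<..}) y * maxwell_density y) = ennreal (indicator {0<..<x} y * maxwell_density y)"
      by eventually_elim (auto simp: indicator_def)
  qed
  then show ?thesis unfolding cdf_def measure_def
    by (subst integral_eq_nn_integral) (auto simp: maxwell_density_nonneg)
qed

lemma cdf_weight_law_tendsto: "(\<lambda>N. cdf (weight_law N) x) \<longlonglongrightarrow> cdf maxwell_law x"
proof (cases "0 < x")
  case True
  let ?b = "\<lambda>N. sqrt (real N) * (real ((2 * N) choose N) / 4 ^ N)"
  have "bounded (range ?b)"
    using central_binomial_asymptotics by (rule convergent_imp_bounded)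
  then obtain C where C: "\<And>N. norm (?b N) \<le> C" unfolding bounded_iff by auto
  \<comment> \<open>The index is shifted because the formulas for the step density and the
    distribution function hold for positive \<open>N\<close>.\<close>
  have "(\<lambda>N. LINT y|lborel. step_density (Suc N) (nat \<lfloor>x * sqrt (real (Suc N))\<rfloor>) y)
      \<longlonglongrightarrow> (LINT y|lborel. indicator {0<..<x} y * maxwell_density y)"
  proof (rule integral_dominated_convergence)
    show "integrable lborel (\<lambda>y. 4 * x\<^sup>2 * C * indicator {0..x} y)"
      by (intro integrable_mult_right integrable_real_indicator) (use True in auto)
    have "AE y in lborel. y \<noteq> x" by (rule AE_lborel_singleton)
    then show "AE y in lborel. (\<lambda>N. step_density (Suc N) (nat \<lfloor>x * sqrt (real (Suc N))\<rfloor>) y)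
        \<longlonglongrightarrow> indicator {0<..<x} y * maxwell_density y"
      by eventually_elim (rule LIMSEQ_Suc[OF step_density_tendsto[OF True]])
    show "AE y in lborel. norm (step_density (Suc N) (nat \<lfloor>x * sqrt (real (Suc N))\<rfloor>) y) \<le> 4 * x\<^sup>2 * C * indicator {0..x} y" for N
    proof (rule AE_I2)
      fix y
      have "?b (Suc N) \<le> C" using C[of "Suc N"] unfolding real_norm_def by linarith
      then show "norm (step_density (Suc N) (nat \<lfloor>x * sqrt (real (Suc N))\<rfloor>) y) \<le> 4 * x\<^sup>2 * C * indicator {0..x} y"
        unfolding real_norm_def using True by (intro step_density_bound) auto
    qed
    show "step_density (Suc N) (nat \<lfloor>x * sqrt (real (Suc N))\<rfloor>) \<in> borel_measurable lborel" for N
      unfolding step_density_def[abs_def] by measurable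
  qed measurable
  then have "(\<lambda>N. cdf (weight_law (Suc N)) x) \<longlonglongrightarrow> cdf maxwell_law x"
    using True by (simp only: integral_step_density cdf_maxwell cdf_weight_law less_imp_le Suc_le_mono le0 One_nat_def)
  then show ?thesis by (rule LIMSEQ_imp_Suc)
next
  case False
  have "cdf (weight_law N) x = 0" for N
  proof -
    have "{j \<in> {1..N}. real j / sqrt (real N) \<in> {..x}} = {}"
    proof -
      have "x < real j / sqrt (real N)" if "j \<in> {1..N}" for j
      proof -
        have "0 < real j / sqrt (real N)" using that by simp
        then show ?thesis using False by linarith
      qed
      then show ?thesis by (force simp: not_le[symmetric])
    qed
    then have "emeasure (weight_law N) {..x} = 0"
      using emeasure_weight_law_eq[of "{..x}" N] by (metis atMost_borel ennreal_0 sum.empty)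
    then show ?thesis unfolding cdf_def measure_def by simp
  qed
  moreover have "cdf maxwell_law x = 0"
  proof -
    have "{0<..<x} = {}" using False by auto
    then show ?thesis unfolding cdf_maxwell by simp
  qed
  ultimately show ?thesis by simp
qed

lemma weak_conv_m_weight_law: "weak_conv_m weight_law maxwell_law"
  unfolding weak_conv_m_def weak_conv_def using cdf_weight_law_tendsto by blast

text \<open>\<open>f\<close> may oscillate at 0, so its extension \<open>g\<close> by zero is
  bounded but possibly discontinuous there. The limit law gives no mass to \<open>{..0}\<close>,
  hence convergence of integrals extends to \<open>g\<close>.\<close>

lemma weak_conv_on_weight_law: "weak_conv_on {0<..} weight_law maxwell_law"
  unfolding weak_conv_on_def
proof (intro allI impI)
  fix f :: "real \<Rightarrow> real"
  assume f: "continuous_on {0<..} f" and b: "bounded (f ` {0<..})"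
  define g where "g = (\<lambda>x. indicator {0<..} x *\<^sub>R f x)"
  obtain B where B: "\<And>x. x \<in> {0<..} \<Longrightarrow> norm (f x) \<le> B" using b unfolding bounded_iff by auto
  have gB: "norm (g x) \<le> max B 0" for x using B[of x] by (auto simp: g_def indicator_def)
  have gm: "g \<in> borel_measurable borel"
    unfolding g_def by (rule borel_measurable_continuous_on_indicator) (use f in auto)
  have cont: "isCont g x" if "x \<noteq> 0" for x
  proof (cases "0 < x")
    case True
    have "isCont f x" using f True by (simp add: continuous_on_eq_continuous_at)
    moreover have "\<forall>\<^sub>F y in nhds x. g y = f y"
      using eventually_nhds_in_open[of "{0<..}" x] True by (auto elim!: eventually_mono simp: g_def)
    ultimately show ?thesis by (simp add: isCont_cong)
  next
    case False
    then have "x < 0" using that by simp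
    then have "\<forall>\<^sub>F y in nhds x. g y = 0"
      using eventually_nhds_in_open[of "{..<0}" x] by (auto elim!: eventually_mono simp: g_def)
    then show ?thesis using isCont_cong[of g "\<lambda>_. 0" x] by simp
  qed
  have "emeasure maxwell_law {x. \<not> isCont g x} \<le> emeasure maxwell_law {..0}"
  proof (rule emeasure_mono)
    show "{x. \<not> isCont g x} \<subseteq> {..0}" using cont by (auto simp: not_less[symmetric])
  qed (simp add: maxwell_law_def)
  also have "\<dots> = 0"
  proof -
    have "{..0} \<inter> {0<..} = ({} :: real set)" by auto
    then show ?thesis by (simp add: emeasure_maxwell)
  qed
  finally have disc: "emeasure maxwell_law {x. \<not> isCont g x} = 0" by simp
  \<comment> \<open>\<open>weight_law 0\<close> is the zero measure; the shifted sequence consists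
    of probability laws.\<close>
  have "weak_conv_m (\<lambda>n. weight_law (Suc n)) maxwell_law"
    unfolding weak_conv_m_def weak_conv_def using LIMSEQ_Suc[OF cdf_weight_law_tendsto] by blast
  from weak_conv_imp_bdd_ae_continuous_conv[OF real_distribution_weight_law real_distribution_maxwell this disc gB gm]
  have "(\<lambda>n. integral\<^sup>L (weight_law (Suc n)) g) \<longlonglongrightarrow> integral\<^sup>L maxwell_law g" by simp
  then have "(\<lambda>n. integral\<^sup>L (weight_law n) g) \<longlonglongrightarrow> integral\<^sup>L maxwell_law g" by (rule LIMSEQ_imp_Suc)
  then show "(\<lambda>n. LINT x:{0<..}|weight_law n. f x) \<longlonglongrightarrow> (LINT x:{0<..}|maxwell_law. f x)"
    by (simp add: g_def set_lebesgue_integral_def)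
qed

theorem proposition5p1:
  shows
   "\<comment> \<open>(i)\<close>
    (\<forall>N::nat. 1 \<le> N \<longrightarrow>
      (\<forall>\<^sub>F T in at_right (0::real).
         (\<forall>b\<in>gamma1_maximizers (A_dir N) T. \<forall>b'\<in>gamma1_maximizers (A_dir N) T.
            \<forall>j\<in>{1..N}. \<bar>coef b j\<bar>\<^sup>2 = \<bar>coef b' j\<bar>\<^sup>2) \<and>
         (\<forall>b\<in>gamma1_maximizers (A_dir N) T. \<forall>b'\<in>carrier_vec N.
            (\<forall>j\<in>{1..N}. \<bar>coef b' j\<bar> = \<bar>coef b j\<bar>) \<longrightarrow> b' \<in> gamma1_maximizers (A_dir N) T) \<and>
         card (gamma1_maximizers (A_dir N) T) = 2 ^ N \<and>
         card (line_through ` gamma1_maximizers (A_dir N) T) = 2 ^ (N - 1)) \<and>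
      (\<forall>b :: real \<Rightarrow> real vec.
         (\<forall>\<^sub>F T in at_right 0. b T \<in> gamma1_maximizers (A_dir N) T) \<longrightarrow>
         (\<forall>j\<in>{1..N}.
            (\<lambda>T. \<bar>coef (b T) j\<bar>\<^sup>2
                 - weight N j * (1 + (2 * (real j)\<^sup>2 - 3 * real N + 1) / 4 * T))
              \<in> O[at_right 0](\<lambda>T. T\<^sup>2)))) \<and>
    \<comment> \<open>(ii)\<close>
    (\<forall>N::nat. 1 \<le> N \<longrightarrow> (\<forall>j\<in>{1..N}. 0 < weight N j) \<and> (\<Sum>j = 1..N. weight N j) = 1) \<and>
    weak_conv_on {0<..} weight_law maxwell_law \<and>
    weak_conv_m weight_law maxwell_law \<and>
    maxwell_law = distr gauss3 borel (\<lambda>z. sqrt (\<Sum>i<3. (z i)\<^sup>2) / sqrt 2) \<and>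
    \<comment> \<open>(iii)\<close>
    (\<forall>b0 :: nat \<Rightarrow> real vec.
       (\<forall>N\<ge>1. b0 N \<in> carrier_vec N \<and> (\<forall>j\<in>{1..N}. \<bar>coef (b0 N) j\<bar>\<^sup>2 = weight N j)) \<longrightarrow>
       weak_conv_L2 {0<..<pi} (\<lambda>N. profile (b0 N)) (\<lambda>x. 0) \<and>
       (\<forall>j\<ge>1. (\<lambda>N. \<bar>coef (b0 N) j\<bar> / \<bar>coef (b0 N) 1\<bar>) \<longlonglongrightarrow> real j)) \<and>
    \<comment> \<open>(iv)\<close>
    (\<forall>(b :: nat \<Rightarrow> real) (c :: real) (s :: real).
       c \<noteq> 0 \<longrightarrow> (\<forall>j\<ge>1. \<bar>b j\<bar> = c * real j) \<longrightarrow> (b \<in> H_D_minus s \<longleftrightarrow> s > 3 / 2)) \<and>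
    \<comment> \<open>(v)\<close>
    (\<forall>N::nat. 1 \<le> N \<longrightarrow>
       delta_max (A_dir N) = fact (2 * N) / (real N * 2 ^ (2 * N - 1)) \<and>
       alpha_max (A_dir N) = - (3 * real N - 1) / 2 \<and>
       (\<exists>r. r \<in> O[at_right 0](\<lambda>T. T\<^sup>2) \<and>
         (\<forall>\<^sub>F T in at_right (0::real).
           rho1 (A_dir N) T =
             real N * (2 * real N - 1) * (fact (N - 1))\<^sup>2 / 16 ^ (N - 1) * T ^ (2 * N - 2)
               * (1 + (real N - 1) * (real N - 2) / 3 * T + r T))))"
proof (intro conjI allI impI ballI)
  fix N :: nat assume N: "1 \<le> N"
  show "\<forall>\<^sub>F T in at_right (0::real).
         (\<forall>b\<in>gamma1_maximizers (A_dir N) T. \<forall>b'\<in>gamma1_maximizers (A_dir N) T.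
            \<forall>j\<in>{1..N}. \<bar>coef b j\<bar>\<^sup>2 = \<bar>coef b' j\<bar>\<^sup>2) \<and>
         (\<forall>b\<in>gamma1_maximizers (A_dir N) T. \<forall>b'\<in>carrier_vec N.
            (\<forall>j\<in>{1..N}. \<bar>coef b' j\<bar> = \<bar>coef b j\<bar>) \<longrightarrow> b' \<in> gamma1_maximizers (A_dir N) T) \<and>
         card (gamma1_maximizers (A_dir N) T) = 2 ^ N \<and>
         card (line_through ` gamma1_maximizers (A_dir N) T) = 2 ^ (N - 1)"
    by (rule eventually_maximizers_sign_symmetric[OF N])
  show "delta_max (A_dir N) = fact (2 * N) / (real N * 2 ^ (2 * N - 1))"
    unfolding delta_max_A_dir[OF N] total_weight_def by simp
  show "alpha_max (A_dir N) = - (3 * real N - 1) / 2"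
    by (rule alpha_max_A_dir[OF N])
  show "\<exists>r. r \<in> O[at_right 0](\<lambda>T. T\<^sup>2) \<and>
         (\<forall>\<^sub>F T in at_right (0::real).
           rho1 (A_dir N) T =
             real N * (2 * real N - 1) * (fact (N - 1))\<^sup>2 / 16 ^ (N - 1) * T ^ (2 * N - 2)
               * (1 + (real N - 1) * (real N - 2) / 3 * T + r T))"
    by (rule rho1_expansion[OF N])
  show "(\<Sum>j = 1..N. weight N j) = 1" by (rule sum_weight[OF N])
next
  fix N :: nat and b :: "real \<Rightarrow> real vec" and j
  assume "1 \<le> N" "\<forall>\<^sub>F T in at_right 0. b T \<in> gamma1_maximizers (A_dir N) T" "j \<in> {1..N}"
  then show "(\<lambda>T. \<bar>coef (b T) j\<bar>\<^sup>2
                 - weight N j * (1 + (2 * (real j)\<^sup>2 - 3 * real N + 1) / 4 * T))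
              \<in> O[at_right 0](\<lambda>T. T\<^sup>2)"
    by (rule maximizers_expansion)
next
  fix N j :: nat assume "j \<in> {1..N}"
  then show "0 < weight N j" by (rule weight_pos)
next
  show "weak_conv_on {0<..} weight_law maxwell_law" by (rule weak_conv_on_weight_law)
  show "weak_conv_m weight_law maxwell_law" by (rule weak_conv_m_weight_law)
  show "maxwell_law = distr gauss3 borel (\<lambda>z. sqrt (\<Sum>i<3. (z i)\<^sup>2) / sqrt 2)"
    by (rule maxwell_law_eq)
next
  fix b0 :: "nat \<Rightarrow> real vec"
  assume b0: "\<forall>N\<ge>1. b0 N \<in> carrier_vec N \<and> (\<forall>j\<in>{1..N}. \<bar>coef (b0 N) j\<bar>\<^sup>2 = weight N j)"
  show "weak_conv_L2 {0<..<pi} (\<lambda>N. profile (b0 N)) (\<lambda>x. 0)" by (rule profile_weak_conv[OF b0])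
  show "(\<lambda>N. \<bar>coef (b0 N) j\<bar> / \<bar>coef (b0 N) 1\<bar>) \<longlonglongrightarrow> real j" if "1 \<le> j" for j
    using b0 that by (rule coef_ratio_tendsto)
next
  fix b :: "nat \<Rightarrow> real" and c s :: real
  assume "c \<noteq> 0" "\<forall>j\<ge>1. \<bar>b j\<bar> = c * real j"
  then show "(b \<in> H_D_minus s) = (s > 3 / 2)" by (rule H_D_minus_iff)
qed


end
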